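(* Let $N\ge1$ be an integer and $\sigma>0$. The function $m\longmapsto E_{min}(m)$ has the following properties. (i) If $\sigma N>4$, then $E_{min}(m)=-\infty$ for all $m>0$. For the following statements assume that $0<\sigma N\le4$. (ii) The function $E_{min}$ is concave on $(0,\infty)$. (iii) For any $m>0$ there holds $E_{min}(m)\le-m$. (iv) $\lim_{m\downarrow0}E_{min}(m)=0$ and $\lim_{m\downarrow0}\frac{E_{min}(m)}m=-1$. (v) If $0<\sigma N<4$, then $E_{min}(m)>-\infty$ for all $m>0$, and there exist $A\in\mathbb{R}$, $B>0$ such that $E_{min}(m)<Am-Bm^{\sigma+1}$ for all $m>0$ (thus, in particular, $\frac{E_{min}(m)}m\to-\infty$ as $m\to\infty$). Moreover, for any $k_1,k_2>0$ the set $\{u\in H^2(\mathbb{R}^N):\|u\|_{L^2}\le k_1\text{ and }E(u)\le k_2\}$ is bounded in $H^2(\mathbb{R}^N)$. (vi) Assume that $\sigma N=4$ and let $k_*=(\sigma+1)^{\frac1\sigma}B(N,\sigma)^{-\frac1\sigma}$. Then $E_{min}(m)$ is finite for any $m\in(0,k_* )$ and $E_{min}(m)=-\infty$ if $m\ge k_*$. In addition, for any $k_1<k_*$ and any $k_2>0$, the set $\{u\in H^2(\mathbb{R}^N):\|u\|_{L^2}^2\le k_1\text{ and }E(u)\le k_2\}$ is bounded in $H^2(\mathbb{R}^N)$.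
   Context: All functions are complex-valued. For $u\in H^2(\mathbb{R}^N)$, $$E(u)=\int_{\mathbb{R}^N}|\Delta u|^2dx-2\int_{\mathbb{R}^N}|\nabla u|^2dx-\frac1{\sigma+1}\int_{\mathbb{R}^N}|u|^{2\sigma+2}dx\in[-\infty,\infty)$$ (with $E(u)=-\infty$ if $u\notin L^{2\sigma+2}$), and for $m>0$, $E_{min}(m)=\inf\{E(u):u\in H^2(\mathbb{R}^N),\ \|u\|_{L^2}^2=m\}\in[-\infty,\infty)$. Concavity is understood for functions with values in $[-\infty,\infty)$. The best Gagliardo–Nirenberg constant is $$B(N,\sigma)=\sup_{u\in H^2(\mathbb{R}^N),\,u\ne0}\frac{\|u\|_{L^{2\sigma+2}}^{2\sigma+2}}{\|\Delta u\|_{L^2}^{\frac{\sigma N}2}\|u\|_{L^2}^{2+2\sigma-\frac{\sigma N}2}}.$$ *)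

theory Defs
  imports "HOL-Analysis.Analysis"
begin

text \<open>
  The space \<open>\<real>\<^sup>N\<close> is \<open>real ^ 'n\<close> with \<open>N = CARD('n)\<close>. Elements of
  Lebesgue and Sobolev spaces are represented by Borel measurable functions; two functions
  that agree almost everywhere represent the same element, and every quantity below depends only
  on the almost-everywhere class of its argument.
\<close>

definition pderivative :: "'n \<Rightarrow> (real ^ 'n \<Rightarrow> real) \<Rightarrow> real ^ 'n \<Rightarrow> real" where
  "pderivative i \<phi> x = frechet_derivative \<phi> (at x) (axis i 1)"

primrec Ck :: "nat \<Rightarrow> (real ^ 'n \<Rightarrow> real) \<Rightarrow> bool" where
  "Ck 0 \<phi> \<longleftrightarrow> continuous_on UNIV \<phi>"
| "Ck (Suc k) \<phi> \<longleftrightarrow> \<phi> differentiable_on UNIV \<and> (\<forall>i. Ck k (pderivative i \<phi>))"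

definition test_function :: "(real ^ 'n \<Rightarrow> real) \<Rightarrow> bool" where
  "test_function \<phi> \<longleftrightarrow> (\<forall>k. Ck k \<phi>) \<and> compact (closure {x. \<phi> x \<noteq> 0})"

definition locally_integrable :: "(real ^ 'n \<Rightarrow> complex) \<Rightarrow> bool" where
  "locally_integrable u \<longleftrightarrow> (\<forall>K. compact K \<longrightarrow> set_integrable lborel K u)"

text \<open>
  Real-valued test functions suffice for complex-valued \<open>u\<close>, as the defining identity is
  complex linear in the test function.
\<close>

definition has_weak_pd :: "'n \<Rightarrow> (real ^ 'n \<Rightarrow> complex) \<Rightarrow> (real ^ 'n \<Rightarrow> complex) \<Rightarrow> bool" where
  "has_weak_pd i u g \<longleftrightarrow> locally_integrable u \<and> locally_integrable g \<and>
     (\<forall>\<phi>. test_function \<phi> \<longrightarrow>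
        (LINT x|lborel. pderivative i \<phi> x *\<^sub>R u x) = - (LINT x|lborel. \<phi> x *\<^sub>R g x))"

text \<open>A representative of the weak derivative, which is unique almost everywhere if it exists.\<close>

definition weak_pd :: "'n \<Rightarrow> (real ^ 'n \<Rightarrow> complex) \<Rightarrow> real ^ 'n \<Rightarrow> complex" where
  "weak_pd i u = (SOME g. has_weak_pd i u g)"

definition L2 :: "(real ^ 'n \<Rightarrow> complex) set" where
  "L2 = {u. u \<in> borel_measurable lborel \<and> integrable lborel (\<lambda>x. (cmod (u x))\<^sup>2)}"

definition L2_norm :: "(real ^ 'n \<Rightarrow> complex) \<Rightarrow> real" where
  "L2_norm u = sqrt (LINT x|lborel. (cmod (u x))\<^sup>2)"

definition H2 :: "(real ^ 'n \<Rightarrow> complex) set" where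
  "H2 = {u. u \<in> L2 \<and>
     (\<exists>g h. (\<forall>i. g i \<in> L2 \<and> has_weak_pd i u (g i)) \<and>
            (\<forall>i j. h i j \<in> L2 \<and> has_weak_pd j (g i) (h i j)))}"

definition H2_norm :: "(real ^ 'n \<Rightarrow> complex) \<Rightarrow> real" where
  "H2_norm u = sqrt ((L2_norm u)\<^sup>2 + (\<Sum>i\<in>UNIV. (L2_norm (weak_pd i u))\<^sup>2)
     + (\<Sum>i\<in>UNIV. \<Sum>j\<in>UNIV. (L2_norm (weak_pd j (weak_pd i u)))\<^sup>2))"

definition H2_bounded :: "(real ^ 'n \<Rightarrow> complex) set \<Rightarrow> bool" where
  "H2_bounded S \<longleftrightarrow> S \<subseteq> H2 \<and> (\<exists>C. \<forall>u\<in>S. H2_norm u \<le> C)"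

definition weak_laplacian :: "(real ^ 'n \<Rightarrow> complex) \<Rightarrow> real ^ 'n \<Rightarrow> complex" where
  "weak_laplacian u x = (\<Sum>i\<in>UNIV. weak_pd i (weak_pd i u) x)"

definition energy :: "real \<Rightarrow> (real ^ 'n \<Rightarrow> complex) \<Rightarrow> ereal" where
  "energy \<sigma> u =
     (if integrable lborel (\<lambda>x. cmod (u x) powr (2 * \<sigma> + 2))
      then ereal ((LINT x|lborel. (cmod (weak_laplacian u x))\<^sup>2)
             - 2 * (LINT x|lborel. (\<Sum>i\<in>UNIV. (cmod (weak_pd i u x))\<^sup>2))
             - 1 / (\<sigma> + 1) * (LINT x|lborel. cmod (u x) powr (2 * \<sigma> + 2)))
      else - \<infinity>)"

definition E_min :: "'n::finite itself \<Rightarrow> real \<Rightarrow> real \<Rightarrow> ereal" where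
  "E_min _ \<sigma> m = (INF u \<in> {u :: real ^ 'n \<Rightarrow> complex. u \<in> H2 \<and> (L2_norm u)\<^sup>2 = m}. energy \<sigma> u)"

text \<open>
  The supremum is taken in \<open>[0, \<infinity>]\<close>. The condition \<open>u \<noteq> 0\<close> refers to the class
  of \<open>u\<close>; it makes the denominator positive, since no non-zero element of
  \<open>L\<^sup>2(\<real>\<^sup>N)\<close> is harmonic.
\<close>

definition GN_const :: "'n::finite itself \<Rightarrow> real \<Rightarrow> ennreal" where
  "GN_const _ \<sigma> =
     (SUP u \<in> {u :: real ^ 'n \<Rightarrow> complex. u \<in> H2 \<and> \<not> (AE x in lborel. u x = 0)}.
        (\<integral>\<^sup>+ x. ennreal (cmod (u x) powr (2 * \<sigma> + 2)) \<partial>lborel) /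
        ennreal (L2_norm (weak_laplacian u) powr (\<sigma> * real CARD('n) / 2)
                 * L2_norm u powr (2 + 2 * \<sigma> - \<sigma> * real CARD('n) / 2)))"

text \<open>
  If \<open>GN_const\<close> were infinite, this would be \<open>0\<close>, in accordance with
  \<open>\<infinity> powr (- 1 / \<sigma>) = 0\<close>, because \<open>enn2real \<infinity> = 0\<close> and
  \<open>0 powr a = 0\<close>.
\<close>

definition k_star :: "'n::finite itself \<Rightarrow> real \<Rightarrow> real" where
  "k_star T \<sigma> = (\<sigma> + 1) powr (1 / \<sigma>) * enn2real (GN_const T \<sigma>) powr (- (1 / \<sigma>))"

definition ereal_concave_on :: "real set \<Rightarrow> (real \<Rightarrow> ereal) \<Rightarrow> bool" where
  "ereal_concave_on S f \<longleftrightarrow> convex S \<and> (\<forall>x\<in>S. f x < \<infinity>) \<and>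
     (\<forall>x\<in>S. \<forall>y\<in>S. \<forall>t. 0 < t \<and> t < 1 \<longrightarrow>
        ereal t * f x + ereal (1 - t) * f y \<le> f (t * x + (1 - t) * y))"

end

theory Submission
  imports Defs "HOL-Probability.Probability_Measure"
begin

text \<open>
  Write \<open>M = \<parallel>u\<parallel>\<close>, \<open>D = \<parallel>\<Delta>u\<parallel>\<close>, \<open>G = \<parallel>\<nabla>u\<parallel>\<^sup>2\<close> and \<open>P = \<integral>\<bar>u\<bar>\<^bsup>2\<sigma>+2\<^esup>\<close>, so that the energy is
  \<open>D\<^sup>2 - 2 G - P / (\<sigma> + 1)\<close>. Everything follows from four facts about these numbers:

  \<^item> their behaviour under amplitude changes and dilations (\<open>E_min_le_scaled\<close>): at fixed mass and
    length scale \<open>1 / l\<close> they become \<open>l\<^sup>4 D\<^sup>2\<close>, \<open>l\<^sup>2 G\<close> and \<open>l\<^bsup>\<sigma>N\<^esup> P\<close>;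
  \<^item> \<open>G \<le> M D\<close> and \<open>\<parallel>\<nabla>\<^sup>2u\<parallel> = D\<close> (\<open>grad_sq_le\<close>, \<open>hessian_eq_laplacian\<close>), so \<open>M\<close> and \<open>D\<close> control the
    norm of \<open>H\<^sup>2\<close>;
  \<^item> the inequality \<open>P \<le> B D\<^bsup>\<sigma>N/2\<^esup> M\<^bsup>2+2\<sigma>-\<sigma>N/2\<^esup>\<close> for \<open>\<sigma>N \<le> 4\<close> (\<open>gagliardo_nirenberg\<close>), and the fact
    that \<open>P\<close> is small whenever \<open>G\<close> is small and \<open>M\<close>, \<open>D\<close> stay bounded (\<open>Lp_small\<close>);
  \<^item> wave packets, whose frequencies concentrate at modulus \<open>\<kappa>\<close> (\<open>wave_packets\<close>).

  If \<open>\<sigma>N > 4\<close>, concentrating a nonzero function makes its energy tend to \<open>-\<infinity>\<close>. On the ray \<open>m \<mapsto> \<surd>m u\<close> the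
  energy is concave in \<open>m\<close>, hence so is the infimum \<open>E_min\<close>; the same rays give
  \<open>E_min m < A m - B m\<^bsup>\<sigma>+1\<^esup>\<close>. The symbol \<open>\<bar>\<xi>\<bar>\<^sup>4 - 2 \<bar>\<xi>\<bar>\<^sup>2\<close> of the quadratic part has minimum \<open>-1\<close>, attained at
  \<open>\<bar>\<xi>\<bar> = 1\<close>, so wave packets with frequencies near the unit sphere give \<open>E_min m \<le> -m\<close>; conversely \<open>G \<le> M D\<close>
  gives \<open>D\<^sup>2 - 2 G \<ge> -M\<^sup>2\<close>, and the Gagliardo--Nirenberg inequality makes \<open>P\<close> negligible for small \<open>m\<close>.
  If \<open>\<sigma>N < 4\<close>, the power of \<open>D\<close> in that inequality is less than \<open>2\<close>, so \<open>P\<close> is absorbed into \<open>D\<^sup>2\<close>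
  and the energy is coercive; if \<open>\<sigma>N = 4\<close>, this works exactly below the mass \<open>k\<^sub>*\<close>. From \<open>k\<^sub>*\<close> on,
  almost optimal functions make the quartic part of the energy negative or at most a small multiple of
  \<open>l\<^sup>4\<close>. Their \<open>P\<close> is not small, hence neither is \<open>G\<close>, and concentrating them, the more the smaller
  this multiple is, drives the energy to \<open>-\<infinity>\<close>.

  The Sobolev space theory rests on one property instead of Fourier analysis or mollification: a weakly
  differentiable \<open>u\<close> satisfies \<open>u (x + y) - u x = \<integral>\<^sub>0\<^sup>1 \<partial>\<^sub>yu (x + s y) ds\<close> almost everywhere
  (\<open>wd_segment_average\<close>). Difference quotients therefore converge in \<open>L\<^sup>2\<close>, integration by parts is inherited
  from their exact discrete counterpart, and finite differences of \<open>u\<close> are bounded by \<open>D\<close> and \<open>G\<close>. For the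
  Gagliardo--Nirenberg inequality, \<open>u (x)\<close> is compared with its averages over cubes: second
  differences bound the error in \<open>L\<^sup>2\<close>, a lower \<open>L\<^sup>r\<close> norm bounds the averages, and the size of
  the cube is adapted to the level \<open>s\<close> at which the measure of \<open>{\<bar>u\<bar> > s}\<close> is estimated.
\<close>

section \<open>The real inner product on the space of square integrable functions\<close>

definition ip :: "(real ^ 'n \<Rightarrow> complex) \<Rightarrow> (real ^ 'n \<Rightarrow> complex) \<Rightarrow> real" where
  "ip f g = (LINT x|lborel. f x \<bullet> g x)"

lemma L2_measurable [measurable_dest]: "f \<in> L2 \<Longrightarrow> f \<in> borel_measurable borel"
  by (simp add: L2_def)

lemma L2_integrable_square: "f \<in> L2 \<Longrightarrow> integrable lborel (\<lambda>x. (cmod (f x))\<^sup>2)"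
  by (simp add: L2_def)

lemma abs_inner_le_sum_squares: "\<bar>a \<bullet> b\<bar> \<le> (norm a)\<^sup>2 + (norm b)\<^sup>2"
proof -
  have "\<bar>a \<bullet> b\<bar> \<le> norm a * norm b" by (rule Cauchy_Schwarz_ineq2)
  also have "\<dots> \<le> (norm a)\<^sup>2 + (norm b)\<^sup>2"
    using sum_squares_bound[of "norm a" "norm b"] mult_nonneg_nonneg[OF norm_ge_zero norm_ge_zero, of a b]
    by linarith
  finally show ?thesis .
qed

lemma ip_integrable:
  assumes "f \<in> L2" "g \<in> L2"
  shows "integrable lborel (\<lambda>x. f x \<bullet> g x)"
proof (rule Bochner_Integration.integrable_bound)
  show "integrable lborel (\<lambda>x. (cmod (f x))\<^sup>2 + (cmod (g x))\<^sup>2)"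
    using assms by (auto simp: L2_def)
  show "(\<lambda>x. f x \<bullet> g x) \<in> borel_measurable lborel"
    using assms by (auto simp: L2_def)
  show "AE x in lborel. norm (f x \<bullet> g x) \<le> norm ((cmod (f x))\<^sup>2 + (cmod (g x))\<^sup>2)"
    using abs_inner_le_sum_squares by auto
qed

lemma L2_scaleR [intro, simp]: "f \<in> L2 \<Longrightarrow> (\<lambda>x. c *\<^sub>R f x) \<in> L2"
  by (auto simp: L2_def power_mult_distrib intro!: integrable_mult_right)

lemma L2_add [intro, simp]:
  assumes "f \<in> L2" "g \<in> L2"
  shows "(\<lambda>x. f x + g x) \<in> L2"
proof -
  have "integrable lborel (\<lambda>x. (cmod (f x + g x))\<^sup>2)"
  proof (rule Bochner_Integration.integrable_bound)
    show "integrable lborel (\<lambda>x. 2 * ((cmod (f x))\<^sup>2 + (cmod (g x))\<^sup>2))"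
      using assms by (auto simp: L2_def)
    have "(cmod (f x + g x))\<^sup>2 \<le> 2 * ((cmod (f x))\<^sup>2 + (cmod (g x))\<^sup>2)" for x
    proof -
      have "(cmod (f x + g x))\<^sup>2 \<le> (cmod (f x) + cmod (g x))\<^sup>2"
        by (intro power_mono norm_triangle_ineq) auto
      also have "\<dots> \<le> 2 * ((cmod (f x))\<^sup>2 + (cmod (g x))\<^sup>2)"
        using sum_squares_bound[of "cmod (f x)" "cmod (g x)"] by (simp add: power2_sum)
      finally show ?thesis .
    qed
    then show "AE x in lborel. norm ((cmod (f x + g x))\<^sup>2) \<le> norm (2 * ((cmod (f x))\<^sup>2 + (cmod (g x))\<^sup>2))"
      by auto
  qed (use assms in \<open>auto simp: L2_def\<close>)
  then show ?thesis using assms by (auto simp: L2_def)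
qed

lemma L2_zero [intro, simp]: "(\<lambda>x. 0) \<in> L2"
  by (auto simp: L2_def)

lemma L2_uminus [intro, simp]: "f \<in> L2 \<Longrightarrow> (\<lambda>x. - f x) \<in> L2"
  by (auto simp: L2_def)

lemma L2_diff [intro, simp]: "f \<in> L2 \<Longrightarrow> g \<in> L2 \<Longrightarrow> (\<lambda>x. f x - g x) \<in> L2"
  using L2_add[of f "\<lambda>x. - g x"] L2_uminus[of g] by simp

lemma L2_sum [intro, simp]:
  "(\<And>i. i \<in> I \<Longrightarrow> f i \<in> L2) \<Longrightarrow> (\<lambda>x. \<Sum>i\<in>I. f i x) \<in> L2"
  by (induction I rule: infinite_finite_induct) auto

lemma L2_cong_AE:
  assumes "f \<in> L2" "g \<in> borel_measurable borel" "AE x in lborel. f x = g x"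
  shows "g \<in> L2"
proof -
  have [measurable]: "f \<in> borel_measurable borel" "g \<in> borel_measurable borel"
    using assms by (auto simp: L2_def)
  have "AE x in lborel. (cmod (f x))\<^sup>2 = (cmod (g x))\<^sup>2"
    using assms(3) by eventually_elim simp
  then have "integrable lborel (\<lambda>x. (cmod (f x))\<^sup>2) \<longleftrightarrow> integrable lborel (\<lambda>x. (cmod (g x))\<^sup>2)"
    by (intro integrable_cong_AE) measurable
  then show ?thesis using assms by (simp add: L2_def)
qed

lemma ip_commute: "ip f g = ip g f"
  by (simp add: ip_def inner_commute)

lemma ip_add_left: "f \<in> L2 \<Longrightarrow> g \<in> L2 \<Longrightarrow> h \<in> L2 \<Longrightarrow> ip (\<lambda>x. f x + g x) h = ip f h + ip g h"
  by (simp add: ip_def inner_add_left ip_integrable)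

lemma ip_scale_left: "ip (\<lambda>x. c *\<^sub>R f x) h = c * ip f h"
  by (simp add: ip_def)

lemma ip_diff_left: "f \<in> L2 \<Longrightarrow> g \<in> L2 \<Longrightarrow> h \<in> L2 \<Longrightarrow> ip (\<lambda>x. f x - g x) h = ip f h - ip g h"
  by (simp add: ip_def inner_diff_left ip_integrable)

lemma ip_sum_left:
  "(\<And>i. i \<in> I \<Longrightarrow> f i \<in> L2) \<Longrightarrow> h \<in> L2 \<Longrightarrow> ip (\<lambda>x. \<Sum>i\<in>I. f i x) h = (\<Sum>i\<in>I. ip (f i) h)"
  by (simp add: ip_def inner_sum_left ip_integrable)

lemma ip_add_right: "f \<in> L2 \<Longrightarrow> g \<in> L2 \<Longrightarrow> h \<in> L2 \<Longrightarrow> ip h (\<lambda>x. f x + g x) = ip h f + ip h g"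
  using ip_add_left[of f g h] by (simp only: ip_commute[of h])

lemma ip_diff_right: "f \<in> L2 \<Longrightarrow> g \<in> L2 \<Longrightarrow> h \<in> L2 \<Longrightarrow> ip h (\<lambda>x. f x - g x) = ip h f - ip h g"
  using ip_diff_left[of f g h] by (simp only: ip_commute[of h])

lemma ip_scale_right: "ip h (\<lambda>x. c *\<^sub>R f x) = c * ip h f"
  by (simp add: ip_def)

lemma ip_sum_right:
  "(\<And>i. i \<in> I \<Longrightarrow> f i \<in> L2) \<Longrightarrow> h \<in> L2 \<Longrightarrow> ip h (\<lambda>x. \<Sum>i\<in>I. f i x) = (\<Sum>i\<in>I. ip h (f i))"
  by (simp add: ip_def inner_sum_right ip_integrable)

lemma ip_cong_AE:
  assumes [measurable]: "f \<in> borel_measurable borel" "g \<in> borel_measurable borel"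
    "h \<in> borel_measurable borel" "k \<in> borel_measurable borel"
    and AE: "AE x in lborel. f x = h x" "AE x in lborel. g x = k x"
  shows "ip f g = ip h k"
  unfolding ip_def
proof (rule integral_cong_AE)
  show "AE x in lborel. f x \<bullet> g x = h x \<bullet> k x" using AE by eventually_elim simp
qed measurable

lemma L2_norm_sq: "(L2_norm f)\<^sup>2 = (LINT x|lborel. (cmod (f x))\<^sup>2)"
  by (simp add: L2_norm_def integral_nonneg_AE)

lemma L2_norm_sq_ip: "(L2_norm f)\<^sup>2 = ip f f"
  by (simp add: L2_norm_sq ip_def power2_norm_eq_inner)

lemma L2_norm_nonneg [simp]: "0 \<le> L2_norm f"
  by (simp add: L2_norm_def integral_nonneg_AE)

lemma L2_norm_sq_nn: "f \<in> L2 \<Longrightarrow> (\<integral>\<^sup>+x. ennreal ((cmod (f x))\<^sup>2) \<partial>lborel) = ennreal ((L2_norm f)\<^sup>2)"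
  by (subst nn_integral_eq_integral) (auto simp: L2_norm_sq L2_def)

lemma L2_norm_scale: "L2_norm (\<lambda>x. c *\<^sub>R f x) = \<bar>c\<bar> * L2_norm f"
  by (simp add: L2_norm_def power_mult_distrib real_sqrt_mult)

lemma ip_Cauchy_Schwarz:
  assumes "f \<in> L2" "g \<in> L2"
  shows "\<bar>ip f g\<bar> \<le> L2_norm f * L2_norm g"
proof -
  have "0 \<le> ip (\<lambda>x. f x + t *\<^sub>R g x) (\<lambda>x. f x + t *\<^sub>R g x)" for t
    by (metis L2_norm_sq_ip zero_le_power2)
  then have *: "0 \<le> (L2_norm f)\<^sup>2 + 2 * t * ip f g + t\<^sup>2 * (L2_norm g)\<^sup>2" for t
    using assms unfolding L2_norm_sq_ip power2_eq_square[of t]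
    by (simp add: ip_add_left ip_add_right ip_scale_left ip_scale_right
        ip_commute[of g f] algebra_simps)
  have "(ip f g)\<^sup>2 \<le> (L2_norm f)\<^sup>2 * (L2_norm g)\<^sup>2"
  proof (cases "L2_norm g = 0")
    case True
    have "ip f g = 0"
    proof (rule ccontr)
      assume "ip f g \<noteq> 0"
      then show False
        using *[of "- ((L2_norm f)\<^sup>2 + 1) / ip f g"] True zero_le_power2[of "L2_norm f"] by simp
    qed
    then show ?thesis by simp
  next
    case False
    define G where "G = (L2_norm g)\<^sup>2"
    have G: "G > 0" using False by (simp add: G_def)
    have "2 * (- ip f g / G) * ip f g + (- ip f g / G)\<^sup>2 * G = - ((ip f g)\<^sup>2 / G)"
      using G by (simp add: power2_eq_square)
    then have "(ip f g)\<^sup>2 / G \<le> (L2_norm f)\<^sup>2"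
      using *[of "- ip f g / G", folded G_def] by linarith
    then show ?thesis using G by (simp add: divide_le_eq G_def)
  qed
  then show ?thesis
    by (metis power_mult_distrib abs_le_square_iff abs_of_nonneg L2_norm_nonneg mult_nonneg_nonneg)
qed

lemma L2_norm_triangle:
  assumes "f \<in> L2" "g \<in> L2"
  shows "L2_norm (\<lambda>x. f x + g x) \<le> L2_norm f + L2_norm g"
proof (rule power2_le_imp_le)
  show "(L2_norm (\<lambda>x. f x + g x))\<^sup>2 \<le> (L2_norm f + L2_norm g)\<^sup>2"
    using assms ip_Cauchy_Schwarz[OF assms]
    by (simp add: L2_norm_sq_ip ip_add_left ip_add_right ip_commute[of g f] power2_sum)
qed simp

lemma L2_norm_triangle_diff:
  assumes "f \<in> L2" "g \<in> L2"
  shows "L2_norm (\<lambda>x. f x - g x) \<le> L2_norm f + L2_norm g"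
  using L2_norm_triangle[of f "\<lambda>x. - g x"] assms by (simp add: L2_norm_def)

lemma L2_norm_cong_AE:
  assumes "f \<in> borel_measurable borel" "g \<in> borel_measurable borel" "AE x in lborel. f x = g x"
  shows "L2_norm f = L2_norm g"
  using ip_cong_AE[OF assms(1,1,2,2,3,3)] L2_norm_sq_ip[of f] L2_norm_sq_ip[of g]
    power2_eq_iff_nonneg[of "L2_norm f" "L2_norm g"] by simp

lemma ip_tendsto:
  assumes f: "\<And>t. f t \<in> L2" "g \<in> L2" and h: "\<And>t. h t \<in> L2" "k \<in> L2"
    and lims: "((\<lambda>t. L2_norm (\<lambda>x. f t x - g x)) \<longlongrightarrow> 0) F"
     "((\<lambda>t. L2_norm (\<lambda>x. h t x - k x)) \<longlongrightarrow> 0) F"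
  shows "((\<lambda>t. ip (f t) (h t)) \<longlongrightarrow> ip g k) F"
proof -
  define a where "a t = L2_norm (\<lambda>x. f t x - g x)" for t
  define b where "b t = L2_norm (\<lambda>x. h t x - k x)" for t
  have *: "norm (ip (f t) (h t) - ip g k) \<le> a t * b t + a t * L2_norm k + L2_norm g * b t" for t
  proof -
    have eq: "ip (f t) (h t) - ip g k = ip (\<lambda>x. f t x - g x) (\<lambda>x. h t x - k x)
        + ip (\<lambda>x. f t x - g x) k + ip g (\<lambda>x. h t x - k x)"
      using f h by (simp add: ip_diff_left ip_diff_right)
    have 1: "\<bar>ip (\<lambda>x. f t x - g x) (\<lambda>x. h t x - k x)\<bar> \<le> a t * b t"
      unfolding a_def b_def by (intro ip_Cauchy_Schwarz L2_diff f h)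
    have 2: "\<bar>ip (\<lambda>x. f t x - g x) k\<bar> \<le> a t * L2_norm k"
      unfolding a_def b_def by (intro ip_Cauchy_Schwarz L2_diff f h)
    have 3: "\<bar>ip g (\<lambda>x. h t x - k x)\<bar> \<le> L2_norm g * b t"
      unfolding a_def b_def by (intro ip_Cauchy_Schwarz L2_diff f h)
    show ?thesis unfolding eq real_norm_def using 1 2 3 by linarith
  qed
  have "((\<lambda>t. a t * b t + a t * L2_norm k + L2_norm g * b t)
      \<longlongrightarrow> 0 * 0 + 0 * L2_norm k + L2_norm g * 0) F"
    by (intro tendsto_intros lims[folded a_def b_def])
  then have lim: "((\<lambda>t. a t * b t + a t * L2_norm k + L2_norm g * b t) \<longlongrightarrow> 0) F"
    by simp
  have "((\<lambda>t. ip (f t) (h t) - ip g k) \<longlongrightarrow> 0) F"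
    by (rule Lim_null_comparison[OF _ lim]) (simp only: * eventually_True)
  then show ?thesis by (simp only: LIM_zero_iff)
qed

subsection \<open>Translations and dilations\<close>

lemma nn_integral_affine:
  fixes f :: "real ^ 'n \<Rightarrow> ennreal"
  assumes [measurable]: "f \<in> borel_measurable borel" and "c > 0"
  shows "(\<integral>\<^sup>+x. f (y + c *\<^sub>R x) \<partial>lborel) = ennreal (1 / c ^ CARD('n)) * (\<integral>\<^sup>+x. f x \<partial>lborel)"
proof -
  have "(\<integral>\<^sup>+x. f x \<partial>lborel)
      = (\<integral>\<^sup>+x. f x \<partial>density (distr lborel borel (\<lambda>x. y + c *\<^sub>R x)) (\<lambda>_. \<bar>c\<bar> ^ DIM(real^'n)))"
    using lborel_affine[of c y] assms(2) by simp
  also have "\<dots> = ennreal (c ^ CARD('n)) * (\<integral>\<^sup>+x. f (y + c *\<^sub>R x) \<partial>lborel)"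
    using assms(2) by (simp add: nn_integral_density nn_integral_cmult nn_integral_distr)
  finally have "(\<integral>\<^sup>+x. f x \<partial>lborel) = ennreal (c ^ CARD('n)) * (\<integral>\<^sup>+x. f (y + c *\<^sub>R x) \<partial>lborel)" .
  then show ?thesis
    using assms(2) by (simp add: mult.assoc[symmetric] ennreal_mult[symmetric])
qed

lemma integrable_affine:
  fixes f :: "real ^ 'n \<Rightarrow> 'b::{banach, second_countable_topology}"
  assumes "integrable lborel f" and c: "c > 0"
  shows "integrable lborel (\<lambda>x. f (y + c *\<^sub>R x))"
proof -
  have [measurable]: "f \<in> borel_measurable borel" using assms(1) by auto
  have "(\<integral>\<^sup>+x. norm (f (y + c *\<^sub>R x)) \<partial>lborel) < \<infinity>"
    using assms nn_integral_affine[of "\<lambda>x. ennreal (norm (f x))" c y]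
    by (simp add: integrable_iff_bounded ennreal_mult_less_top)
  then show ?thesis by (simp add: integrable_iff_bounded)
qed

lemma integral_affine:
  fixes f :: "real ^ 'n \<Rightarrow> 'b::{banach, second_countable_topology}"
  assumes [measurable]: "f \<in> borel_measurable borel" and c: "c > 0"
  shows "(LINT x|lborel. f (y + c *\<^sub>R x)) = (1 / c ^ CARD('n)) *\<^sub>R (LINT x|lborel. f x)"
proof -
  have "(LINT x|lborel. f x)
      = (LINT x|density (distr lborel borel (\<lambda>x. y + c *\<^sub>R x)) (\<lambda>_. \<bar>c\<bar> ^ DIM(real^'n)). f x)"
    using lborel_affine[of c y] c by simp
  also have "\<dots> = (c ^ CARD('n)) *\<^sub>R (LINT x|lborel. f (y + c *\<^sub>R x))"
    using c by (simp add: integral_density integral_distr)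
  finally show ?thesis using c by simp
qed

lemma integral_translate:
  fixes f :: "real ^ 'n \<Rightarrow> 'b::{banach, second_countable_topology}"
  assumes [measurable]: "f \<in> borel_measurable borel"
  shows "(LINT x|lborel. f (x + y)) = (LINT x|lborel. f x)"
  using integral_affine[of f 1 y] by (simp add: add.commute)

lemma nn_integral_translate:
  fixes f :: "real ^ 'n \<Rightarrow> ennreal"
  assumes [measurable]: "f \<in> borel_measurable borel"
  shows "(\<integral>\<^sup>+x. f (x + y) \<partial>lborel) = (\<integral>\<^sup>+x. f x \<partial>lborel)"
  using nn_integral_affine[of f 1 y] by (simp add: add.commute)

lemma integrable_translate:
  fixes f :: "real ^ 'n \<Rightarrow> 'b::{banach, second_countable_topology}"
  shows "integrable lborel f \<Longrightarrow> integrable lborel (\<lambda>x. f (x + y))"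
  using integrable_affine[of f 1 y] by (simp add: add.commute)

lemma L2_affine [simp]:
  assumes "f \<in> L2" "c > 0" shows "(\<lambda>x. f (y + c *\<^sub>R x)) \<in> L2"
  using assms by (auto simp: L2_def intro: integrable_affine[where f="\<lambda>x. (cmod (f x))\<^sup>2"])

lemma L2_translate [simp]: "f \<in> L2 \<Longrightarrow> (\<lambda>x. f (x + y)) \<in> L2"
  using L2_affine[of f 1 y] by (simp add: add.commute)

lemma ip_translate:
  assumes "f \<in> L2" "g \<in> L2"
  shows "ip (\<lambda>x. f (x + y)) (\<lambda>x. g (x + y)) = ip f g"
  unfolding ip_def using assms by (intro integral_translate) (auto simp: L2_def)

lemma L2_norm_translate: "f \<in> L2 \<Longrightarrow> L2_norm (\<lambda>x. f (x + y)) = L2_norm f"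
  using integral_translate[of "\<lambda>x. (cmod (f x))\<^sup>2" y] by (auto simp: L2_norm_def L2_def)

subsection \<open>Continuity of translations\<close>

text \<open>
  Continuity of translations passes to \<open>L\<^sup>1\<close> limits, because translations are isometries; so it
  needs checking only for indicators of open sets of finite measure.
\<close>

lemma translation_approx_L1:
  fixes f :: "real ^ 'n \<Rightarrow> complex" and Y :: "nat \<Rightarrow> real ^ 'n"
  assumes f: "integrable lborel f"
    and approx: "\<And>e. e > 0 \<Longrightarrow> \<exists>g. integrable lborel g \<and> (LINT x|lborel. cmod (f x - g x)) < e \<and>
       (\<lambda>n. LINT x|lborel. cmod (g (x + Y n) - g x)) \<longlonglongrightarrow> 0"
  shows "(\<lambda>n. LINT x|lborel. cmod (f (x + Y n) - f x)) \<longlonglongrightarrow> 0"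
proof (rule LIMSEQ_I)
  fix r :: real assume "r > 0"
  obtain g where g: "integrable lborel g" and fg: "(LINT x|lborel. cmod (f x - g x)) < r / 3"
    and lim: "(\<lambda>n. LINT x|lborel. cmod (g (x + Y n) - g x)) \<longlonglongrightarrow> 0"
    using approx[of "r / 3"] \<open>r > 0\<close> by auto
  obtain n0 where n0: "\<And>n. n \<ge> n0 \<Longrightarrow> norm ((LINT x|lborel. cmod (g (x + Y n) - g x)) - 0) < r / 3"
    using LIMSEQ_D[OF lim, of "r / 3"] \<open>r > 0\<close> by auto
  have [measurable]: "f \<in> borel_measurable borel" "g \<in> borel_measurable borel"
    using f g by auto
  have "norm ((LINT x|lborel. cmod (f (x + Y n) - f x)) - 0) < r" if "n \<ge> n0" for n
  proof -
    have int: "integrable lborel (\<lambda>x. cmod (f x - g x))"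
      "integrable lborel (\<lambda>x. cmod (f (x + Y n) - g (x + Y n)))"
      "integrable lborel (\<lambda>x. cmod (g (x + Y n) - g x))"
      "integrable lborel (\<lambda>x. cmod (f (x + Y n) - f x))"
      using f g by (auto intro!: integrable_translate)
    have "(LINT x|lborel. cmod (f (x + Y n) - f x)) \<le>
      (LINT x|lborel. cmod (f (x + Y n) - g (x + Y n)) + cmod (g (x + Y n) - g x) + cmod (f x - g x))"
    proof (rule integral_mono)
      fix x
      have eq: "f (x + Y n) - f x = (f (x + Y n) - g (x + Y n)) + (g (x + Y n) - g x) - (f x - g x)"
        by simp
      show "cmod (f (x + Y n) - f x) \<le>
          cmod (f (x + Y n) - g (x + Y n)) + cmod (g (x + Y n) - g x) + cmod (f x - g x)"
        unfolding eq using norm_triangle_ineq4[of "(f (x + Y n) - g (x + Y n)) + (g (x + Y n) - g x)" "f x - g x"]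
          norm_triangle_ineq[of "f (x + Y n) - g (x + Y n)" "g (x + Y n) - g x"] by linarith
    qed (use int in auto)
    also have "\<dots> = (LINT x|lborel. cmod (f (x + Y n) - g (x + Y n)))
        + (LINT x|lborel. cmod (g (x + Y n) - g x)) + (LINT x|lborel. cmod (f x - g x))"
      using int by simp
    also have "(LINT x|lborel. cmod (f (x + Y n) - g (x + Y n))) = (LINT x|lborel. cmod (f x - g x))"
      by (rule integral_translate[where f="\<lambda>x. cmod (f x - g x)"]) measurable
    finally have le: "(LINT x|lborel. cmod (f (x + Y n) - f x)) \<le> (LINT x|lborel. cmod (f x - g x))
        + (LINT x|lborel. cmod (g (x + Y n) - g x)) + (LINT x|lborel. cmod (f x - g x))" .
    have "0 \<le> (LINT x|lborel. cmod (f (x + Y n) - f x))" "0 \<le> (LINT x|lborel. cmod (g (x + Y n) - g x))"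
      by (simp_all add: integral_nonneg_AE)
    then show ?thesis using n0[OF that] fg le by simp
  qed
  then show "\<exists>n0. \<forall>n\<ge>n0. norm ((LINT x|lborel. cmod (f (x + Y n) - f x)) - 0) < r"
    by auto
qed

text \<open>
  For an open set \<open>U\<close> the translates \<open>U - y\<close> exhaust \<open>U\<close> in the limit, because every point of \<open>U\<close>
  is interior; dominated convergence then controls the symmetric difference.
\<close>

lemma translation_open_set:
  fixes U :: "(real ^ 'n) set" and Y :: "nat \<Rightarrow> real ^ 'n"
  assumes U: "open U" "emeasure lborel U < \<infinity>" and Y: "Y \<longlonglongrightarrow> 0"
  shows "(\<lambda>n. LINT x|lborel. \<bar>indicator U (x + Y n) - indicator U x :: real\<bar>) \<longlonglongrightarrow> 0"
proof -
  have [measurable]: "U \<in> sets borel" using U by auto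
  have intU: "integrable lborel (indicator U :: _ \<Rightarrow> real)"
    using U by (intro integrable_real_indicator) auto
  have intUY: "integrable lborel (\<lambda>x. indicator U (x + y) :: real)" for y
    using integrable_translate[OF intU] .
  have intUU: "integrable lborel (\<lambda>x. indicator U (x + y) * indicator U x :: real)" for y
    by (rule Bochner_Integration.integrable_bound[OF intU]) (auto simp: indicator_def)
  have lim: "(\<lambda>n. LINT x|lborel. indicator U (x + Y n) * indicator U x :: real) \<longlonglongrightarrow>
      (LINT x|lborel. indicator U x)"
  proof (rule integral_dominated_convergence[where w="indicator U"])
    show "AE x in lborel. (\<lambda>n. indicator U (x + Y n) * indicator U x :: real) \<longlonglongrightarrow> indicator U x"
    proof (rule AE_I2)
      fix x :: "real ^ 'n"
      show "(\<lambda>n. indicator U (x + Y n) * indicator U x :: real) \<longlonglongrightarrow> indicator U x"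
      proof (cases "x \<in> U")
        case True
        have "(\<lambda>n. x + Y n) \<longlonglongrightarrow> x + 0" by (intro tendsto_intros Y)
        then have "\<forall>\<^sub>F n in sequentially. x + Y n \<in> U"
          using U True by (auto dest: topological_tendstoD)
        then have "\<forall>\<^sub>F n in sequentially. indicator U (x + Y n) * indicator U x = (1::real)"
          by eventually_elim (use True in simp)
        then show ?thesis using True by (simp add: tendsto_eventually)
      qed simp
    qed
  qed (use intU in \<open>auto simp: indicator_def\<close>)
  have "(LINT x|lborel. \<bar>indicator U (x + Y n) - indicator U x :: real\<bar>) =
      2 * (LINT x|lborel. indicator U x) - 2 * (LINT x|lborel. indicator U (x + Y n) * indicator U x)" for n
  proof -
    have "(LINT x|lborel. \<bar>indicator U (x + Y n) - indicator U x :: real\<bar>) =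
      (LINT x|lborel. indicator U (x + Y n) + indicator U x - 2 * (indicator U (x + Y n) * indicator U x))"
      by (intro Bochner_Integration.integral_cong) (auto simp: indicator_def)
    also have "\<dots> = (LINT x|lborel. indicator U (x + Y n)) + (LINT x|lborel. indicator U x)
         - 2 * (LINT x|lborel. indicator U (x + Y n) * indicator U x)"
      using intU intUY[of "Y n"] intUU[of "Y n"] by simp
    also have "(LINT x|lborel. indicator U (x + Y n)) = (LINT x|lborel. indicator U x :: real)"
      by (rule integral_translate) measurable
    finally show ?thesis by simp
  qed
  moreover have "(\<lambda>n. 2 * (LINT x|lborel. indicator U x) - 2 * (LINT x|lborel. indicator U (x + Y n) * indicator U x))
     \<longlonglongrightarrow> 2 * (LINT x|lborel. indicator U x :: real) - 2 * (LINT x|lborel. indicator U x)"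
    by (intro tendsto_intros lim)
  ultimately show ?thesis by simp
qed

lemma translation_continuous_L1:
  fixes f :: "real ^ 'n \<Rightarrow> complex" and Y :: "nat \<Rightarrow> real ^ 'n"
  assumes "integrable lborel f" and Y: "Y \<longlonglongrightarrow> 0"
  shows "(\<lambda>n. LINT x|lborel. cmod (f (x + Y n) - f x)) \<longlonglongrightarrow> 0"
  using assms(1)
proof induction
  case (base A c)
  have A[measurable]: "A \<in> sets borel" using base by simp
  show ?case
  proof (rule translation_approx_L1)
    show "integrable lborel (\<lambda>x. indicator A x *\<^sub>R c)"
      using base by (intro integrable_scaleR_left) auto
    fix e :: real assume "e > 0"
    define d where "d = e / (cmod c + 1)"
    have "d > 0" using \<open>e > 0\<close> by (auto simp: d_def intro!: divide_pos_pos add_nonneg_pos)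
    obtain U where U: "open U" "A \<subseteq> U" "emeasure lborel (U - A) < ennreal d"
      using outer_regular_lborel[OF A \<open>d > 0\<close>] by blast
    have [measurable]: "U \<in> sets borel" using U by auto
    have "emeasure lborel U = emeasure lborel A + emeasure lborel (U - A)"
      using U by (subst plus_emeasure) (auto simp: Un_absorb1)
    then have fin: "emeasure lborel U < \<infinity>"
      using U base by (auto simp: less_top[symmetric])
    have "integrable lborel (\<lambda>x. indicator U x *\<^sub>R c)"
      using fin by (intro integrable_scaleR_left) auto
    moreover have "(LINT x|lborel. cmod (indicator A x *\<^sub>R c - indicator U x *\<^sub>R c)) < e"
    proof -
      have "(LINT x|lborel. cmod (indicator A x *\<^sub>R c - indicator U x *\<^sub>R c))
          = (LINT x|lborel. indicator (U - A) x * cmod c)"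
        using U by (intro Bochner_Integration.integral_cong) (auto simp: indicator_def)
      also have "\<dots> = measure lborel (U - A) * cmod c" by simp
      also have "measure lborel (U - A) < d"
        using U(3) by (cases "emeasure lborel (U - A)") (auto simp: measure_def ennreal_less_iff)
      then have "measure lborel (U - A) * cmod c \<le> d * cmod c"
        by (intro mult_right_mono) auto
      also have "d * cmod c < d * (cmod c + 1)" using \<open>d > 0\<close> by simp
      also have "\<dots> = e" using norm_ge_zero[of c] by (simp add: d_def add_nonneg_eq_0_iff)
      finally show ?thesis .
    qed
    moreover have "(\<lambda>n. LINT x|lborel. cmod (indicator U (x + Y n) *\<^sub>R c - indicator U x *\<^sub>R c)) \<longlonglongrightarrow> 0"
    proof -
      have "(LINT x|lborel. cmod (indicator U (x + Y n) *\<^sub>R c - indicator U x *\<^sub>R c)) =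
        (LINT x|lborel. \<bar>indicator U (x + Y n) - indicator U x\<bar>) * cmod c" for n
        by (simp add: scaleR_diff_left[symmetric])
      then show ?thesis
        using tendsto_mult_left_zero[OF translation_open_set[OF U(1) fin Y]] by simp
    qed
    ultimately show "\<exists>g. integrable lborel g \<and> (LINT x|lborel. cmod (indicator A x *\<^sub>R c - g x)) < e \<and>
       (\<lambda>n. LINT x|lborel. cmod (g (x + Y n) - g x)) \<longlonglongrightarrow> 0" by blast
  qed
next
  case (add f g)
  note [measurable] = borel_measurable_integrable[OF add(1)] borel_measurable_integrable[OF add(2)]
  have int: "integrable lborel (\<lambda>x. cmod (f (x + y) - f x))" "integrable lborel (\<lambda>x. cmod (g (x + y) - g x))"
     "integrable lborel (\<lambda>x. cmod (f (x + y) + g (x + y) - (f x + g x)))" for y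
    by (intro integrable_norm Bochner_Integration.integrable_diff Bochner_Integration.integrable_add
        integrable_translate[of f] integrable_translate[of g] add(1,2))+
  have le: "norm (LINT x|lborel. cmod (f (x + Y n) + g (x + Y n) - (f x + g x)))
      \<le> (LINT x|lborel. cmod (f (x + Y n) - f x)) + (LINT x|lborel. cmod (g (x + Y n) - g x))" for n
  proof -
    have "norm (LINT x|lborel. cmod (f (x + Y n) + g (x + Y n) - (f x + g x)))
      = (LINT x|lborel. cmod (f (x + Y n) + g (x + Y n) - (f x + g x)))"
      by (simp add: integral_nonneg_AE)
    also have "\<dots> \<le> (LINT x|lborel. cmod (f (x + Y n) - f x) + cmod (g (x + Y n) - g x))"
    proof (rule integral_mono)
      fix x
      have "f (x + Y n) + g (x + Y n) - (f x + g x) = (f (x + Y n) - f x) + (g (x + Y n) - g x)"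
        by simp
      then show "cmod (f (x + Y n) + g (x + Y n) - (f x + g x)) \<le> cmod (f (x + Y n) - f x) + cmod (g (x + Y n) - g x)"
        by (metis norm_triangle_ineq)
    qed (use int in auto)
    finally show ?thesis using int by simp
  qed
  have "(\<lambda>n. (LINT x|lborel. cmod (f (x + Y n) - f x)) + (LINT x|lborel. cmod (g (x + Y n) - g x))) \<longlonglongrightarrow> 0 + 0"
    by (intro tendsto_intros add)
  then show ?case
    by (intro Lim_null_comparison[OF always_eventually[OF allI[OF le]]]) simp
next
  case (lim f s)
  show ?case
  proof (rule translation_approx_L1)
    fix e :: real assume "e > 0"
    have [measurable]: "f \<in> borel_measurable borel" "\<And>i. s i \<in> borel_measurable borel"
      using lim by auto
    have le: "norm (s i x) \<le> 2 * norm (f x)" for i x using lim by simp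
    have "(\<lambda>i. LINT x|lborel. cmod (f x - s i x)) \<longlonglongrightarrow> (LINT x|(lborel :: (real ^ 'n) measure). (0::real))"
    proof (rule integral_dominated_convergence[where w="\<lambda>x. 3 * cmod (f x)"])
      show "AE x in lborel. (\<lambda>i. cmod (f x - s i x)) \<longlonglongrightarrow> 0"
      proof (rule AE_I2)
        fix x :: "real ^ 'n"
        have "(\<lambda>i. cmod (f x - s i x)) \<longlonglongrightarrow> cmod (f x - f x)"
          by (intro tendsto_intros lim) auto
        then show "(\<lambda>i. cmod (f x - s i x)) \<longlonglongrightarrow> 0" by simp
      qed
      fix i
      show "AE x in lborel. norm (cmod (f x - s i x)) \<le> 3 * cmod (f x)"
      proof (rule AE_I2)
        fix x :: "real ^ 'n"
        show "norm (cmod (f x - s i x)) \<le> 3 * cmod (f x)"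
          using norm_triangle_ineq4[of "f x" "s i x"] le[of i x] by simp
      qed
    qed (use lim in auto)
    then have "(\<lambda>i. LINT x|lborel. cmod (f x - s i x)) \<longlonglongrightarrow> 0" by simp
    from LIMSEQ_D[OF this \<open>e > 0\<close>] obtain i where "norm ((LINT x|lborel. cmod (f x - s i x)) - 0) < e"
      by auto
    then have "(LINT x|lborel. cmod (f x - s i x)) < e" by simp
    then show "\<exists>g. integrable lborel g \<and> (LINT x|lborel. cmod (f x - g x)) < e \<and>
       (\<lambda>n. LINT x|lborel. cmod (g (x + Y n) - g x)) \<longlonglongrightarrow> 0"
      using lim by blast
  qed (use lim in auto)
qed

text \<open>
  Truncating in range and space produces a bounded integrable function \<open>w\<close>, for which
  \<open>\<bar>w (x + y) - w x\<bar>\<^sup>2 \<le> 2 k \<bar>w (x + y) - w x\<bar>\<close> reduces the claim to the one in \<open>L\<^sup>1\<close>.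
\<close>

lemma translation_continuous_L2:
  fixes v :: "real ^ 'n \<Rightarrow> complex" and Y :: "nat \<Rightarrow> real ^ 'n"
  assumes v: "v \<in> L2" and Y: "Y \<longlonglongrightarrow> 0"
  shows "(\<lambda>n. L2_norm (\<lambda>x. v (x + Y n) - v x)) \<longlonglongrightarrow> 0"
proof (rule LIMSEQ_I)
  fix r :: real assume "r > 0"
  have [measurable]: "v \<in> borel_measurable borel" using v by measurable
  define w where "w k x = (if cmod (v x) \<le> real k \<and> norm x \<le> real k then v x else 0)" for k :: nat and x
  have [measurable]: "w k \<in> borel_measurable borel" for k unfolding w_def by measurable
  have wle: "cmod (w k x) \<le> cmod (v x)" "cmod (w k x) \<le> real k" for k x by (auto simp: w_def)
  have wL2: "w k \<in> L2" for k
  proof -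
    have "integrable lborel (\<lambda>x. (cmod (w k x))\<^sup>2)"
      by (rule Bochner_Integration.integrable_bound[OF L2_integrable_square[OF v]])
         (auto intro!: power_mono wle)
    then show ?thesis by (simp add: L2_def)
  qed
  have "(\<lambda>k. LINT x|lborel. (cmod (v x - w k x))\<^sup>2) \<longlonglongrightarrow> (LINT x|(lborel :: (real ^ 'n) measure). (0::real))"
  proof (rule integral_dominated_convergence[where w="\<lambda>x. (cmod (v x))\<^sup>2"])
    show "AE x in lborel. (\<lambda>k. (cmod (v x - w k x))\<^sup>2) \<longlonglongrightarrow> 0"
    proof (rule AE_I2)
      fix x :: "real ^ 'n"
      obtain k0 :: nat where k0: "cmod (v x) \<le> k0" "norm x \<le> k0"
        by (meson le_cases order_trans real_arch_simple)
      have "\<forall>\<^sub>F k in sequentially. (cmod (v x - w k x))\<^sup>2 = 0"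
        using eventually_ge_at_top[of k0]
      proof eventually_elim
        case (elim k)
        then have "cmod (v x) \<le> k" "norm x \<le> k" using k0 by (meson order_trans of_nat_mono)+
        then show ?case by (simp add: w_def)
      qed
      then show "(\<lambda>k. (cmod (v x - w k x))\<^sup>2) \<longlonglongrightarrow> 0" by (rule tendsto_eventually)
    qed
    show "AE x in lborel. norm ((cmod (v x - w k x))\<^sup>2) \<le> (cmod (v x))\<^sup>2" for k
      by (auto simp: w_def)
  qed (use L2_integrable_square[OF v] in auto)
  then have "(\<lambda>k. L2_norm (\<lambda>x. v x - w k x)) \<longlonglongrightarrow> sqrt 0"
    unfolding L2_norm_def by (intro tendsto_real_sqrt) simp
  from LIMSEQ_D[OF this, of "r / 3"] \<open>r > 0\<close>
  obtain k where k: "L2_norm (\<lambda>x. v x - w k x) < r / 3" by auto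
  have wint: "integrable lborel (w k)"
  proof (rule integrableI_bounded_set[where A="cball 0 (real k)" and B="real k"])
    show "emeasure lborel (cball (0::real^'n) (real k)) < \<infinity>"
      using emeasure_bounded_finite[of "cball (0::real^'n) (real k)"] by simp
  qed (use wle in \<open>auto simp: w_def\<close>)
  have "(\<lambda>n. LINT x|lborel. cmod (w k (x + Y n) - w k x)) \<longlonglongrightarrow> 0"
    by (rule translation_continuous_L1[OF wint Y])
  then have lim0: "(\<lambda>n. 2 * real k * (LINT x|lborel. cmod (w k (x + Y n) - w k x))) \<longlonglongrightarrow> 0"
    by (rule tendsto_mult_right_zero)
  have le0: "norm ((L2_norm (\<lambda>x. w k (x + Y n) - w k x))\<^sup>2) \<le> 2 * real k * (LINT x|lborel. cmod (w k (x + Y n) - w k x))" for n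
  proof -
    have "(LINT x|lborel. (cmod (w k (x + Y n) - w k x))\<^sup>2) \<le> (LINT x|lborel. 2 * real k * cmod (w k (x + Y n) - w k x))"
    proof (rule integral_mono)
      show "integrable lborel (\<lambda>x. (cmod (w k (x + Y n) - w k x))\<^sup>2)"
        by (intro L2_integrable_square L2_diff L2_translate wL2)
      show "integrable lborel (\<lambda>x. 2 * real k * cmod (w k (x + Y n) - w k x))"
        using wint by (auto intro!: integrable_translate)
      fix x
      have "cmod (w k (x + Y n) - w k x) \<le> 2 * real k"
        using norm_triangle_ineq4[of "w k (x + Y n)" "w k x"] wle(2)[of k x] wle(2)[of k "x + Y n"] by linarith
      then show "(cmod (w k (x + Y n) - w k x))\<^sup>2 \<le> 2 * real k * cmod (w k (x + Y n) - w k x)"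
        by (simp add: power2_eq_square mult_right_mono)
    qed
    then show ?thesis by (simp add: L2_norm_sq)
  qed
  have "(\<lambda>n. (L2_norm (\<lambda>x. w k (x + Y n) - w k x))\<^sup>2) \<longlonglongrightarrow> 0"
    by (rule Lim_null_comparison[OF always_eventually lim0]) (intro allI le0)
  then have "(\<lambda>n. sqrt ((L2_norm (\<lambda>x. w k (x + Y n) - w k x))\<^sup>2)) \<longlonglongrightarrow> sqrt 0"
    by (rule tendsto_real_sqrt)
  then have "(\<lambda>n. L2_norm (\<lambda>x. w k (x + Y n) - w k x)) \<longlonglongrightarrow> 0"
    by simp
  from LIMSEQ_D[OF this, of "r / 3"] \<open>r > 0\<close>
  obtain n0 where n0: "\<And>n. n \<ge> n0 \<Longrightarrow> L2_norm (\<lambda>x. w k (x + Y n) - w k x) < r / 3" by auto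
  have "norm (L2_norm (\<lambda>x. v (x + Y n) - v x) - 0) < r" if n: "n \<ge> n0" for n
  proof -
    have "L2_norm (\<lambda>x. v (x + Y n) - v x) =
       L2_norm (\<lambda>x. ((v (x + Y n) - w k (x + Y n)) + (w k (x + Y n) - w k x)) - (v x - w k x))"
      by (simp add: algebra_simps)
    also have "\<dots> \<le> L2_norm (\<lambda>x. (v (x + Y n) - w k (x + Y n)) + (w k (x + Y n) - w k x)) + L2_norm (\<lambda>x. v x - w k x)"
      by (intro L2_norm_triangle_diff L2_add L2_diff L2_translate wL2 v)
    also have "L2_norm (\<lambda>x. (v (x + Y n) - w k (x + Y n)) + (w k (x + Y n) - w k x)) \<le>
      L2_norm (\<lambda>x. v (x + Y n) - w k (x + Y n)) + L2_norm (\<lambda>x. w k (x + Y n) - w k x)"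
      by (intro L2_norm_triangle L2_add L2_diff L2_translate wL2 v)
    also have "L2_norm (\<lambda>x. v (x + Y n) - w k (x + Y n)) = L2_norm (\<lambda>x. v x - w k x)"
      by (rule L2_norm_translate[where f="\<lambda>x. v x - w k x"]) (intro L2_diff v wL2)
    finally show ?thesis using k n0[OF n] by simp
  qed
  then show "\<exists>n0. \<forall>n\<ge>n0. norm (L2_norm (\<lambda>x. v (x + Y n) - v x) - 0) < r" by auto
qed

subsection \<open>Averages of translates\<close>

definition avg :: "(real ^ 'n) measure \<Rightarrow> (real ^ 'n \<Rightarrow> complex) \<Rightarrow> real ^ 'n \<Rightarrow> complex" where
  "avg \<nu> g x = (LINT z|\<nu>. g (x + z))"

lemma nn_integral_Jensen_square:
  fixes F :: "real ^ 'n \<Rightarrow> real ^ 'n \<Rightarrow> ennreal"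
  assumes "prob_space \<nu>" and [measurable_cong]: "sets \<nu> = sets borel"
    and F[measurable]: "case_prod F \<in> borel_measurable (borel \<Otimes>\<^sub>M borel)"
  shows "(\<integral>\<^sup>+x. (\<integral>\<^sup>+z. F x z \<partial>\<nu>)\<^sup>2 \<partial>lborel) \<le> (\<integral>\<^sup>+z. (\<integral>\<^sup>+x. (F x z)\<^sup>2 \<partial>lborel) \<partial>\<nu>)"
proof -
  interpret \<nu>: prob_space \<nu> by fact
  interpret P: pair_sigma_finite lborel \<nu> ..
  have "(\<integral>\<^sup>+z. F x z \<partial>\<nu>)\<^sup>2 \<le> (\<integral>\<^sup>+z. (F x z)\<^sup>2 \<partial>\<nu>)" for x
    using Cauchy_Schwarz_nn_integral[of "F x" \<nu> "\<lambda>_. 1"] by (simp add: \<nu>.emeasure_space_1)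
  then have "(\<integral>\<^sup>+x. (\<integral>\<^sup>+z. F x z \<partial>\<nu>)\<^sup>2 \<partial>lborel) \<le> (\<integral>\<^sup>+x. (\<integral>\<^sup>+z. (F x z)\<^sup>2 \<partial>\<nu>) \<partial>lborel)"
    by (intro nn_integral_mono)
  also have "\<dots> = (\<integral>\<^sup>+z. (\<integral>\<^sup>+x. (F x z)\<^sup>2 \<partial>lborel) \<partial>\<nu>)"
    by (rule P.Fubini'[symmetric]) measurable
  finally show ?thesis .
qed

text \<open>
  Minkowski's integral inequality for averages: an average of translates of \<open>g\<close> is as close to \<open>h\<close>
  as the translates themselves. The cases \<open>h = 0\<close> and \<open>h = g\<close> say that averaging contracts the norm
  and that it perturbs \<open>g\<close> by at most the modulus of continuity of its translates.
\<close>

lemma avg_near: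
  fixes g h :: "real ^ 'n \<Rightarrow> complex"
  assumes \<nu>: "prob_space \<nu>" and sets[measurable_cong]: "sets \<nu> = sets borel"
    and g: "g \<in> L2" and h: "h \<in> L2" and e: "e \<ge> 0"
    and bound: "AE z in \<nu>. L2_norm (\<lambda>x. g (x + z) - h x) \<le> e"
  shows "avg \<nu> g \<in> L2" "L2_norm (\<lambda>x. avg \<nu> g x - h x) \<le> e"
    "AE x in lborel. integrable \<nu> (\<lambda>z. g (x + z))"
proof -
  interpret \<nu>: prob_space \<nu> by fact
  have [measurable]: "g \<in> borel_measurable borel" "h \<in> borel_measurable borel" using g h by measurable
  have meas[measurable]: "avg \<nu> g \<in> borel_measurable borel"
  proof -
    have "(\<lambda>x. LINT z|\<nu>. g (x + z)) \<in> borel_measurable borel"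
      by (rule \<nu>.borel_measurable_lebesgue_integral) measurable
    then show ?thesis by (simp add: avg_def[abs_def])
  qed
  define F where "F x z = ennreal (cmod (g (x + z) - h x))" for x z
  have F[measurable]: "case_prod F \<in> borel_measurable (borel \<Otimes>\<^sub>M borel)" unfolding F_def by measurable
  have "(\<integral>\<^sup>+x. (\<integral>\<^sup>+z. F x z \<partial>\<nu>)\<^sup>2 \<partial>lborel) \<le> (\<integral>\<^sup>+z. (\<integral>\<^sup>+x. (F x z)\<^sup>2 \<partial>lborel) \<partial>\<nu>)"
    by (rule nn_integral_Jensen_square[OF \<nu> sets F])
  also have "\<dots> \<le> (\<integral>\<^sup>+z. ennreal (e\<^sup>2) \<partial>\<nu>)"
  proof (rule nn_integral_mono_AE)
    show "AE z in \<nu>. (\<integral>\<^sup>+x. (F x z)\<^sup>2 \<partial>lborel) \<le> ennreal (e\<^sup>2)"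
      using bound
    proof eventually_elim
      case (elim z)
      have "(\<integral>\<^sup>+x. (F x z)\<^sup>2 \<partial>lborel) = (\<integral>\<^sup>+x. ennreal ((cmod (g (x + z) - h x))\<^sup>2) \<partial>lborel)"
        by (simp add: F_def ennreal_power)
      also have "\<dots> = ennreal ((L2_norm (\<lambda>x. g (x + z) - h x))\<^sup>2)"
        by (intro L2_norm_sq_nn L2_diff L2_translate g h)
      also have "\<dots> \<le> ennreal (e\<^sup>2)" using elim by (intro ennreal_leI power_mono) auto
      finally show ?case .
    qed
  qed
  also have "\<dots> = ennreal (e\<^sup>2)" by (simp add: \<nu>.emeasure_space_1)
  finally have main: "(\<integral>\<^sup>+x. (\<integral>\<^sup>+z. F x z \<partial>\<nu>)\<^sup>2 \<partial>lborel) \<le> ennreal (e\<^sup>2)" .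
  have "AE x in lborel. (\<integral>\<^sup>+z. F x z \<partial>\<nu>)\<^sup>2 \<noteq> \<infinity>"
    by (rule nn_integral_PInf_AE) (use main in \<open>auto simp: top_unique\<close>)
  then have AE1: "AE x in lborel. integrable \<nu> (\<lambda>z. g (x + z) - h x)"
  proof eventually_elim
    case (elim x)
    then have "(\<integral>\<^sup>+z. F x z \<partial>\<nu>) < \<infinity>" by (auto simp: less_top power_eq_top_ennreal)
    then show ?case unfolding F_def by (intro integrableI_bounded) measurable
  qed
  then show AE2: "AE x in lborel. integrable \<nu> (\<lambda>z. g (x + z))"
  proof eventually_elim
    case (elim x)
    from Bochner_Integration.integrable_add[OF this \<nu>.integrable_const[of "h x"]] show ?case by simp
  qed
  have pt: "AE x in lborel. ennreal ((cmod (avg \<nu> g x - h x))\<^sup>2) \<le> (\<integral>\<^sup>+z. F x z \<partial>\<nu>)\<^sup>2"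
    using AE1 AE2
  proof eventually_elim
    case (elim x)
    have "avg \<nu> g x - h x = (LINT z|\<nu>. g (x + z) - h x)"
      using elim by (simp add: avg_def \<nu>.prob_space)
    then have "ennreal (cmod (avg \<nu> g x - h x)) \<le> (\<integral>\<^sup>+z. F x z \<partial>\<nu>)"
      unfolding F_def using integral_norm_bound_ennreal[OF elim(1)] by simp
    then have "ennreal (cmod (avg \<nu> g x - h x)) ^ 2 \<le> (\<integral>\<^sup>+z. F x z \<partial>\<nu>)\<^sup>2"
      by (rule power_mono) simp
    then show ?case by (simp add: ennreal_power)
  qed
  have le: "(\<integral>\<^sup>+x. ennreal ((cmod (avg \<nu> g x - h x))\<^sup>2) \<partial>lborel) \<le> ennreal (e\<^sup>2)"
    by (rule order_trans[OF nn_integral_mono_AE[OF pt] main])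
  have int: "integrable lborel (\<lambda>x. (cmod (avg \<nu> g x - h x))\<^sup>2)"
  proof (rule integrableI_bounded)
    show "(\<integral>\<^sup>+x. ennreal (norm ((cmod (avg \<nu> g x - h x))\<^sup>2)) \<partial>lborel) < \<infinity>"
      using le by (auto intro: le_less_trans)
  qed measurable
  then have L: "(\<lambda>x. avg \<nu> g x - h x) \<in> L2" by (simp add: L2_def)
  show "avg \<nu> g \<in> L2" using L2_add[OF L h] by simp
  show "L2_norm (\<lambda>x. avg \<nu> g x - h x) \<le> e"
    using le e unfolding L2_norm_sq_nn[OF L] by (auto simp: ennreal_le_iff intro: power2_le_imp_le)
qed

section \<open>Test functions\<close>

lemma pderivative_eq: "(f has_derivative f') (at x) \<Longrightarrow> pderivative i f x = f' (axis i 1)"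
  by (simp add: pderivative_def frechet_derivative_at[symmetric])

lemma linear_axis_expansion:
  assumes "linear (f :: real ^ 'n \<Rightarrow> real)"
  shows "f h = (\<Sum>i\<in>UNIV. h $ i * f (axis i 1))"
proof -
  have "f h = f (\<Sum>i\<in>UNIV. h $ i *\<^sub>R axis i 1)"
    using basis_expansion[of h] by (simp add: scalar_mult_eq_scaleR)
  also have "\<dots> = (\<Sum>i\<in>UNIV. h $ i * f (axis i 1))"
    using assms by (simp add: linear_sum linear_scale)
  finally show ?thesis .
qed

lemma has_derivative_pderivative:
  assumes "f differentiable at x"
  shows "(f has_derivative (\<lambda>h. \<Sum>i\<in>UNIV. h $ i * pderivative i f x)) (at x)"
proof -
  obtain f' where f': "(f has_derivative f') (at x)" using assms by (auto simp: differentiable_def)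
  have "f' = (\<lambda>h. \<Sum>i\<in>UNIV. h $ i * pderivative i f x)"
  proof
    fix h
    show "f' h = (\<Sum>i\<in>UNIV. h $ i * pderivative i f x)"
      unfolding pderivative_eq[OF f'] by (rule linear_axis_expansion[OF has_derivative_linear[OF f']])
  qed
  then show ?thesis using f' by simp
qed

lemma frechet_derivative_pderivative:
  "f differentiable at x \<Longrightarrow> frechet_derivative f (at x) y = (\<Sum>i\<in>UNIV. y $ i * pderivative i f x)"
  by (simp only: frechet_derivative_at[OF has_derivative_pderivative, symmetric])

subsection \<open>Smooth bump functions\<close>

definition flat_exp :: "nat \<Rightarrow> real \<Rightarrow> real" where
  "flat_exp n t = (if t > 0 then exp (- (1 / t)) / t ^ n else 0)"

lemma flat_exp_tendsto_0: "(flat_exp n \<longlongrightarrow> 0) (at 0)"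
proof (rule filterlim_split_at)
  have "\<forall>\<^sub>F t in at_left 0. flat_exp n t = 0"
    by (auto simp: flat_exp_def eventually_at_filter)
  then show "(flat_exp n \<longlongrightarrow> 0) (at_left 0)" by (rule tendsto_eventually)
  have "((\<lambda>t. inverse t ^ n / exp (inverse t)) \<longlongrightarrow> 0) (at_right (0::real))"
    by (rule filterlim_compose[OF tendsto_power_div_exp_0 filterlim_inverse_at_top_right])
  moreover have "\<forall>\<^sub>F t in at_right (0::real). inverse t ^ n / exp (inverse t) = flat_exp n t"
    by (auto simp: flat_exp_def eventually_at_filter exp_minus divide_simps)
  ultimately show "(flat_exp n \<longlongrightarrow> 0) (at_right 0)"
    by (rule Lim_transform_eventually)
qed

text \<open>
  The denominators \<open>t ^ n\<close> are there to make the linear span of the family closed under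
  differentiation.
\<close>

lemma flat_exp_deriv:
  "(flat_exp n has_real_derivative (flat_exp (n + 2) t - real n * flat_exp (n + 1) t)) (at t)"
proof -
  consider "t > 0" | "t < 0" | "t = 0" by linarith
  then show ?thesis
  proof cases
    case 1
    have "((\<lambda>t. exp (- (1 / t)) / t ^ n) has_real_derivative (flat_exp (n + 2) t - real n * flat_exp (n + 1) t)) (at t)"
    proof (cases n)
      case 0
      then show ?thesis using 1
        by (auto intro!: derivative_eq_intros simp: flat_exp_def power2_eq_square)
    next
      case (Suc m)
      then show ?thesis using 1
        by (auto intro!: derivative_eq_intros simp: flat_exp_def) (cases m; simp add: field_simps power2_eq_square)
    qed
    then show ?thesis
    proof (rule has_field_derivative_transform_within_open[where S="{0<..}"])
      fix s :: real assume "s \<in> {0<..}"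
      then show "exp (- (1 / s)) / s ^ n = flat_exp n s" by (simp add: flat_exp_def)
    qed (use 1 in auto)
  next
    case 2
    have "((\<lambda>t. 0) has_real_derivative 0) (at t)" by simp
    then have "(flat_exp n has_real_derivative 0) (at t)"
    proof (rule has_field_derivative_transform_within_open[where S="{..<0}"])
      fix s :: real assume "s \<in> {..<0}"
      then show "0 = flat_exp n s" by (simp add: flat_exp_def)
    qed (use 2 in auto)
    then show ?thesis using 2 by (simp add: flat_exp_def)
  next
    case 3
    have "((\<lambda>h. (flat_exp n (0 + h) - flat_exp n 0) / h) \<longlongrightarrow> 0) (at 0)"
    proof (rule Lim_transform_eventually[OF flat_exp_tendsto_0[of "n + 1"]])
      show "\<forall>\<^sub>F h in at 0. flat_exp (n + 1) h = (flat_exp n (0 + h) - flat_exp n 0) / h"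
        by (auto simp: flat_exp_def eventually_at_filter)
    qed
    then show ?thesis using 3 by (simp add: DERIV_def flat_exp_def)
  qed
qed

text \<open>
  This algebra is closed under partial derivatives, so each of its members is differentiable to every
  order. The inner function of a bump may be any member, which gives bumps supported on boxes.
\<close>

inductive smooth_alg :: "(real ^ 'n \<Rightarrow> real) \<Rightarrow> bool" where
  const: "smooth_alg (\<lambda>x. c)"
| coord: "smooth_alg (\<lambda>x. x $ i)"
| add: "smooth_alg f \<Longrightarrow> smooth_alg g \<Longrightarrow> smooth_alg (\<lambda>x. f x + g x)"
| mult: "smooth_alg f \<Longrightarrow> smooth_alg g \<Longrightarrow> smooth_alg (\<lambda>x. f x * g x)"
| bump: "smooth_alg q \<Longrightarrow> smooth_alg (\<lambda>x. flat_exp n (q x))"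

lemma smooth_alg_prod: "(\<And>i. i \<in> I \<Longrightarrow> smooth_alg (f i)) \<Longrightarrow> smooth_alg (\<lambda>x. \<Prod>i\<in>I. f i x)"
  by (induction I rule: infinite_finite_induct) (auto intro: smooth_alg.intros)

lemma smooth_alg_derivative:
  fixes f :: "real ^ 'n \<Rightarrow> real"
  assumes "smooth_alg f"
  shows "\<exists>g. (\<forall>i. smooth_alg (g i)) \<and> (\<forall>x. (f has_derivative (\<lambda>h. \<Sum>i\<in>UNIV. h $ i * g i x)) (at x))"
  using assms
proof induction
  case (const c)
  show ?case by (rule exI[of _ "\<lambda>_ _. 0"]) (auto intro: smooth_alg.intros)
next
  case (coord j)
  have "(\<lambda>h::real^'n. \<Sum>i\<in>UNIV. h $ i * (if i = j then 1 else 0)) = (\<lambda>h. h $ j)"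
    by (simp add: if_distrib cong: if_cong)
  then show ?case
    by (intro exI[of _ "\<lambda>i x. if i = j then 1 else 0"])
       (auto intro: smooth_alg.intros bounded_linear_imp_has_derivative bounded_linear_vec_nth)
next
  case (add f1 f2)
  from add.IH(1) obtain g1 where g1: "\<And>i. smooth_alg (g1 i)"
    and d1: "\<And>x. (f1 has_derivative (\<lambda>h. \<Sum>i\<in>UNIV. h $ i * g1 i x)) (at x)" by blast
  from add.IH(2) obtain g2 where g2: "\<And>i. smooth_alg (g2 i)"
    and d2: "\<And>x. (f2 has_derivative (\<lambda>h. \<Sum>i\<in>UNIV. h $ i * g2 i x)) (at x)" by blast
  have "((\<lambda>x. f1 x + f2 x) has_derivative (\<lambda>h. \<Sum>i\<in>UNIV. h $ i * (g1 i x + g2 i x))) (at x)" for x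
    using has_derivative_add[OF d1[of x] d2[of x]] by (simp add: sum.distrib[symmetric] algebra_simps)
  then show ?case
    using g1 g2
    by (intro exI[of _ "\<lambda>i x. g1 i x + g2 i x"]) (auto intro: smooth_alg.intros)
next
  case (mult f1 f2)
  from mult.IH(1) obtain g1 where g1: "\<And>i. smooth_alg (g1 i)"
    and d1: "\<And>x. (f1 has_derivative (\<lambda>h. \<Sum>i\<in>UNIV. h $ i * g1 i x)) (at x)" by blast
  from mult.IH(2) obtain g2 where g2: "\<And>i. smooth_alg (g2 i)"
    and d2: "\<And>x. (f2 has_derivative (\<lambda>h. \<Sum>i\<in>UNIV. h $ i * g2 i x)) (at x)" by blast
  have "((\<lambda>x. f1 x * f2 x) has_derivative (\<lambda>h. \<Sum>i\<in>UNIV. h $ i * (f1 x * g2 i x + g1 i x * f2 x))) (at x)" for x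
    using has_derivative_mult[OF d1[of x] d2[of x]]
    by (simp add: sum.distrib[symmetric] sum_distrib_left sum_distrib_right algebra_simps)
  then show ?case
    using g1 g2 mult.hyps
    by (intro exI[of _ "\<lambda>i x. f1 x * g2 i x + g1 i x * f2 x"]) (auto intro!: smooth_alg.intros)
next
  case (bump q n)
  from bump.IH obtain g where g: "\<And>i. smooth_alg (g i)"
    and d: "\<And>x. (q has_derivative (\<lambda>h. \<Sum>i\<in>UNIV. h $ i * g i x)) (at x)" by blast
  let ?b = "\<lambda>x. flat_exp (n + 2) (q x) + (- real n) * flat_exp (n + 1) (q x)"
  have b: "smooth_alg ?b" using bump.hyps by (intro smooth_alg.intros)
  have "((\<lambda>x. flat_exp n (q x)) has_derivative (\<lambda>h. \<Sum>i\<in>UNIV. h $ i * (?b x * g i x))) (at x)" for x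
  proof -
    have "(flat_exp n has_derivative (\<lambda>h. ?b x * h)) (at (q x))"
      using flat_exp_deriv[of n "q x"] by (simp add: has_field_derivative_def)
    from has_derivative_compose[OF d[of x] this] show ?thesis
      by (simp add: sum_distrib_left sum_subtractf algebra_simps)
  qed
  then show ?case
    using smooth_alg.mult[OF b g] by (intro exI[of _ "\<lambda>i x. ?b x * g i x"]) blast
qed

lemma smooth_alg_pderivative: "smooth_alg f \<Longrightarrow> smooth_alg (pderivative i f)"
proof -
  assume "smooth_alg f"
  then obtain g where g: "\<And>i. smooth_alg (g i)"
    and d: "\<And>x. (f has_derivative (\<lambda>h. \<Sum>i\<in>UNIV. h $ i * g i x)) (at x)"
    using smooth_alg_derivative[OF \<open>smooth_alg f\<close>] by blast
  have "pderivative i f = g i"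
  proof
    fix x
    show "pderivative i f x = g i x"
    proof -
      have "axis i 1 $ j * g j x = (if j = i then g j x else 0)" for j by (simp add: axis_def)
      then show ?thesis unfolding pderivative_eq[OF d] by simp
    qed
  qed
  then show ?thesis using g by simp
qed

lemma smooth_alg_differentiable: "smooth_alg f \<Longrightarrow> f differentiable at x"
  unfolding differentiable_def by (drule smooth_alg_derivative) blast

lemma smooth_alg_Ck: "smooth_alg f \<Longrightarrow> Ck k f"
proof (induction k arbitrary: f)
  case 0
  then show ?case
    by (auto intro!: continuous_at_imp_continuous_on differentiable_imp_continuous_within smooth_alg_differentiable)
next
  case (Suc k)
  then show ?case
    by (auto intro: smooth_alg_pderivative differentiable_at_imp_differentiable_on smooth_alg_differentiable)
qed

text \<open>
  For \<open>a \<le> b\<close> the product \<open>(x\<^sub>i - a\<^sub>i) (b\<^sub>i - x\<^sub>i)\<close> is positive exactly between \<open>a\<^sub>i\<close> and \<open>b\<^sub>i\<close>; multiplying it by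
  \<open>k\<close> drives the exponential to \<open>1\<close> there. It is written with sums and products only, to match the
  rules of \<open>smooth_alg\<close>.
\<close>

definition box_bump :: "real ^ 'n \<Rightarrow> real ^ 'n \<Rightarrow> nat \<Rightarrow> real ^ 'n \<Rightarrow> real" where
  "box_bump a b k x = (\<Prod>i\<in>UNIV. flat_exp 0 (real k * ((x $ i + (- (a $ i))) * (b $ i + (- 1) * x $ i))))"

lemma box_bump_bound: "0 \<le> box_bump a b k x" "box_bump a b k x \<le> 1"
  unfolding box_bump_def by (auto simp: flat_exp_def intro!: prod_nonneg prod_le_1)

lemma mult_pos_iff_between:
  assumes "a \<le> (b::real)" shows "(t - a) * (b - t) > 0 \<longleftrightarrow> a < t \<and> t < b"
  using assms by (auto simp: zero_less_mult_iff)

lemma box_bump_outside: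
  assumes "\<And>i. a $ i \<le> b $ i" "x \<notin> box a b" shows "box_bump a b k x = 0"
proof -
  obtain i where "\<not> (a $ i < x $ i \<and> x $ i < b $ i)" using assms(2) by (auto simp: mem_box_cart)
  then have "(x $ i - a $ i) * (b $ i - x $ i) \<le> 0"
    using mult_pos_iff_between[OF assms(1)[of i], of "x $ i"] by linarith
  then have "flat_exp 0 (real k * ((x $ i + (- (a $ i))) * (b $ i + (- 1) * x $ i))) = 0"
    by (simp add: flat_exp_def mult_nonneg_nonpos not_less)
  then show ?thesis unfolding box_bump_def by (intro prod_zero) auto
qed

lemma box_bump_test_function:
  assumes "\<And>i. a $ i \<le> b $ i" shows "test_function (box_bump a b k)"
proof -
  have "smooth_alg (box_bump a b k)"
    unfolding box_bump_def[abs_def] by (intro smooth_alg_prod smooth_alg.intros)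
  moreover have "{x. box_bump a b k x \<noteq> 0} \<subseteq> cbox a b"
    using box_bump_outside[OF assms] box_subset_cbox by blast
  then have "bounded {x. box_bump a b k x \<noteq> 0}" by (rule bounded_subset[OF bounded_cbox])
  ultimately show ?thesis by (auto simp: test_function_def smooth_alg_Ck)
qed

lemma box_bump_tendsto:
  fixes a b :: "real ^ 'n"
  assumes "\<And>i. a $ i \<le> b $ i"
  shows "(\<lambda>k. box_bump a b k x) \<longlonglongrightarrow> indicator (box a b) x"
proof (cases "x \<in> box a b")
  case True
  have "(\<lambda>k. box_bump a b k x) \<longlonglongrightarrow> (\<Prod>i\<in>(UNIV::'n set). 1)"
    unfolding box_bump_def
  proof (rule tendsto_prod)
    fix i
    let ?t = "(x $ i + (- (a $ i))) * (b $ i + (- 1) * x $ i)"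
    have t: "?t > 0"
      using True mult_pos_iff_between[OF assms[of i], of "x $ i"] by (simp add: mem_box_cart)
    have "(\<lambda>k. exp (- (1 / ?t * (1 / real k)))) \<longlonglongrightarrow> exp (- (1 / ?t * 0))"
      by (intro tendsto_intros lim_1_over_n)
    then have "(\<lambda>k. exp (- (1 / ?t * (1 / real k)))) \<longlonglongrightarrow> 1" by simp
    then show "(\<lambda>k. flat_exp 0 (real k * ?t)) \<longlonglongrightarrow> 1"
    proof (rule Lim_transform_eventually)
      show "\<forall>\<^sub>F k in sequentially. exp (- (1 / ?t * (1 / real k))) = flat_exp 0 (real k * ?t)"
        using eventually_gt_at_top[of 0]
      proof eventually_elim
        case (elim k)
        then have "real k * ?t > 0" using t by simp
        then show ?case by (simp add: flat_exp_def mult.commute)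
      qed
    qed
  qed
  then show ?thesis using True by simp
next
  case False
  then show ?thesis using box_bump_outside[OF assms False] by simp
qed

subsection \<open>Basic properties of test functions\<close>

text \<open>
  The factor \<open>b\<close> is needed for the induction, since the chain rule produces a factor \<open>c\<close> in each step.
\<close>

lemma Ck_affine:
  assumes "Ck k \<phi>"
  shows "Ck k (\<lambda>x. b * \<phi> (y + c *\<^sub>R x))"
  using assms
proof (induction k arbitrary: \<phi> b)
  case 0
  then show ?case by (auto intro!: continuous_intros intro: continuous_on_compose2[of UNIV \<phi>])
next
  case (Suc k)
  have diff: "\<phi> differentiable at x" for x
    using Suc.prems by (auto simp: differentiable_on_def)
  have d: "((\<lambda>x. b * \<phi> (y + c *\<^sub>R x)) has_derivative
      (\<lambda>h. b * frechet_derivative \<phi> (at (y + c *\<^sub>R x)) (c *\<^sub>R h))) (at x)" for x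
  proof -
    have "((\<lambda>x. y + c *\<^sub>R x) has_derivative (\<lambda>h. c *\<^sub>R h)) (at x)"
      by (auto intro!: derivative_eq_intros)
    from has_derivative_compose[OF this frechet_derivative_works[THEN iffD1, OF diff]]
    show ?thesis by (intro has_derivative_mult_right)
  qed
  have p: "pderivative i (\<lambda>x. b * \<phi> (y + c *\<^sub>R x)) = (\<lambda>x. (b * c) * pderivative i \<phi> (y + c *\<^sub>R x))" for i
  proof
    fix x
    have "linear (frechet_derivative \<phi> (at (y + c *\<^sub>R x)))"
      using linear_frechet_derivative[OF diff] .
    then show "pderivative i (\<lambda>x. b * \<phi> (y + c *\<^sub>R x)) x = (b * c) * pderivative i \<phi> (y + c *\<^sub>R x)"
      unfolding pderivative_eq[OF d] by (simp add: pderivative_def linear_scale)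
  qed
  have "(\<lambda>x. b * \<phi> (y + c *\<^sub>R x)) differentiable_on UNIV"
    using d by (auto simp: differentiable_on_def differentiable_def)
  then show ?case using Suc by (simp add: p)
qed

lemma test_function_differentiable: "test_function \<phi> \<Longrightarrow> \<phi> differentiable at x"
proof -
  assume "test_function \<phi>"
  then have "Ck (Suc 0) \<phi>" unfolding test_function_def by blast
  then show ?thesis by (simp add: differentiable_on_def)
qed

lemma test_function_affine:
  assumes "test_function \<phi>" "c \<noteq> 0"
  shows "test_function (\<lambda>x. \<phi> (y + c *\<^sub>R x))"
proof -
  have "bounded {x. \<phi> x \<noteq> 0}" using assms by (simp add: test_function_def)
  then have "bounded ((\<lambda>z. (1 / c) *\<^sub>R (- y + z)) ` {x. \<phi> x \<noteq> 0})"
    by (intro bounded_scaling[of "(\<lambda>z. - y + z) ` {x. \<phi> x \<noteq> 0}" "1/c", unfolded image_image] bounded_translation)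
  moreover have "{x. \<phi> (y + c *\<^sub>R x) \<noteq> 0} \<subseteq> (\<lambda>z. (1 / c) *\<^sub>R (- y + z)) ` {x. \<phi> x \<noteq> 0}"
  proof
    fix x assume "x \<in> {x. \<phi> (y + c *\<^sub>R x) \<noteq> 0}"
    then show "x \<in> (\<lambda>z. (1 / c) *\<^sub>R (- y + z)) ` {x. \<phi> x \<noteq> 0}"
      using assms(2) by (intro image_eqI[of _ _ "y + c *\<^sub>R x"]) auto
  qed
  ultimately have "bounded {x. \<phi> (y + c *\<^sub>R x) \<noteq> 0}" by (rule bounded_subset)
  then show ?thesis
    using assms Ck_affine[of _ \<phi> 1 y c] by (simp add: test_function_def)
qed

lemma continuous_compact_support_bound:
  fixes f :: "real ^ 'n \<Rightarrow> 'b::real_normed_vector"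
  assumes "continuous_on UNIV f" "\<And>x. norm x > R \<Longrightarrow> f x = 0"
  obtains B where "B \<ge> 0" "\<And>x. norm (f x) \<le> B * indicator (cball 0 R) x"
proof -
  have "compact (f ` cball 0 R)"
    using assms(1) by (intro compact_continuous_image) (auto intro: continuous_on_subset)
  then have "bounded (f ` cball 0 R)" by (rule compact_imp_bounded)
  then obtain B where "\<forall>y\<in>f ` cball 0 R. norm y \<le> B" unfolding bounded_iff by blast
  then have B: "\<And>x. x \<in> cball 0 R \<Longrightarrow> norm (f x) \<le> B" by blast
  have "norm (f x) \<le> max B 0 * indicator (cball 0 R) x" for x
    using B[of x] assms(2)[of x] by (cases "norm x \<le> R") (auto simp: indicator_def)
  then show ?thesis by (intro that[of "max B 0"]) auto
qed

lemma integrable_indicator_cball: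
  "integrable lborel (\<lambda>x. B * indicator (cball (0::real^'n) R) x :: real)"
  using emeasure_bounded_finite[of "cball (0::real^'n) R"]
  by (intro integrable_mult_right integrable_real_indicator) auto

lemma test_function_continuous: "test_function \<phi> \<Longrightarrow> continuous_on UNIV \<phi>"
  using test_function_differentiable by (auto intro: continuous_at_imp_continuous_on differentiable_imp_continuous_within)

lemma test_function_pderivative_continuous: "test_function \<phi> \<Longrightarrow> continuous_on UNIV (pderivative i \<phi>)"
proof -
  assume "test_function \<phi>"
  then have "Ck (Suc 0) \<phi>" unfolding test_function_def by blast
  then show ?thesis by simp
qed

lemma test_function_bounds:
  assumes "test_function (\<phi> :: real ^ 'n \<Rightarrow> real)"
  obtains B R where "B \<ge> 0" "\<And>x. \<bar>\<phi> x\<bar> \<le> B * indicator (cball 0 R) x"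
    "\<And>i x. \<bar>pderivative i \<phi> x\<bar> \<le> B * indicator (cball 0 R) x"
proof -
  have "bounded {x. \<phi> x \<noteq> 0}" using assms by (simp add: test_function_def)
  then obtain R where R: "\<And>x. \<phi> x \<noteq> 0 \<Longrightarrow> norm x \<le> R" by (auto simp: bounded_iff)
  have Z: "\<phi> x = 0" if "norm x > R" for x using R[of x] that by force
  have Z2: "pderivative i \<phi> x = 0" if "norm x > R" for x i
  proof -
    have "((\<lambda>_. 0) has_derivative (\<lambda>_. 0)) (at x)" by simp
    then have "(\<phi> has_derivative (\<lambda>_. 0)) (at x)"
    proof (rule has_derivative_transform_within_open[where s="- cball 0 R"])
      show "\<And>y. y \<in> - cball 0 R \<Longrightarrow> 0 = \<phi> y" using Z by auto
    qed (use that in auto)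
    from pderivative_eq[OF this] show ?thesis .
  qed
  obtain B0 where B0: "B0 \<ge> 0" "\<And>x. norm (\<phi> x) \<le> B0 * indicator (cball 0 R) x"
    using continuous_compact_support_bound[OF test_function_continuous[OF assms] Z] by blast
  have "\<exists>B. B \<ge> 0 \<and> (\<forall>x. norm (pderivative i \<phi> x) \<le> B * indicator (cball 0 R) x)" for i
    using continuous_compact_support_bound[OF test_function_pderivative_continuous[OF assms, of i] Z2] by blast
  then obtain B1 where B1: "\<And>i. B1 i \<ge> 0" "\<And>i x. norm (pderivative i \<phi> x) \<le> B1 i * indicator (cball 0 R) x"
    by metis
  let ?B = "B0 + (\<Sum>i\<in>UNIV. B1 i)"
  have le: "B0 \<le> ?B" "B1 i \<le> ?B" for i
    using B0 B1(1) member_le_sum[of i UNIV B1] by (auto simp: sum_nonneg add_increasing)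
  show ?thesis
  proof (rule that[of ?B R])
    show "?B \<ge> 0" using B0 le(1) by linarith
    show "\<bar>\<phi> x\<bar> \<le> ?B * indicator (cball 0 R) x" for x
      using order_trans[OF B0(2) mult_right_mono[OF le(1)]] by simp
    show "\<bar>pderivative i \<phi> x\<bar> \<le> ?B * indicator (cball 0 R) x" for i x
      using order_trans[OF B1(2) mult_right_mono[OF le(2)]] by simp
  qed
qed

lemma locally_integrable_measurable:
  fixes u :: "real ^ 'n \<Rightarrow> complex"
  assumes "locally_integrable u" shows "u \<in> borel_measurable borel"
proof (rule borel_measurable_LIMSEQ_metric)
  show "(\<lambda>x. indicator (cball 0 (real n)) x *\<^sub>R u x) \<in> borel_measurable borel" for n
    using assms by (auto simp: locally_integrable_def set_integrable_def dest!: spec[of _ "cball 0 (real n)"])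
  fix x :: "real ^ 'n"
  obtain n0 :: nat where n0: "norm x \<le> n0" using real_arch_simple by blast
  have "\<forall>\<^sub>F n in sequentially. indicator (cball 0 (real n)) x *\<^sub>R u x = u x"
    using eventually_ge_at_top[of n0]
  proof eventually_elim
    case (elim n)
    then have "norm x \<le> n" using n0 by (meson order_trans of_nat_mono)
    then show ?case by simp
  qed
  then show "(\<lambda>n. indicator (cball 0 (real n)) x *\<^sub>R u x) \<longlonglongrightarrow> u x"
    by (rule tendsto_eventually)
qed

lemma locally_integrable_cball_bound:
  fixes u :: "real ^ 'n \<Rightarrow> complex"
  assumes "locally_integrable u" and [measurable]: "\<psi> \<in> borel_measurable borel"
    and b: "\<And>x. \<bar>\<psi> x\<bar> \<le> B * indicator (cball 0 R) x"
  shows "integrable lborel (\<lambda>x. \<psi> x *\<^sub>R u x)"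
proof (rule Bochner_Integration.integrable_bound)
  have [measurable]: "u \<in> borel_measurable borel" using locally_integrable_measurable[OF assms(1)] .
  have "integrable lborel (\<lambda>x. indicator (cball 0 R) x *\<^sub>R u x)"
    using assms(1) by (auto simp: locally_integrable_def set_integrable_def)
  then show "integrable lborel (\<lambda>x. B *\<^sub>R (indicator (cball 0 R) x *\<^sub>R u x))"
    by (rule integrable_scaleR_right)
  show "(\<lambda>x. \<psi> x *\<^sub>R u x) \<in> borel_measurable lborel" by measurable
  show "AE x in lborel. norm (\<psi> x *\<^sub>R u x) \<le> norm (B *\<^sub>R (indicator (cball 0 R) x *\<^sub>R u x))"
  proof (rule AE_I2)
    fix x
    have "\<bar>\<psi> x\<bar> * cmod (u x) \<le> \<bar>B * indicator (cball 0 R) x\<bar> * cmod (u x)"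
      using b[of x] by (intro mult_right_mono) auto
    then show "norm (\<psi> x *\<^sub>R u x) \<le> norm (B *\<^sub>R (indicator (cball 0 R) x *\<^sub>R u x))"
      by (simp add: abs_mult mult.assoc)
  qed
qed

lemma L2_locally_integrable:
  fixes u :: "real ^ 'n \<Rightarrow> complex"
  assumes "u \<in> L2" shows "locally_integrable u"
  unfolding locally_integrable_def set_integrable_def
proof (intro allI impI)
  fix K :: "(real ^ 'n) set" assume K: "compact K"
  have [measurable]: "u \<in> borel_measurable borel" using assms by measurable
  have [measurable]: "K \<in> sets borel" using K by (simp add: borel_compact)
  show "integrable lborel (\<lambda>x. indicator K x *\<^sub>R u x)"
  proof (rule Bochner_Integration.integrable_bound)
    show "integrable lborel (\<lambda>x. indicator K x + (cmod (u x))\<^sup>2 :: real)"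
      using K emeasure_compact_finite[OF K] L2_integrable_square[OF assms]
      by (intro Bochner_Integration.integrable_add integrable_real_indicator) auto
    have "t \<le> 1 + t\<^sup>2" for t :: real
      using sum_squares_bound[of t 1] zero_le_power2[of t] unfolding one_power2 mult_1_right by linarith
    then show "AE x in lborel. norm (indicator K x *\<^sub>R u x) \<le> norm (indicator K x + (cmod (u x))\<^sup>2)"
      by (auto simp: indicator_def)
  qed measurable
qed

text \<open>
  Test functions converge boundedly to the indicator of any box, so a function orthogonal to all of
  them has vanishing integral over every box, and Lebesgue differentiation applies.
\<close>

lemma fundamental_lemma:
  fixes v :: "real ^ 'n \<Rightarrow> complex"
  assumes v: "locally_integrable v" and orth: "\<And>\<phi>. test_function \<phi> \<Longrightarrow> (LINT x|lborel. \<phi> x *\<^sub>R v x) = 0"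
  shows "AE x in lborel. v x = 0"
proof -
  have [measurable]: "v \<in> borel_measurable borel" using locally_integrable_measurable[OF v] .
  have si: "set_integrable lborel (cbox a b) v" for a b
    using v by (auto simp: locally_integrable_def)
  have int: "v integrable_on cbox a b" for a b
    using set_borel_integral_eq_integral(1)[OF si] .
  have zero: "integral (cbox a b) v = 0" if ab: "\<And>i. a $ i \<le> b $ i" for a b
  proof -
    have "(\<lambda>k. LINT x|lborel. box_bump a b k x *\<^sub>R v x) \<longlonglongrightarrow> (LINT x|lborel. indicator (box a b) x *\<^sub>R v x)"
    proof (rule integral_dominated_convergence[where w="\<lambda>x. norm (indicator (cbox a b) x *\<^sub>R v x)"])
      show "(\<lambda>x. box_bump a b k x *\<^sub>R v x) \<in> borel_measurable lborel" for k
      proof -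
        have [measurable]: "box_bump a b k \<in> borel_measurable borel"
          by (intro borel_measurable_continuous_onI test_function_continuous box_bump_test_function ab)
        show ?thesis by measurable
      qed
      show "integrable lborel (\<lambda>x. norm (indicator (cbox a b) x *\<^sub>R v x))"
        using si[of a b] unfolding set_integrable_def by (rule integrable_norm)
      show "AE x in lborel. (\<lambda>k. box_bump a b k x *\<^sub>R v x) \<longlonglongrightarrow> indicator (box a b) x *\<^sub>R v x"
        by (intro AE_I2 tendsto_intros box_bump_tendsto ab)
      show "AE x in lborel. norm (box_bump a b k x *\<^sub>R v x) \<le> norm (indicator (cbox a b) x *\<^sub>R v x)" for k
      proof (rule AE_I2)
        fix x
        have "\<bar>box_bump a b k x\<bar> \<le> indicator (cbox a b) x"
          using box_bump_bound[of a b k x] box_bump_outside[OF ab, of x k] box_subset_cbox[of a b]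
          by (auto simp: indicator_def)
        then show "norm (box_bump a b k x *\<^sub>R v x) \<le> norm (indicator (cbox a b) x *\<^sub>R v x)"
          by (simp add: mult_right_mono)
      qed
    qed measurable
    moreover have "(LINT x|lborel. box_bump a b k x *\<^sub>R v x) = 0" for k
      by (rule orth[OF box_bump_test_function[OF ab]])
    ultimately have "(LINT x:box a b|lborel. v x) = 0"
      by (simp add: set_lebesgue_integral_def LIMSEQ_const_iff)
    moreover have "set_integrable lborel (box a b) v"
      by (rule set_integrable_subset[OF si]) (auto intro: box_subset_cbox[THEN subsetD])
    ultimately have "integral (box a b) v = 0"
      using set_borel_integral_eq_integral(2)[of "box a b" v] by simp
    then show ?thesis by (simp add: integral_open_interval)
  qed
  obtain N where N: "negligible N" and *: "\<And>x e. \<lbrakk>x \<notin> N; 0 < e\<rbrakk> \<Longrightarrow> \<exists>d>0. \<forall>h. 0 < h \<and> h < d \<longrightarrow>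
     norm (integral (cbox x (x + h *\<^sub>R One)) v /\<^sub>R h ^ DIM(real^'n) - v x) < e"
    using integrable_ccontinuous_explicit[OF int] by blast
  have "v x = 0" if xN: "x \<notin> N" for x
  proof (rule ccontr)
    assume "v x \<noteq> 0"
    then obtain d where d: "d > 0" and d': "\<And>h. 0 < h \<Longrightarrow> h < d \<Longrightarrow>
      norm (integral (cbox x (x + h *\<^sub>R One)) v /\<^sub>R h ^ DIM(real^'n) - v x) < norm (v x)"
      using *[OF xN, of "norm (v x)"] by auto
    have "integral (cbox x (x + (d/2) *\<^sub>R One)) v = 0"
    proof (rule zero)
      fix i :: 'n
      have "(One :: real ^ 'n) $ i = (\<Sum>b\<in>Basis. 1 *\<^sub>R b) \<bullet> (axis i 1 :: real ^ 'n)"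
        unfolding cart_eq_inner_axis by simp
      also have "\<dots> = 1" by (rule inner_sum_left_Basis) simp
      finally have "(One :: real ^ 'n) $ i = 1" .
      then show "x $ i \<le> (x + (d/2) *\<^sub>R One) $ i" using d by simp
    qed
    then show False using d'[of "d / 2"] d by simp
  qed
  then have "{x. v x \<noteq> 0} \<subseteq> N" by auto
  then have "negligible {x. v x \<noteq> 0}" by (rule negligible_subset[OF N])
  then have "{x. v x \<noteq> 0} \<in> null_sets lebesgue" by (simp add: negligible_iff_null_sets)
  then have "{x. v x \<noteq> 0} \<in> null_sets lborel"
    by (subst (asm) null_sets_completion_iff) auto
  then show ?thesis by (subst AE_iff_null) auto
qed

section \<open>Directional weak derivatives in the space of square integrable functions\<close>

text \<open>
  Derivatives in arbitrary directions are used because finite differences along any vector are needed.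
  Membership of both functions in \<open>L2\<close> is included.
\<close>

definition wd :: "real ^ 'n \<Rightarrow> (real ^ 'n \<Rightarrow> complex) \<Rightarrow> (real ^ 'n \<Rightarrow> complex) \<Rightarrow> bool" where
  "wd y f g \<longleftrightarrow> f \<in> L2 \<and> g \<in> L2 \<and> (\<forall>\<phi>. test_function \<phi> \<longrightarrow>
     (LINT x|lborel. frechet_derivative \<phi> (at x) y *\<^sub>R f x) = - (LINT x|lborel. \<phi> x *\<^sub>R g x))"

lemma wd_L2: "wd y f g \<Longrightarrow> f \<in> L2" "wd y f g \<Longrightarrow> g \<in> L2"
  by (auto simp: wd_def)

lemma wd_axis_iff:
  "wd (axis i 1) f g \<longleftrightarrow> f \<in> L2 \<and> g \<in> L2 \<and> has_weak_pd i f g"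
  using L2_locally_integrable[of f] L2_locally_integrable[of g]
  unfolding wd_def has_weak_pd_def pderivative_def by blast

lemma frechet_derivative_linear_test:
  "test_function \<phi> \<Longrightarrow> linear (frechet_derivative \<phi> (at x))"
  by (intro linear_frechet_derivative test_function_differentiable)

lemma test_function_directional_bounds:
  fixes \<phi> :: "real ^ 'n \<Rightarrow> real"
  assumes "test_function \<phi>"
  obtains B R where "\<And>x. \<bar>\<phi> x\<bar> \<le> B * indicator (cball 0 R) x"
    "\<And>x. \<bar>frechet_derivative \<phi> (at x) y\<bar> \<le> B * indicator (cball 0 R) x"
proof -
  obtain B R where B: "B \<ge> 0" "\<And>x. \<bar>\<phi> x\<bar> \<le> B * indicator (cball 0 R) x"
    "\<And>i x. \<bar>pderivative i \<phi> x\<bar> \<le> B * indicator (cball 0 R) x"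
    using test_function_bounds[OF assms] by metis
  let ?S = "\<Sum>i\<in>UNIV. \<bar>y $ i\<bar>"
  have S: "?S \<ge> 0" by (simp add: sum_nonneg)
  have 1: "\<bar>frechet_derivative \<phi> (at x) y\<bar> \<le> (B + ?S * B) * indicator (cball 0 R) x" for x
  proof -
    have "\<bar>frechet_derivative \<phi> (at x) y\<bar> \<le> (\<Sum>i\<in>UNIV. \<bar>y $ i\<bar> * \<bar>pderivative i \<phi> x\<bar>)"
      unfolding frechet_derivative_pderivative[OF test_function_differentiable[OF assms]]
      by (rule order_trans[OF sum_abs]) (simp add: abs_mult)
    also have "\<dots> \<le> (\<Sum>i\<in>UNIV. \<bar>y $ i\<bar> * (B * indicator (cball 0 R) x))"
      by (intro sum_mono mult_left_mono B) auto
    also have "\<dots> = ?S * (B * indicator (cball 0 R) x)" by (simp add: sum_distrib_right)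
    also have "\<dots> \<le> (B + ?S * B) * indicator (cball 0 R) x"
      using B(1) by (simp add: indicator_def)
    finally show ?thesis .
  qed
  have 2: "\<bar>\<phi> x\<bar> \<le> (B + ?S * B) * indicator (cball 0 R) x" for x
  proof -
    have "B * indicator (cball 0 R) x \<le> (B + ?S * B) * indicator (cball 0 R) x"
      using B(1) S by (intro mult_right_mono) auto
    then show ?thesis using B(2)[of x] by linarith
  qed
  show ?thesis using that[OF 2 1] .
qed

lemma test_function_directional_measurable:
  assumes "test_function \<phi>"
  shows "\<phi> \<in> borel_measurable borel" "(\<lambda>x. frechet_derivative \<phi> (at x) y) \<in> borel_measurable borel"
proof -
  show "\<phi> \<in> borel_measurable borel"
    by (intro borel_measurable_continuous_onI test_function_continuous assms)
  have "(\<lambda>x. frechet_derivative \<phi> (at x) y) = (\<lambda>x. \<Sum>i\<in>UNIV. y $ i * pderivative i \<phi> x)"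
    using frechet_derivative_pderivative[OF test_function_differentiable[OF assms]] by blast
  moreover have [measurable]: "pderivative i \<phi> \<in> borel_measurable borel" for i
    by (intro borel_measurable_continuous_onI test_function_pderivative_continuous assms)
  ultimately show "(\<lambda>x. frechet_derivative \<phi> (at x) y) \<in> borel_measurable borel" by simp
qed

lemma test_function_integrable:
  assumes "test_function \<phi>" "f \<in> L2"
  shows "integrable lborel (\<lambda>x. \<phi> x *\<^sub>R f x)"
    "integrable lborel (\<lambda>x. frechet_derivative \<phi> (at x) y *\<^sub>R f x)"
proof -
  obtain B R where *: "\<And>x. \<bar>\<phi> x\<bar> \<le> B * indicator (cball 0 R) x"
    "\<And>x. \<bar>frechet_derivative \<phi> (at x) y\<bar> \<le> B * indicator (cball 0 R) x"
    using test_function_directional_bounds[OF assms(1)] by metis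
  show "integrable lborel (\<lambda>x. \<phi> x *\<^sub>R f x)"
    by (rule locally_integrable_cball_bound[OF L2_locally_integrable[OF assms(2)] _ *(1)])
       (rule test_function_directional_measurable[OF assms(1)])
  show "integrable lborel (\<lambda>x. frechet_derivative \<phi> (at x) y *\<^sub>R f x)"
    by (rule locally_integrable_cball_bound[OF L2_locally_integrable[OF assms(2)] _ *(2)])
       (rule test_function_directional_measurable[OF assms(1)])
qed

lemma test_function_square_integrable:
  fixes \<phi> :: "real ^ 'n \<Rightarrow> real"
  assumes "test_function \<phi>"
  shows "integrable lborel (\<lambda>x. (\<phi> x)\<^sup>2)" "integrable lborel (\<lambda>x. (frechet_derivative \<phi> (at x) y)\<^sup>2)"
proof -
  obtain B R where *: "\<And>x. \<bar>\<phi> x\<bar> \<le> B * indicator (cball 0 R) x"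
    "\<And>x. \<bar>frechet_derivative \<phi> (at x) y\<bar> \<le> B * indicator (cball 0 R) x"
    using test_function_directional_bounds[OF assms(1)] by metis
  note [measurable] = test_function_directional_measurable[OF assms]
  have "integrable lborel (\<lambda>x. (\<psi> x)\<^sup>2)" if b: "\<And>x. \<bar>\<psi> x\<bar> \<le> B * indicator (cball 0 R) x"
    and [measurable]: "\<psi> \<in> borel_measurable borel" for \<psi> :: "real ^ 'n \<Rightarrow> real"
  proof (rule Bochner_Integration.integrable_bound[OF integrable_indicator_cball[of "B\<^sup>2" R]])
    show "AE x in lborel. norm ((\<psi> x)\<^sup>2) \<le> norm (B\<^sup>2 * indicator (cball 0 R) x)"
    proof (rule AE_I2)
      fix x
      have "\<bar>\<psi> x\<bar>\<^sup>2 \<le> (B * indicator (cball 0 R) x)\<^sup>2" by (intro power_mono b) auto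
      then show "norm ((\<psi> x)\<^sup>2) \<le> norm (B\<^sup>2 * indicator (cball 0 R) x)"
        by (cases "norm x \<le> R") auto
    qed
  qed measurable
  from this[OF *(1)] this[OF *(2)]
  show "integrable lborel (\<lambda>x. (\<phi> x)\<^sup>2)" "integrable lborel (\<lambda>x. (frechet_derivative \<phi> (at x) y)\<^sup>2)"
    by measurable
qed

lemma frechet_derivative_translate:
  fixes \<phi> :: "real ^ 'n \<Rightarrow> real"
  assumes "test_function \<phi>"
  shows "frechet_derivative (\<lambda>x. \<phi> (x + z)) (at x) y = frechet_derivative \<phi> (at (x + z)) y"
proof -
  have "((\<lambda>x. x + z) has_derivative (\<lambda>h. h)) (at x)" by (auto intro!: derivative_eq_intros)
  from has_derivative_compose[OF this frechet_derivative_works[THEN iffD1, OF test_function_differentiable[OF assms]]]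
  have "((\<lambda>x. \<phi> (x + z)) has_derivative frechet_derivative \<phi> (at (x + z))) (at x)" by simp
  from frechet_derivative_at[OF this] show ?thesis by simp
qed

lemma test_function_translate: "test_function \<phi> \<Longrightarrow> test_function (\<lambda>x. \<phi> (x + z))"
  using test_function_affine[of \<phi> 1 z] by (simp add: add.commute)

lemma wdI:
  assumes "f \<in> L2" "g \<in> L2" "\<And>\<phi>. test_function \<phi> \<Longrightarrow>
     (LINT x|lborel. frechet_derivative \<phi> (at x) y *\<^sub>R f x) = - (LINT x|lborel. \<phi> x *\<^sub>R g x)"
  shows "wd y f g"
  using assms by (simp add: wd_def)

lemma wdD:
  "wd y f g \<Longrightarrow> test_function \<phi> \<Longrightarrow>
     (LINT x|lborel. frechet_derivative \<phi> (at x) y *\<^sub>R f x) = - (LINT x|lborel. \<phi> x *\<^sub>R g x)"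
  by (simp add: wd_def)

lemma integral_scaleR_scaleR:
  "(LINT x|M. a x *\<^sub>R c *\<^sub>R g x) = c *\<^sub>R (LINT x|M. a x *\<^sub>R g x :: complex)"
  by (simp only: scaleR_left_commute[of _ c] integral_scaleR_right)

lemma wd_scale_direction:
  assumes "wd y f g" shows "wd (c *\<^sub>R y) f (\<lambda>x. c *\<^sub>R g x)"
proof (rule wdI)
  fix \<phi> :: "real ^ 'a \<Rightarrow> real" assume t: "test_function \<phi>"
  have "(LINT x|lborel. frechet_derivative \<phi> (at x) (c *\<^sub>R y) *\<^sub>R f x)
      = (LINT x|lborel. c *\<^sub>R (frechet_derivative \<phi> (at x) y *\<^sub>R f x))"
    using linear_scale[OF frechet_derivative_linear_test[OF t]] by simp
  also have "\<dots> = - (LINT x|lborel. \<phi> x *\<^sub>R c *\<^sub>R g x)"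
    unfolding integral_scaleR_scaleR integral_scaleR_right wdD[OF assms t] by simp
  finally show "(LINT x|lborel. frechet_derivative \<phi> (at x) (c *\<^sub>R y) *\<^sub>R f x)
     = - (LINT x|lborel. \<phi> x *\<^sub>R c *\<^sub>R g x)" .
qed (use wd_L2[OF assms] in auto)

lemma wd_add_direction:
  assumes "wd y f g" "wd z f h" shows "wd (y + z) f (\<lambda>x. g x + h x)"
proof (rule wdI)
  fix \<phi> :: "real ^ 'a \<Rightarrow> real" assume t: "test_function \<phi>"
  note L = wd_L2[OF assms(1)] wd_L2[OF assms(2)]
  have "(LINT x|lborel. frechet_derivative \<phi> (at x) (y + z) *\<^sub>R f x)
      = (LINT x|lborel. frechet_derivative \<phi> (at x) y *\<^sub>R f x + frechet_derivative \<phi> (at x) z *\<^sub>R f x)"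
    using linear_add[OF frechet_derivative_linear_test[OF t]] by (simp add: scaleR_left_distrib)
  also have "\<dots> = - (LINT x|lborel. \<phi> x *\<^sub>R g x) - (LINT x|lborel. \<phi> x *\<^sub>R h x)"
    using wdD[OF assms(1) t] wdD[OF assms(2) t] test_function_integrable(2)[OF t] L by simp
  also have "\<dots> = - (LINT x|lborel. \<phi> x *\<^sub>R (g x + h x))"
    using test_function_integrable(1)[OF t] L by (simp add: scaleR_right_distrib)
  finally show "(LINT x|lborel. frechet_derivative \<phi> (at x) (y + z) *\<^sub>R f x)
     = - (LINT x|lborel. \<phi> x *\<^sub>R (g x + h x))" .
qed (use wd_L2[OF assms(1)] wd_L2[OF assms(2)] in auto)

lemma wd_sum_direction:
  fixes f :: "real ^ 'n \<Rightarrow> complex"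
  assumes "\<And>i. i \<in> I \<Longrightarrow> wd (y i) f (g i)" "f \<in> L2"
  shows "wd (\<Sum>i\<in>I. y i) f (\<lambda>x. \<Sum>i\<in>I. g i x)"
proof -
  have 0: "wd 0 f (\<lambda>x. 0)"
  proof (rule wdI)
    fix \<phi> :: "real ^ 'n \<Rightarrow> real" assume t: "test_function \<phi>"
    show "(LINT x|lborel. frechet_derivative \<phi> (at x) 0 *\<^sub>R f x) = - (LINT x|lborel. \<phi> x *\<^sub>R 0)"
      by (simp add: linear_0[OF frechet_derivative_linear_test[OF t]])
  qed (use assms(2) in auto)
  show ?thesis
    using assms(1)
    by (induction I rule: infinite_finite_induct) (simp_all add: 0 wd_add_direction)
qed

lemma wd_diff:
  assumes "wd y f g" "wd y f' g'" shows "wd y (\<lambda>x. f x - f' x) (\<lambda>x. g x - g' x)"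
proof (rule wdI)
  fix \<phi> :: "real ^ 'a \<Rightarrow> real" assume t: "test_function \<phi>"
  note L = wd_L2[OF assms(1)] wd_L2[OF assms(2)]
  show "(LINT x|lborel. frechet_derivative \<phi> (at x) y *\<^sub>R (f x - f' x))
     = - (LINT x|lborel. \<phi> x *\<^sub>R (g x - g' x))"
    using wdD[OF assms(1) t] wdD[OF assms(2) t] test_function_integrable[OF t] L
    by (simp add: scaleR_diff_right)
qed (use wd_L2[OF assms(1)] wd_L2[OF assms(2)] in auto)

lemma wd_scale:
  assumes "wd y f g" shows "wd y (\<lambda>x. c *\<^sub>R f x) (\<lambda>x. c *\<^sub>R g x)"
proof (rule wdI)
  fix \<phi> :: "real ^ 'a \<Rightarrow> real" assume t: "test_function \<phi>"
  show "(LINT x|lborel. frechet_derivative \<phi> (at x) y *\<^sub>R c *\<^sub>R f x) = - (LINT x|lborel. \<phi> x *\<^sub>R c *\<^sub>R g x)"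
    unfolding integral_scaleR_scaleR wdD[OF assms t] by simp
qed (use wd_L2[OF assms] in auto)

lemma wd_translate:
  assumes "wd y f g" shows "wd y (\<lambda>x. f (x + z)) (\<lambda>x. g (x + z))"
proof (rule wdI)
  fix \<phi> :: "real ^ 'a \<Rightarrow> real" assume t: "test_function \<phi>"
  have [measurable]: "f \<in> borel_measurable borel" "g \<in> borel_measurable borel"
    using wd_L2[OF assms] by measurable
  note [measurable] = test_function_directional_measurable[OF t]
  let ?\<psi> = "\<lambda>x. \<phi> (x + (- z))"
  have "(LINT x|lborel. frechet_derivative \<phi> (at x) y *\<^sub>R f (x + z))
      = (LINT x|lborel. frechet_derivative \<phi> (at (x + (- z))) y *\<^sub>R f (x + (- z) + z))"
    by (rule integral_translate[symmetric, where f="\<lambda>x. frechet_derivative \<phi> (at x) y *\<^sub>R f (x + z)"]) measurable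
  also have "\<dots> = (LINT x|lborel. frechet_derivative ?\<psi> (at x) y *\<^sub>R f x)"
    by (simp only: frechet_derivative_translate[OF t] add.assoc left_minus add_0_right)
  also have "\<dots> = - (LINT x|lborel. ?\<psi> x *\<^sub>R g x)"
    by (rule wdD[OF assms test_function_translate[OF t]])
  also have "(LINT x|lborel. ?\<psi> x *\<^sub>R g x) = (LINT x|lborel. \<phi> (x + (- z)) *\<^sub>R g (x + (- z) + z))"
    by simp
  also have "\<dots> = (LINT x|lborel. \<phi> x *\<^sub>R g (x + z))"
    by (rule integral_translate[where f="\<lambda>x. \<phi> x *\<^sub>R g (x + z)"]) measurable
  finally show "(LINT x|lborel. frechet_derivative \<phi> (at x) y *\<^sub>R f (x + z))
      = - (LINT x|lborel. \<phi> x *\<^sub>R g (x + z))" .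
qed (use wd_L2[OF assms] in auto)

subsection \<open>Weakly differentiable functions are absolutely continuous along lines\<close>

text \<open>
  The uniform distribution on \<open>[0, 1]\<close>, and below its image on the segment from \<open>0\<close> to \<open>y\<close>: integrals along
  segments become averages of translates.
\<close>

definition uniform_01 :: "real measure" where "uniform_01 = density lborel (\<lambda>s. ennreal (indicator {0..1} s))"

definition segment_measure :: "real ^ 'n \<Rightarrow> (real ^ 'n) measure" where
  "segment_measure y = distr uniform_01 borel (\<lambda>s. s *\<^sub>R y)"

lemma sets_uniform_01 [measurable_cong, simp]: "sets uniform_01 = sets borel"
  by (simp add: uniform_01_def)

lemma prob_space_uniform_01: "prob_space uniform_01"
  by (rule prob_spaceI) (simp add: uniform_01_def emeasure_density ennreal_indicator)

lemma AE_uniform_01: "(\<And>s. 0 \<le> s \<Longrightarrow> s \<le> 1 \<Longrightarrow> P s) \<Longrightarrow> AE s in uniform_01. P s"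
  unfolding uniform_01_def by (subst AE_density) (auto simp: indicator_def split: if_splits)

lemma sets_segment_measure [simp]: "sets (segment_measure y) = sets borel"
  by (simp add: segment_measure_def)

lemma prob_space_segment_measure: "prob_space (segment_measure y)"
  unfolding segment_measure_def by (rule prob_space.prob_space_distr[OF prob_space_uniform_01]) measurable

lemma AE_segment_measure:
  assumes "\<And>s. 0 \<le> s \<Longrightarrow> s \<le> 1 \<Longrightarrow> P (s *\<^sub>R y)" "Measurable.pred borel P"
  shows "AE z in segment_measure y. P z"
  unfolding segment_measure_def
  using assms by (subst AE_distr_iff) (auto intro!: AE_uniform_01)

lemma avg_segment_measure:
  assumes [measurable]: "g \<in> borel_measurable borel"
  shows "avg (segment_measure y) g x = (LINT s|uniform_01. g (x + s *\<^sub>R y))"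
  unfolding avg_def segment_measure_def by (rule integral_distr) measurable

lemma Fubini_uniform_01:
  fixes F :: "real ^ 'n \<Rightarrow> real \<Rightarrow> complex"
  assumes F[measurable]: "case_prod F \<in> borel_measurable (borel \<Otimes>\<^sub>M borel)"
    and b: "\<And>s. (\<integral>\<^sup>+x. norm (F x s) \<partial>lborel) \<le> ennreal C"
  shows "(LINT x|lborel. LINT s|uniform_01. F x s) = (LINT s|uniform_01. LINT x|lborel. F x s)"
proof -
  interpret U: prob_space uniform_01 by (rule prob_space_uniform_01)
  interpret P: pair_sigma_finite lborel uniform_01 ..
  have "integrable (lborel \<Otimes>\<^sub>M uniform_01) (case_prod F)"
  proof (rule integrableI_bounded)
    have "(\<integral>\<^sup>+p. norm (case_prod F p) \<partial>(lborel \<Otimes>\<^sub>M uniform_01)) = (\<integral>\<^sup>+s. (\<integral>\<^sup>+x. norm (F x s) \<partial>lborel) \<partial>uniform_01)"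
      by (subst P.nn_integral_snd[symmetric]) (auto simp: case_prod_beta)
    also have "\<dots> \<le> (\<integral>\<^sup>+s. ennreal C \<partial>uniform_01)" by (intro nn_integral_mono b)
    also have "\<dots> < \<infinity>" by (simp add: U.emeasure_space_1)
    finally show "(\<integral>\<^sup>+p. norm (case_prod F p) \<partial>(lborel \<Otimes>\<^sub>M uniform_01)) < \<infinity>" .
  qed measurable
  then show ?thesis using P.Fubini_integral[of F] by simp
qed

lemma nn_integral_product_bound:
  fixes a :: "real ^ 'n \<Rightarrow> real" and b :: "real ^ 'n \<Rightarrow> complex"
  assumes "integrable lborel (\<lambda>x. (a x)\<^sup>2)" "b \<in> L2" and [measurable]: "a \<in> borel_measurable borel"
  shows "(\<integral>\<^sup>+x. norm (a x *\<^sub>R b x) \<partial>lborel) \<le> ennreal ((LINT x|lborel. (a x)\<^sup>2) + (L2_norm b)\<^sup>2)"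
proof -
  have [measurable]: "b \<in> borel_measurable borel" using assms(2) by measurable
  have "(\<integral>\<^sup>+x. norm (a x *\<^sub>R b x) \<partial>lborel) \<le> (\<integral>\<^sup>+x. ennreal ((a x)\<^sup>2 + (cmod (b x))\<^sup>2) \<partial>lborel)"
  proof (intro nn_integral_mono ennreal_leI)
    fix x
    show "norm (a x *\<^sub>R b x) \<le> (a x)\<^sup>2 + (cmod (b x))\<^sup>2"
      using abs_inner_le_sum_squares[of "\<bar>a x\<bar>" "cmod (b x)"] by simp
  qed
  also have "\<dots> = ennreal (LINT x|lborel. (a x)\<^sup>2 + (cmod (b x))\<^sup>2)"
    using assms L2_integrable_square[OF assms(2)] by (intro nn_integral_eq_integral) auto
  also have "(LINT x|lborel. (a x)\<^sup>2 + (cmod (b x))\<^sup>2) = (LINT x|lborel. (a x)\<^sup>2) + (L2_norm b)\<^sup>2"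
    using assms L2_integrable_square[OF assms(2)] by (simp add: L2_norm_sq)
  finally show ?thesis .
qed

lemma test_function_FTC:
  fixes \<phi> :: "real ^ 'n \<Rightarrow> real"
  assumes t: "test_function \<phi>"
  shows "\<phi> (x - y) - \<phi> x = - (LINT s|uniform_01. frechet_derivative \<phi> (at (x - s *\<^sub>R y)) y)"
proof -
  note [measurable] = test_function_directional_measurable[OF t]
  have cont: "continuous_on UNIV (\<lambda>x. frechet_derivative \<phi> (at x) y)"
    unfolding frechet_derivative_pderivative[OF test_function_differentiable[OF t]]
    by (intro continuous_intros test_function_pderivative_continuous[OF t])
  have d: "((\<lambda>s. \<phi> (x - s *\<^sub>R y)) has_vector_derivative - frechet_derivative \<phi> (at (x - s *\<^sub>R y)) y) (at s within {0..1})" for s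
  proof -
    have "((\<lambda>s. x - s *\<^sub>R y) has_derivative (\<lambda>h. - (h *\<^sub>R y))) (at s within {0..1})"
      by (auto intro!: derivative_eq_intros)
    from has_derivative_compose[OF this frechet_derivative_works[THEN iffD1, OF test_function_differentiable[OF t]]]
    have "((\<lambda>s. \<phi> (x - s *\<^sub>R y)) has_derivative (\<lambda>h. frechet_derivative \<phi> (at (x - s *\<^sub>R y)) (- (h *\<^sub>R y)))) (at s within {0..1})" .
    moreover have "(\<lambda>h. frechet_derivative \<phi> (at (x - s *\<^sub>R y)) (- (h *\<^sub>R y))) = (\<lambda>h. h *\<^sub>R (- frechet_derivative \<phi> (at (x - s *\<^sub>R y)) y))"
      using linear_scale[OF frechet_derivative_linear_test[OF t]] linear_neg[OF frechet_derivative_linear_test[OF t]]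
      by simp
    ultimately show ?thesis by (simp add: has_vector_derivative_def)
  qed
  have "(LINT s|uniform_01. frechet_derivative \<phi> (at (x - s *\<^sub>R y)) y) =
     (LINT s|lborel. indicator {0..1} s *\<^sub>R frechet_derivative \<phi> (at (x - s *\<^sub>R y)) y)"
    unfolding uniform_01_def by (rule integral_density) auto
  moreover have "(LINT s|lborel. indicator {0..1} s *\<^sub>R (- frechet_derivative \<phi> (at (x - s *\<^sub>R y)) y)) =
     \<phi> (x - 1 *\<^sub>R y) - \<phi> (x - 0 *\<^sub>R y)"
  proof (rule integral_FTC_atLeastAtMost)
    show "continuous_on {0..1} (\<lambda>s. - frechet_derivative \<phi> (at (x - s *\<^sub>R y)) y)"
      by (intro continuous_intros continuous_on_compose2[OF cont]) auto
  qed (use d in auto)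
  ultimately show ?thesis by simp
qed

text \<open>
  Tested against \<open>\<phi>\<close>, the difference of \<open>f\<close> becomes one of \<open>\<phi>\<close>, to which the fundamental theorem of
  calculus applies on each segment. Fubini's theorem and the definition of the weak derivative move
  the derivative back to \<open>f\<close>, and the fundamental lemma removes \<open>\<phi>\<close>.
\<close>

lemma wd_segment_average:
  fixes f g :: "real ^ 'n \<Rightarrow> complex"
  assumes w: "wd y f g"
  shows "AE x in lborel. f (x + y) - f x = avg (segment_measure y) g x"
proof -
  note L = wd_L2[OF w]
  have [measurable]: "f \<in> borel_measurable borel" "g \<in> borel_measurable borel" using L by measurable
  interpret U: prob_space uniform_01 by (rule prob_space_uniform_01)
  let ?A = "avg (segment_measure y) g"
  have A: "?A \<in> L2"
    by (rule avg_near(1)[where h="\<lambda>_. 0" and e="L2_norm g"])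
       (use L in \<open>auto simp: prob_space_segment_measure L2_norm_translate\<close>)
  have AEq: "?A x = (LINT s|uniform_01. g (x + s *\<^sub>R y))" for x by (rule avg_segment_measure) measurable
  have "AE x in lborel. f (x + y) - f x - ?A x = 0"
  proof (rule fundamental_lemma)
    show "locally_integrable (\<lambda>x. f (x + y) - f x - ?A x)"
      by (intro L2_locally_integrable L2_diff L2_translate L A)
    fix \<phi> :: "real ^ 'n \<Rightarrow> real" assume t: "test_function \<phi>"
    note [measurable] = test_function_directional_measurable[OF t]
    have int: "integrable lborel (\<lambda>x. \<phi> x *\<^sub>R h x)" if "h \<in> L2" for h
      using test_function_integrable(1)[OF t that] .
    have t': "test_function (\<lambda>x. \<phi> (x + z))" for z by (rule test_function_translate[OF t])
    have s1: "(LINT x|lborel. \<phi> x *\<^sub>R f (x + y)) = (LINT x|lborel. \<phi> (x + (- y)) *\<^sub>R f x)"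
      using integral_translate[of "\<lambda>x. \<phi> x *\<^sub>R f (x + y)" "- y"] by simp
    have "(LINT x|lborel. \<phi> x *\<^sub>R (f (x + y) - f x)) = (LINT x|lborel. (\<phi> (x - y) - \<phi> x) *\<^sub>R f x)"
      using s1 int[OF L2_translate[OF L(1)]] int[OF L(1)] test_function_integrable(1)[OF t'[of "- y"] L(1)]
      by (simp add: scaleR_diff_right scaleR_diff_left)
    also have "\<dots> = (LINT x|lborel. - (LINT s|uniform_01. frechet_derivative \<phi> (at (x - s *\<^sub>R y)) y *\<^sub>R f x))"
    proof (intro Bochner_Integration.integral_cong refl)
      fix x
      obtain B R where B: "\<And>x. \<bar>frechet_derivative \<phi> (at x) y\<bar> \<le> B * indicator (cball 0 R) x"
        using test_function_directional_bounds[OF t] by metis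
      have "integrable uniform_01 (\<lambda>s. frechet_derivative \<phi> (at (x - s *\<^sub>R y)) y)"
      proof (rule U.integrable_const_bound[where B="\<bar>B\<bar>"])
        have "B * indicator (cball 0 R) z \<le> \<bar>B\<bar>" for z :: "real ^ 'n"
          by (auto simp: indicator_def)
        then show "AE s in uniform_01. norm (frechet_derivative \<phi> (at (x - s *\<^sub>R y)) y) \<le> \<bar>B\<bar>"
          by (intro AE_I2) (use B order_trans in fastforce)
      qed measurable
      then show "(\<phi> (x - y) - \<phi> x) *\<^sub>R f x = - (LINT s|uniform_01. frechet_derivative \<phi> (at (x - s *\<^sub>R y)) y *\<^sub>R f x)"
        by (simp add: test_function_FTC[OF t])
    qed
    also have "\<dots> = - (LINT s|uniform_01. LINT x|lborel. frechet_derivative \<phi> (at (x - s *\<^sub>R y)) y *\<^sub>R f x)"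
    proof (simp, rule Fubini_uniform_01)
      show "(\<lambda>(x, s). frechet_derivative \<phi> (at (x - s *\<^sub>R y)) y *\<^sub>R f x) \<in> borel_measurable (borel \<Otimes>\<^sub>M borel)"
        by measurable
      fix s
      show "(\<integral>\<^sup>+x. norm (frechet_derivative \<phi> (at (x - s *\<^sub>R y)) y *\<^sub>R f x) \<partial>lborel)
         \<le> ennreal ((LINT x|lborel. (frechet_derivative \<phi> (at x) y)\<^sup>2) + (L2_norm f)\<^sup>2)"
      proof (rule order_trans[OF nn_integral_product_bound])
        show "integrable lborel (\<lambda>x. (frechet_derivative \<phi> (at (x - s *\<^sub>R y)) y)\<^sup>2)"
          using integrable_translate[OF test_function_square_integrable(2)[OF t, of y], of "- (s *\<^sub>R y)"] by simp
        show "ennreal ((LINT x|lborel. (frechet_derivative \<phi> (at (x - s *\<^sub>R y)) y)\<^sup>2) + (L2_norm f)\<^sup>2)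
          \<le> ennreal ((LINT x|lborel. (frechet_derivative \<phi> (at x) y)\<^sup>2) + (L2_norm f)\<^sup>2)"
          using integral_translate[of "\<lambda>x. (frechet_derivative \<phi> (at x) y)\<^sup>2" "- (s *\<^sub>R y)"] by simp
      qed (use L in auto)
    qed
    also have "\<dots> = (LINT s|uniform_01. LINT x|lborel. \<phi> x *\<^sub>R g (x + s *\<^sub>R y))"
    proof -
      have fd: "frechet_derivative (\<lambda>x. \<phi> (x - s *\<^sub>R y)) (at x) y = frechet_derivative \<phi> (at (x - s *\<^sub>R y)) y" for x s
        using frechet_derivative_translate[OF t, of "- (s *\<^sub>R y)" x y] by simp
      have "- (LINT x|lborel. frechet_derivative \<phi> (at (x - s *\<^sub>R y)) y *\<^sub>R f x) =
         (LINT x|lborel. \<phi> x *\<^sub>R g (x + s *\<^sub>R y))" for s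
        using wdD[OF w t'[of "- (s *\<^sub>R y)"]] integral_translate[of "\<lambda>x. \<phi> x *\<^sub>R g (x + s *\<^sub>R y)" "- (s *\<^sub>R y)"]
        by (simp add: fd)
      then show ?thesis by (simp flip: integral_minus)
    qed
    also have "\<dots> = (LINT x|lborel. LINT s|uniform_01. \<phi> x *\<^sub>R g (x + s *\<^sub>R y))"
    proof (rule Fubini_uniform_01[symmetric])
      show "(\<lambda>(x, s). \<phi> x *\<^sub>R g (x + s *\<^sub>R y)) \<in> borel_measurable (borel \<Otimes>\<^sub>M borel)" by measurable
      fix s
      show "(\<integral>\<^sup>+x. norm (\<phi> x *\<^sub>R g (x + s *\<^sub>R y)) \<partial>lborel) \<le> ennreal ((LINT x|lborel. (\<phi> x)\<^sup>2) + (L2_norm g)\<^sup>2)"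
        using nn_integral_product_bound[OF test_function_square_integrable(1)[OF t] L2_translate[OF L(2), of "s *\<^sub>R y"]]
        by (simp add: L2_norm_translate[OF L(2)])
    qed
    also have "\<dots> = (LINT x|lborel. \<phi> x *\<^sub>R ?A x)" by (simp add: AEq)
    finally have "(LINT x|lborel. \<phi> x *\<^sub>R (f (x + y) - f x)) = (LINT x|lborel. \<phi> x *\<^sub>R ?A x)" .
    then show "(LINT x|lborel. \<phi> x *\<^sub>R (f (x + y) - f x - ?A x)) = 0"
      using int[OF A] int[OF L2_diff[OF L2_translate[OF L(1), of y] L(1)]]
      by (subst scaleR_diff_right) simp
  qed
  then show ?thesis by simp
qed

lemma wd_difference_near:
  fixes f g h :: "real ^ 'n \<Rightarrow> complex"
  assumes w: "wd y f g" and h: "h \<in> L2" and e: "e \<ge> 0"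
    and near: "\<And>s. 0 \<le> s \<Longrightarrow> s \<le> 1 \<Longrightarrow> L2_norm (\<lambda>x. g (x + s *\<^sub>R y) - h x) \<le> e"
  shows "L2_norm (\<lambda>x. f (x + y) - f x - h x) \<le> e"
proof -
  note L = wd_L2[OF w]
  have [measurable]: "f \<in> borel_measurable borel" "g \<in> borel_measurable borel" "h \<in> borel_measurable borel"
    using L h by measurable
  have AE: "AE z in segment_measure y. L2_norm (\<lambda>x. g (x + z) - h x) \<le> e"
  proof (rule AE_segment_measure[where P="\<lambda>z. L2_norm (\<lambda>x. g (x + z) - h x) \<le> e"])
    have "(\<lambda>z. LINT x|lborel. (cmod (g (x + z) - h x))\<^sup>2) \<in> borel_measurable borel"
      by (rule lborel.borel_measurable_lebesgue_integral) measurable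
    then show "Measurable.pred borel (\<lambda>z. L2_norm (\<lambda>x. g (x + z) - h x) \<le> e)"
      unfolding L2_norm_def by measurable
  qed (use near in simp)
  note a = avg_near[OF prob_space_segment_measure sets_segment_measure L(2) h e AE]
  have [measurable]: "avg (segment_measure y) g \<in> borel_measurable borel" using a(1) by measurable
  have "L2_norm (\<lambda>x. f (x + y) - f x - h x) = L2_norm (\<lambda>x. avg (segment_measure y) g x - h x)"
  proof (rule L2_norm_cong_AE)
    show "AE x in lborel. f (x + y) - f x - h x = avg (segment_measure y) g x - h x"
      using wd_segment_average[OF w] by eventually_elim simp
  qed measurable
  then show ?thesis using a(2) by simp
qed

lemma wd_difference_le:
  assumes w: "wd y f g" shows "L2_norm (\<lambda>x. f (x + y) - f x) \<le> L2_norm g"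
  using wd_difference_near[OF w L2_zero L2_norm_nonneg[of g]] L2_norm_translate[OF wd_L2(2)[OF w]]
  by simp

lemma translation_continuous_L2_eps:
  fixes g :: "real ^ 'n \<Rightarrow> complex"
  assumes "g \<in> L2" "e > 0"
  obtains d where "d > 0" "\<And>z. norm z < d \<Longrightarrow> L2_norm (\<lambda>x. g (x + z) - g x) < e"
proof -
  have "(\<lambda>z. L2_norm (\<lambda>x. g (x + z) - g x)) \<midarrow>0\<rightarrow> 0"
    unfolding LIMSEQ_SEQ_conv[symmetric] using translation_continuous_L2[OF assms(1)] by blast
  then obtain d where d: "d > 0" "\<And>z. z \<noteq> 0 \<Longrightarrow> norm z < d \<Longrightarrow> \<bar>L2_norm (\<lambda>x. g (x + z) - g x)\<bar> < e"
    using assms(2) unfolding LIM_def by (auto simp: dist_norm)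
  show ?thesis
  proof (rule that[OF d(1)])
    fix z :: "real ^ 'n" assume "norm z < d"
    then show "L2_norm (\<lambda>x. g (x + z) - g x) < e"
      using d(2)[of z] assms(2) by (cases "z = 0") (auto simp: L2_norm_def)
  qed
qed

definition diff_quot :: "nat \<Rightarrow> real ^ 'n \<Rightarrow> (real ^ 'n \<Rightarrow> complex) \<Rightarrow> real ^ 'n \<Rightarrow> complex" where
  "diff_quot n y f x = real (Suc n) *\<^sub>R (f (x + (1 / real (Suc n)) *\<^sub>R y) - f x)"

lemma diff_quot_L2 [simp]: "f \<in> L2 \<Longrightarrow> diff_quot n y f \<in> L2"
  unfolding diff_quot_def[abs_def] by (intro L2_scaleR L2_diff L2_translate)

lemma wd_diff_quot: "wd z f g \<Longrightarrow> wd z (diff_quot n y f) (diff_quot n y g)"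
  unfolding diff_quot_def[abs_def] by (intro wd_scale wd_diff wd_translate)

lemma ip_diff_quot:
  assumes "f \<in> L2" "g \<in> L2"
  shows "ip (diff_quot n y f) g = ip f (diff_quot n (- y) g)"
proof -
  let ?z = "(1 / real (Suc n)) *\<^sub>R y"
  have "ip (\<lambda>x. f (x + ?z)) g = ip (\<lambda>x. f (x + ?z)) (\<lambda>x. (\<lambda>w. g (w + (- ?z))) (x + ?z))" by simp
  also have "\<dots> = ip f (\<lambda>w. g (w + (- ?z)))"
    by (rule ip_translate) (use assms L2_translate[OF assms(2), of "- ?z"] in simp_all)
  finally have "ip (\<lambda>x. f (x + ?z)) g = ip f (\<lambda>w. g (w + (- ?z)))" .
  then show ?thesis
    unfolding diff_quot_def[abs_def] using assms L2_translate[OF assms(1), of ?z] L2_translate[OF assms(2), of "- ?z"]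
    by (simp only: ip_scale_left ip_scale_right ip_diff_left ip_diff_right scaleR_minus_right)
qed

text \<open>
  Difference quotients are averages of translates of the derivative over short segments, so they are
  as close to \<open>h\<close> as those translates are.
\<close>

lemma diff_quot_near:
  fixes f g h :: "real ^ 'n \<Rightarrow> complex"
  assumes w: "wd y f g" and h: "h \<in> L2" and e: "e \<ge> 0"
    and near: "\<And>z. norm z \<le> norm y / real (Suc n) \<Longrightarrow> L2_norm (\<lambda>x. g (x + z) - h x) \<le> e"
  shows "L2_norm (\<lambda>x. diff_quot n y f x - h x) \<le> e"
proof -
  define c where "c = 1 / real (Suc n)"
  have c: "c > 0" "real (Suc n) * c = 1" by (auto simp: c_def)
  have "L2_norm (\<lambda>x. f (x + c *\<^sub>R y) - f x - c *\<^sub>R h x) \<le> c * e"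
  proof (rule wd_difference_near[OF wd_scale_direction[OF w]])
    fix s :: real assume s: "0 \<le> s" "s \<le> 1"
    have "norm (s *\<^sub>R c *\<^sub>R y) \<le> norm y / real (Suc n)"
      using s c mult_right_mono[OF s(2), of "c * norm y"] by (simp add: c_def)
    from near[OF this] have "L2_norm (\<lambda>x. g (x + s *\<^sub>R c *\<^sub>R y) - h x) \<le> e" .
    then have "c * L2_norm (\<lambda>x. g (x + s *\<^sub>R c *\<^sub>R y) - h x) \<le> c * e"
      using c by (intro mult_left_mono) auto
    then show "L2_norm (\<lambda>x. c *\<^sub>R g (x + s *\<^sub>R c *\<^sub>R y) - c *\<^sub>R h x) \<le> c * e"
      using L2_norm_scale[of c "\<lambda>x. g (x + s *\<^sub>R c *\<^sub>R y) - h x"] c by (simp add: scaleR_diff_right)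
  qed (use h c e in auto)
  then have "real (Suc n) * L2_norm (\<lambda>x. f (x + c *\<^sub>R y) - f x - c *\<^sub>R h x) \<le> real (Suc n) * (c * e)"
    by (intro mult_left_mono) auto
  also have "real (Suc n) * (c * e) = e" using c by (simp add: mult.assoc[symmetric])
  finally have le: "real (Suc n) * L2_norm (\<lambda>x. f (x + c *\<^sub>R y) - f x - c *\<^sub>R h x) \<le> e" .
  have "diff_quot n y f x - h x = real (Suc n) *\<^sub>R (f (x + c *\<^sub>R y) - f x - c *\<^sub>R h x)" for x
    using c(2) by (simp add: diff_quot_def c_def[symmetric] scaleR_diff_right del: of_nat_Suc)
  then have "L2_norm (\<lambda>x. diff_quot n y f x - h x) = real (Suc n) * L2_norm (\<lambda>x. f (x + c *\<^sub>R y) - f x - c *\<^sub>R h x)"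
    by (simp only: L2_norm_scale abs_of_nat)
  then show ?thesis using le by simp
qed

lemma eventually_norm_div_less:
  assumes "d > 0" shows "\<forall>\<^sub>F n in sequentially. norm (y::'a::real_normed_vector) / real (Suc n) < d"
proof -
  have "(\<lambda>n. norm y * (1 / real (Suc n))) \<longlonglongrightarrow> norm y * 0"
    by (intro tendsto_intros LIMSEQ_Suc lim_1_over_n)
  then have "(\<lambda>n. norm y / real (Suc n)) \<longlonglongrightarrow> 0" by simp
  from order_tendstoD(2)[OF this assms] show ?thesis .
qed

lemma diff_quot_tendsto:
  fixes f g :: "real ^ 'n \<Rightarrow> complex"
  assumes w: "wd y f g"
  shows "(\<lambda>n. L2_norm (\<lambda>x. diff_quot n y f x - g x)) \<longlonglongrightarrow> 0"
proof (rule tendstoI)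
  fix e :: real assume e: "e > 0"
  obtain d where d: "d > 0" "\<And>z. norm z < d \<Longrightarrow> L2_norm (\<lambda>x. g (x + z) - g x) < e / 2"
    using translation_continuous_L2_eps[OF wd_L2(2)[OF w], of "e / 2"] e by auto
  show "\<forall>\<^sub>F n in sequentially. dist (L2_norm (\<lambda>x. diff_quot n y f x - g x)) 0 < e"
    using eventually_norm_div_less[OF d(1), of y]
  proof eventually_elim
    case (elim n)
    have "L2_norm (\<lambda>x. diff_quot n y f x - g x) \<le> e / 2"
      by (rule diff_quot_near[OF w wd_L2(2)[OF w]]) (use e elim d(2) in \<open>auto intro!: less_imp_le\<close>)
    then show ?case using e by simp
  qed
qed

text \<open>Integration by parts holds exactly for difference quotients, by translation invariance.\<close>

lemma wd_integration_by_parts: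
  assumes "wd y f g" "wd y f' g'"
  shows "ip g f' = - ip f g'"
proof -
  note L = wd_L2[OF assms(1)] wd_L2[OF assms(2)]
  have w: "wd (- y) f' (\<lambda>x. - g' x)" using wd_scale_direction[OF assms(2), of "- 1"] by simp
  have "(\<lambda>n. ip (diff_quot n y f) f') \<longlonglongrightarrow> ip g f'"
    by (rule ip_tendsto[OF _ _ _ _ diff_quot_tendsto[OF assms(1)]]) (use L in \<open>auto simp: L2_norm_def\<close>)
  moreover have "(\<lambda>n. ip f (diff_quot n (- y) f')) \<longlonglongrightarrow> ip f (\<lambda>x. - g' x)"
    by (rule ip_tendsto[OF _ _ _ _ _ diff_quot_tendsto[OF w]]) (use L in \<open>auto simp: L2_norm_def\<close>)
  moreover have "ip (diff_quot n y f) f' = ip f (diff_quot n (- y) f')" for n using ip_diff_quot L by blast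
  ultimately have "ip g f' = ip f (\<lambda>x. - g' x)" using LIMSEQ_unique by simp
  also have "\<dots> = - ip f g'" by (simp add: ip_def)
  finally show ?thesis .
qed

text \<open>
  Formally this is two integrations by parts through a third derivative of \<open>u\<close>, which need not exist;
  a difference quotient takes its place.
\<close>

lemma wd_mixed_second:
  assumes ui: "wd y u gi" and uj: "wd z u gj" and ij: "wd z gi hij" and ii: "wd y gi hii" and jj: "wd z gj hjj"
  shows "ip hij hij = ip hii hjj"
proof -
  note L = wd_L2[OF ui] wd_L2[OF uj] wd_L2[OF ij] wd_L2[OF ii] wd_L2[OF jj]
  have lim1: "(\<lambda>n. ip (diff_quot n z gi) (diff_quot n z gi)) \<longlonglongrightarrow> ip hij hij"
    by (rule ip_tendsto[OF _ _ _ _ diff_quot_tendsto[OF ij] diff_quot_tendsto[OF ij]]) (use L in auto)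
  have eq: "ip (diff_quot n z gi) (diff_quot n z gi) = - ip (diff_quot n (- z) (diff_quot n z u)) hii" for n
  proof -
    have "ip (diff_quot n z gi) (diff_quot n z gi) = - ip (diff_quot n z u) (diff_quot n z hii)"
      by (rule wd_integration_by_parts[OF wd_diff_quot[OF ui] wd_diff_quot[OF ii]])
    also have "ip (diff_quot n z u) (diff_quot n z hii) = ip (diff_quot n z hii) (diff_quot n z u)" by (rule ip_commute)
    also have "\<dots> = ip hii (diff_quot n (- z) (diff_quot n z u))" using L by (intro ip_diff_quot) auto
    finally show ?thesis by (simp add: ip_commute)
  qed
  have lim2: "(\<lambda>n. L2_norm (\<lambda>x. diff_quot n (- z) (diff_quot n z u) x - (- hjj x))) \<longlonglongrightarrow> 0"
  proof (rule tendstoI)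
    fix e :: real assume e: "e > 0"
    obtain d where d: "d > 0" "\<And>w. norm w < d \<Longrightarrow> L2_norm (\<lambda>x. hjj (x + w) - hjj x) < e / 3"
      using translation_continuous_L2_eps[OF wd_L2(2)[OF jj], of "e / 3"] e by auto
    have "\<forall>\<^sub>F n in sequentially. L2_norm (\<lambda>x. diff_quot n z gj x - hjj x) < e / 3"
      using order_tendstoD(2)[OF diff_quot_tendsto[OF jj], of "e / 3"] e by simp
    with eventually_norm_div_less[OF d(1), of "z"]
    show "\<forall>\<^sub>F n in sequentially. dist (L2_norm (\<lambda>x. diff_quot n (- z) (diff_quot n z u) x - (- hjj x))) 0 < e"
    proof eventually_elim
      case (elim n)
      have w: "wd (- z) (diff_quot n z u) (\<lambda>x. - diff_quot n z gj x)"
        using wd_scale_direction[OF wd_diff_quot[OF uj], of "- 1"] by simp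
      have "L2_norm (\<lambda>x. diff_quot n (- z) (diff_quot n z u) x - (- hjj x)) \<le> 2 * e / 3"
      proof (rule diff_quot_near[OF w])
        fix w :: "real ^ 'a" assume "norm w \<le> norm (- z) / real (Suc n)"
        then have w: "norm w < d" using elim(1) by simp
        have "L2_norm (\<lambda>x. - diff_quot n z gj (x + w) - - hjj x)
            = L2_norm (\<lambda>x. (hjj x - hjj (x + w)) + (hjj (x + w) - diff_quot n z gj (x + w)))"
          by (simp add: algebra_simps)
        also have "\<dots> \<le> L2_norm (\<lambda>x. hjj x - hjj (x + w)) + L2_norm (\<lambda>x. hjj (x + w) - diff_quot n z gj (x + w))"
          using L by (intro L2_norm_triangle L2_diff L2_translate diff_quot_L2)
        also have "L2_norm (\<lambda>x. hjj (x + w) - diff_quot n z gj (x + w)) = L2_norm (\<lambda>x. hjj x - diff_quot n z gj x)"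
          by (rule L2_norm_translate[where f="\<lambda>x. hjj x - diff_quot n z gj x"]) (use L in auto)
        also have "\<dots> = L2_norm (\<lambda>x. diff_quot n z gj x - hjj x)" by (simp add: L2_norm_def norm_minus_commute)
        also have "L2_norm (\<lambda>x. hjj x - hjj (x + w)) = L2_norm (\<lambda>x. hjj (x + w) - hjj x)"
          by (simp add: L2_norm_def norm_minus_commute)
        finally show "L2_norm (\<lambda>x. - diff_quot n z gj (x + w) - - hjj x) \<le> 2 * e / 3"
          using d(2)[OF w] elim(2) by simp
      qed (use L e in auto)
      then show ?case using e by simp
    qed
  qed
  have "(\<lambda>n. ip (diff_quot n (- z) (diff_quot n z u)) hii) \<longlonglongrightarrow> ip (\<lambda>x. - hjj x) hii"
    by (rule ip_tendsto[OF _ _ _ _ lim2]) (use L in \<open>auto simp: L2_norm_def\<close>)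
  from tendsto_minus[OF this] have "(\<lambda>n. ip (diff_quot n z gi) (diff_quot n z gi)) \<longlonglongrightarrow> - ip (\<lambda>x. - hjj x) hii"
    by (simp add: eq)
  from LIMSEQ_unique[OF lim1 this] show ?thesis by (simp add: ip_def inner_commute)
qed

section \<open>The space \<open>H\<^sup>2\<close>\<close>

lemma has_weak_pd_unique:
  assumes "has_weak_pd i u g" "has_weak_pd i u g'"
  shows "AE x in lborel. g x = g' x"
proof -
  have li: "locally_integrable g" "locally_integrable g'" using assms by (auto simp: has_weak_pd_def)
  have eq: "(\<lambda>x. indicator K x *\<^sub>R (g x - g' x)) = (\<lambda>x. indicator K x *\<^sub>R g x - indicator K x *\<^sub>R g' x)" for K
    by (simp add: scaleR_diff_right)
  have "AE x in lborel. g x - g' x = 0"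
  proof (rule fundamental_lemma)
    show "locally_integrable (\<lambda>x. g x - g' x)"
      using li unfolding locally_integrable_def set_integrable_def eq
      by (intro allI impI Bochner_Integration.integrable_diff) simp_all
    fix \<phi> :: "real ^ 'a \<Rightarrow> real" assume t: "test_function \<phi>"
    obtain B R where *: "\<And>x. \<bar>\<phi> x\<bar> \<le> B * indicator (cball 0 R) x"
      using test_function_bounds[OF t] by metis
    have int: "integrable lborel (\<lambda>x. \<phi> x *\<^sub>R g x)" "integrable lborel (\<lambda>x. \<phi> x *\<^sub>R g' x)"
      using locally_integrable_cball_bound[OF li(1) test_function_directional_measurable(1)[OF t] *]
        locally_integrable_cball_bound[OF li(2) test_function_directional_measurable(1)[OF t] *] by auto
    have "(LINT x|lborel. \<phi> x *\<^sub>R g x) = (LINT x|lborel. \<phi> x *\<^sub>R g' x)"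
      using assms t by (simp add: has_weak_pd_def)
    then show "(LINT x|lborel. \<phi> x *\<^sub>R (g x - g' x)) = 0"
      using int by (simp add: scaleR_diff_right)
  qed
  then show ?thesis by simp
qed

lemma weak_pd_eq:
  assumes "has_weak_pd i u g"
  shows "has_weak_pd i u (weak_pd i u)" "AE x in lborel. weak_pd i u x = g x"
proof -
  show 1: "has_weak_pd i u (weak_pd i u)"
    unfolding weak_pd_def by (rule someI[where P="has_weak_pd i u", OF assms])
  show "AE x in lborel. weak_pd i u x = g x" by (rule has_weak_pd_unique[OF 1 assms])
qed

lemma weak_pd_wd:
  assumes "wd (axis i 1) u g"
  shows "wd (axis i 1) u (weak_pd i u)" "AE x in lborel. weak_pd i u x = g x"
proof -
  have w: "has_weak_pd i u g" "u \<in> L2" "g \<in> L2" using assms by (auto simp: wd_axis_iff)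
  show eq: "AE x in lborel. weak_pd i u x = g x" by (rule weak_pd_eq(2)[OF w(1)])
  have "weak_pd i u \<in> borel_measurable borel"
    using weak_pd_eq(1)[OF w(1)] by (auto simp: has_weak_pd_def intro: locally_integrable_measurable)
  moreover have "AE x in lborel. g x = weak_pd i u x" using eq by eventually_elim simp
  ultimately have "weak_pd i u \<in> L2" by (rule L2_cong_AE[OF w(3)])
  then show "wd (axis i 1) u (weak_pd i u)" using weak_pd_eq(1)[OF w(1)] w by (simp add: wd_axis_iff)
qed

lemma wd_cong_left:
  assumes "wd y f g" "f' \<in> borel_measurable borel" "AE x in lborel. f x = f' x"
  shows "wd y f' g"
proof (rule wdI)
  show f': "f' \<in> L2" using L2_cong_AE[OF wd_L2(1)[OF assms(1)] assms(2,3)] .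
  fix \<phi> :: "real ^ 'a \<Rightarrow> real" assume t: "test_function \<phi>"
  have [measurable]: "f \<in> borel_measurable borel" "f' \<in> borel_measurable borel"
    using wd_L2(1)[OF assms(1)] assms(2) by measurable
  note [measurable] = test_function_directional_measurable[OF t]
  have "(LINT x|lborel. frechet_derivative \<phi> (at x) y *\<^sub>R f' x) = (LINT x|lborel. frechet_derivative \<phi> (at x) y *\<^sub>R f x)"
    by (rule integral_cong_AE) (measurable, use assms(3) in \<open>eventually_elim, simp\<close>)
  then show "(LINT x|lborel. frechet_derivative \<phi> (at x) y *\<^sub>R f' x) = - (LINT x|lborel. \<phi> x *\<^sub>R g x)"
    using wdD[OF assms(1) t] by simp
qed (use wd_L2[OF assms(1)] in auto)

text \<open>
  The chosen \<open>weak_pd\<close> may differ from a given weak derivative on a null set, and second derivatives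
  are taken of the chosen representative. For computations with explicit weak derivatives both
  choices have to be transferred.
\<close>

lemma H2_I:
  assumes "\<And>i. wd (axis i 1) u (g i)" "\<And>i j. wd (axis j 1) (g i) (h i j)"
  shows "u \<in> H2" "AE x in lborel. weak_pd i u x = g i x"
    "AE x in lborel. weak_pd j (weak_pd i u) x = h i j x"
proof -
  show "u \<in> H2" unfolding H2_def
    using assms by (auto simp: wd_axis_iff intro!: exI[of _ g] exI[of _ h])
  show eq: "AE x in lborel. weak_pd i u x = g i x" by (rule weak_pd_wd(2)[OF assms(1)])
  have m: "weak_pd i u \<in> borel_measurable borel"
    using wd_L2(2)[OF weak_pd_wd(1)[OF assms(1)]] by measurable
  have "AE x in lborel. g i x = weak_pd i u x" using eq by eventually_elim simp
  then show "AE x in lborel. weak_pd j (weak_pd i u) x = h i j x"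
    by (rule weak_pd_wd(2)[OF wd_cong_left[OF assms(2) m]])
qed

lemma H2_wd:
  assumes "u \<in> H2"
  shows "wd (axis i 1) u (weak_pd i u)" "wd (axis j 1) (weak_pd i u) (weak_pd j (weak_pd i u))"
proof -
  obtain g h where w: "\<And>i. wd (axis i 1) u (g i)" "\<And>i j. wd (axis j 1) (g i) (h i j)"
    using assms unfolding H2_def wd_axis_iff by blast
  show 1: "wd (axis i 1) u (weak_pd i u)" by (rule weak_pd_wd(1)[OF w(1)])
  have m: "weak_pd i u \<in> borel_measurable borel" using wd_L2(2)[OF 1] by measurable
  have "AE x in lborel. g i x = weak_pd i u x"
    using weak_pd_wd(2)[OF w(1), of i] by eventually_elim simp
  from weak_pd_wd(1)[OF wd_cong_left[OF w(2) m this]]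
  show "wd (axis j 1) (weak_pd i u) (weak_pd j (weak_pd i u))" .
qed

lemma H2_L2 [simp]:
  assumes "u \<in> H2"
  shows "u \<in> L2" "weak_pd i u \<in> L2" "weak_pd j (weak_pd i u) \<in> L2" "weak_laplacian u \<in> L2"
proof -
  show "u \<in> L2" by (rule wd_L2(1)[OF H2_wd(1)[OF assms]])
  show "weak_pd i u \<in> L2" for i by (rule wd_L2(2)[OF H2_wd(1)[OF assms]])
  have h: "weak_pd j (weak_pd i u) \<in> L2" for i j by (rule wd_L2(2)[OF H2_wd(2)[OF assms]])
  then show "weak_pd j (weak_pd i u) \<in> L2" .
  show "weak_laplacian u \<in> L2" unfolding weak_laplacian_def[abs_def] by (intro L2_sum h)
qed

definition grad_sq :: "(real ^ 'n \<Rightarrow> complex) \<Rightarrow> real" where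
  "grad_sq u = (LINT x|lborel. (\<Sum>i\<in>UNIV. (cmod (weak_pd i u x))\<^sup>2))"

lemma grad_sq_eq: "u \<in> H2 \<Longrightarrow> grad_sq u = (\<Sum>i\<in>UNIV. (L2_norm (weak_pd i u))\<^sup>2)"
  unfolding grad_sq_def
  by (subst Bochner_Integration.integral_sum) (auto simp: L2_norm_sq intro!: L2_integrable_square)

lemma grad_sq_nonneg: "0 \<le> grad_sq u"
  unfolding grad_sq_def by (intro integral_nonneg_AE AE_I2 sum_nonneg) auto

lemma grad_sq_le:
  assumes "u \<in> H2"
  shows "grad_sq u \<le> L2_norm u * L2_norm (weak_laplacian u)"
proof -
  have "(L2_norm (weak_pd i u))\<^sup>2 = - ip u (weak_pd i (weak_pd i u))" for i
    unfolding L2_norm_sq_ip by (rule wd_integration_by_parts[OF H2_wd[OF assms]])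
  then have "grad_sq u = - (\<Sum>i\<in>UNIV. ip u (weak_pd i (weak_pd i u)))"
    using assms by (simp add: grad_sq_eq sum_negf)
  also have "(\<Sum>i\<in>UNIV. ip u (weak_pd i (weak_pd i u))) = ip u (weak_laplacian u)"
    using assms by (simp add: weak_laplacian_def[abs_def] ip_sum_right)
  finally show ?thesis using ip_Cauchy_Schwarz[of u "weak_laplacian u"] assms by simp
qed

text \<open>
  Expanding the square of the Laplacian yields the inner products of \<open>\<partial>\<^sub>i\<partial>\<^sub>iu\<close> and \<open>\<partial>\<^sub>j\<partial>\<^sub>ju\<close>, each of
  which is the square of the norm of a mixed derivative.
\<close>

lemma hessian_eq_laplacian:
  assumes "u \<in> H2"
  shows "(\<Sum>i\<in>UNIV. \<Sum>j\<in>UNIV. (L2_norm (weak_pd j (weak_pd i u)))\<^sup>2) = (L2_norm (weak_laplacian u))\<^sup>2"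
proof -
  have "(L2_norm (weak_pd j (weak_pd i u)))\<^sup>2 = ip (weak_pd i (weak_pd i u)) (weak_pd j (weak_pd j u))" for i j
    unfolding L2_norm_sq_ip
    by (rule wd_mixed_second[OF H2_wd(1)[OF assms] H2_wd(1)[OF assms] H2_wd(2)[OF assms] H2_wd(2)[OF assms] H2_wd(2)[OF assms]])
  then show ?thesis
    using assms by (simp add: L2_norm_sq_ip weak_laplacian_def[abs_def] ip_sum_right ip_sum_left)
      (rule sum.swap)
qed

lemma H2_norm_sq:
  assumes "u \<in> H2"
  shows "H2_norm u = sqrt ((L2_norm u)\<^sup>2 + grad_sq u + (L2_norm (weak_laplacian u))\<^sup>2)"
  using assms by (simp add: H2_norm_def grad_sq_eq hessian_eq_laplacian)

section \<open>Dilations\<close>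

definition dil :: "real \<Rightarrow> real \<Rightarrow> (real ^ 'n \<Rightarrow> complex) \<Rightarrow> real ^ 'n \<Rightarrow> complex" where
  "dil a l u x = a *\<^sub>R u (l *\<^sub>R x)"

lemma frechet_derivative_dilate:
  fixes \<phi> :: "real ^ 'n \<Rightarrow> real"
  assumes "test_function \<phi>"
  shows "frechet_derivative (\<lambda>x. \<phi> (c *\<^sub>R x)) (at x) y = c * frechet_derivative \<phi> (at (c *\<^sub>R x)) y"
proof -
  have "((\<lambda>x. c *\<^sub>R x) has_derivative (\<lambda>h. c *\<^sub>R h)) (at x)" by (auto intro!: derivative_eq_intros)
  from has_derivative_compose[OF this frechet_derivative_works[THEN iffD1, OF test_function_differentiable[OF assms]]]
  have "((\<lambda>x. \<phi> (c *\<^sub>R x)) has_derivative (\<lambda>h. frechet_derivative \<phi> (at (c *\<^sub>R x)) (c *\<^sub>R h))) (at x)" .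
  from frechet_derivative_at[OF this] show ?thesis
    using linear_scale[OF frechet_derivative_linear_test[OF assms]] by (metis real_scaleR_def)
qed

lemma dil_L2 [simp]: "u \<in> L2 \<Longrightarrow> l > 0 \<Longrightarrow> dil a l u \<in> L2"
  using L2_affine[of u l 0] unfolding dil_def[abs_def] by (intro L2_scaleR) simp

lemma wd_dil:
  fixes u g :: "real ^ 'n \<Rightarrow> complex"
  assumes w: "wd y u g" and l: "l > 0"
  shows "wd y (dil a l u) (dil (a * l) l g)"
proof -
  have [measurable]: "u \<in> borel_measurable borel" "g \<in> borel_measurable borel"
    using wd_L2[OF w] by measurable
  have "wd y (dil 1 l u) (dil l l g)"
  proof (rule wdI)
    fix \<phi> :: "real ^ 'n \<Rightarrow> real" assume t: "test_function \<phi>"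
    note [measurable] = test_function_directional_measurable[OF t]
    let ?c = "1 / l"
    have c: "?c > 0" "?c *\<^sub>R l *\<^sub>R x = x" "l *\<^sub>R ?c *\<^sub>R x = x" for x :: "real ^ 'n" using l by auto
    have t': "test_function (\<lambda>x. \<phi> (?c *\<^sub>R x))" using test_function_affine[OF t, of ?c 0] l by simp
    have "(LINT x|lborel. frechet_derivative \<phi> (at x) y *\<^sub>R dil 1 l u x) =
       (1 / l ^ CARD('n)) *\<^sub>R (LINT x|lborel. frechet_derivative \<phi> (at (?c *\<^sub>R x)) y *\<^sub>R u x)"
      using integral_affine[of "\<lambda>x. frechet_derivative \<phi> (at (?c *\<^sub>R x)) y *\<^sub>R u x" l 0] l
      by (simp add: dil_def)
    also have "(LINT x|lborel. frechet_derivative \<phi> (at (?c *\<^sub>R x)) y *\<^sub>R u x) =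
       (LINT x|lborel. l *\<^sub>R (frechet_derivative (\<lambda>x. \<phi> (?c *\<^sub>R x)) (at x) y *\<^sub>R u x))"
      unfolding frechet_derivative_dilate[OF t] using l by simp
    also have "\<dots> = l *\<^sub>R (- (LINT x|lborel. \<phi> (?c *\<^sub>R x) *\<^sub>R g x))"
      unfolding integral_scaleR_right wdD[OF w t'] ..
    finally have 1: "(LINT x|lborel. frechet_derivative \<phi> (at x) y *\<^sub>R dil 1 l u x) =
       (1 / l ^ CARD('n)) *\<^sub>R l *\<^sub>R (- (LINT x|lborel. \<phi> (?c *\<^sub>R x) *\<^sub>R g x))" .
    have "(LINT x|lborel. \<phi> x *\<^sub>R dil l l g x) =
       (1 / l ^ CARD('n)) *\<^sub>R (LINT x|lborel. \<phi> (?c *\<^sub>R x) *\<^sub>R l *\<^sub>R g x)"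
      using integral_affine[of "\<lambda>x. \<phi> (?c *\<^sub>R x) *\<^sub>R l *\<^sub>R g x" l 0] l by (simp add: dil_def)
    then have 2: "(LINT x|lborel. \<phi> x *\<^sub>R dil l l g x) =
       (1 / l ^ CARD('n)) *\<^sub>R l *\<^sub>R (LINT x|lborel. \<phi> (?c *\<^sub>R x) *\<^sub>R g x)"
      unfolding integral_scaleR_scaleR .
    show "(LINT x|lborel. frechet_derivative \<phi> (at x) y *\<^sub>R dil 1 l u x) = - (LINT x|lborel. \<phi> x *\<^sub>R dil l l g x)"
      unfolding 1 2 by simp
  qed (use wd_L2[OF w] l in auto)
  from wd_scale[OF this, of a] show ?thesis by (simp add: dil_def[abs_def])
qed

lemma dil_H2:
  assumes "u \<in> H2" and l: "l > 0"
  shows "dil a l u \<in> H2"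
    "AE x in lborel. weak_pd i (dil a l u) x = dil (a * l) l (weak_pd i u) x"
    "AE x in lborel. weak_pd j (weak_pd i (dil a l u)) x = dil (a * l * l) l (weak_pd j (weak_pd i u)) x"
  by (rule H2_I[OF wd_dil[OF H2_wd(1)[OF assms(1)] l] wd_dil[OF H2_wd(2)[OF assms(1)] l]])+

lemma L2_norm_dil:
  fixes f :: "real ^ 'n \<Rightarrow> complex"
  assumes "f \<in> L2" "l > 0"
  shows "(L2_norm (dil a l f))\<^sup>2 = a\<^sup>2 / l ^ CARD('n) * (L2_norm f)\<^sup>2"
proof -
  have [measurable]: "f \<in> borel_measurable borel" using assms by measurable
  show ?thesis
    using integral_affine[of "\<lambda>x. (cmod (f x))\<^sup>2" l 0] assms
    by (simp add: L2_norm_sq dil_def power_mult_distrib)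
qed

lemma laplacian_dil:
  assumes u: "u \<in> H2" and l: "l > 0"
  shows "AE x in lborel. weak_laplacian (dil a l u) x = dil (a * l * l) l (weak_laplacian u) x"
proof -
  have "AE x in lborel. \<forall>i\<in>UNIV. weak_pd i (weak_pd i (dil a l u)) x = dil (a * l * l) l (weak_pd i (weak_pd i u)) x"
    by (rule AE_finite_allI) (use dil_H2(3)[OF u l] in auto)
  then show ?thesis
    by eventually_elim (simp add: weak_laplacian_def dil_def scaleR_sum_right)
qed

lemma L2_norm_laplacian_dil:
  fixes u :: "real ^ 'n \<Rightarrow> complex"
  assumes u: "u \<in> H2" and l: "l > 0"
  shows "(L2_norm (weak_laplacian (dil a l u)))\<^sup>2 = a\<^sup>2 * l ^ 4 / l ^ CARD('n) * (L2_norm (weak_laplacian u))\<^sup>2"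
proof -
  have "L2_norm (weak_laplacian (dil a l u)) = L2_norm (dil (a * l * l) l (weak_laplacian u))"
  proof (rule L2_norm_cong_AE[OF _ _ laplacian_dil[OF u l]])
    show "weak_laplacian (dil a l u) \<in> borel_measurable borel"
      by (intro L2_measurable H2_L2(4) dil_H2(1)[OF u l])
    show "dil (a * l * l) l (weak_laplacian u) \<in> borel_measurable borel"
      by (intro L2_measurable dil_L2 H2_L2(4) u l)
  qed
  then show ?thesis
    using L2_norm_dil[OF H2_L2(4)[OF u] l] by (simp add: power_mult_distrib power2_eq_square power4_eq_xxxx)
qed

lemma grad_sq_dil:
  fixes u :: "real ^ 'n \<Rightarrow> complex"
  assumes u: "u \<in> H2" and l: "l > 0"
  shows "grad_sq (dil a l u) = a\<^sup>2 * l\<^sup>2 / l ^ CARD('n) * grad_sq u"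
proof -
  have "(L2_norm (weak_pd i (dil a l u)))\<^sup>2 = a\<^sup>2 * l\<^sup>2 / l ^ CARD('n) * (L2_norm (weak_pd i u))\<^sup>2" for i
  proof -
    have "L2_norm (weak_pd i (dil a l u)) = L2_norm (dil (a * l) l (weak_pd i u))"
    proof (rule L2_norm_cong_AE[OF _ _ dil_H2(2)[OF u l]])
      show "weak_pd i (dil a l u) \<in> borel_measurable borel"
        by (intro L2_measurable H2_L2(2) dil_H2(1)[OF u l])
      show "dil (a * l) l (weak_pd i u) \<in> borel_measurable borel"
        by (intro L2_measurable dil_L2 H2_L2(2) u l)
    qed
    then show ?thesis
      using L2_norm_dil[OF H2_L2(2)[OF u] l] by (simp add: power_mult_distrib)
  qed
  then show ?thesis by (simp add: grad_sq_eq[OF u] grad_sq_eq[OF dil_H2(1)[OF u l]] sum_distrib_left)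
qed

definition Lp_int :: "real \<Rightarrow> (real ^ 'n \<Rightarrow> complex) \<Rightarrow> ennreal" where
  "Lp_int p u = (\<integral>\<^sup>+x. ennreal (cmod (u x) powr p) \<partial>lborel)"

lemma Lp_int_dil:
  fixes u :: "real ^ 'n \<Rightarrow> complex"
  assumes [measurable]: "u \<in> borel_measurable borel" and l: "l > 0" and a: "a \<ge> 0"
  shows "Lp_int p (dil a l u) = ennreal (a powr p / l ^ CARD('n)) * Lp_int p u"
proof -
  have "Lp_int p (dil a l u) = (\<integral>\<^sup>+x. ennreal (a powr p) * ennreal (cmod (u (l *\<^sub>R x)) powr p) \<partial>lborel)"
    unfolding Lp_int_def dil_def using a by (simp add: powr_mult ennreal_mult)
  also have "\<dots> = ennreal (a powr p) * (\<integral>\<^sup>+x. ennreal (cmod (u (l *\<^sub>R x)) powr p) \<partial>lborel)"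
    by (rule nn_integral_cmult) measurable
  also have "(\<integral>\<^sup>+x. ennreal (cmod (u (l *\<^sub>R x)) powr p) \<partial>lborel) = ennreal (1 / l ^ CARD('n)) * Lp_int p u"
    using nn_integral_affine[of "\<lambda>x. ennreal (cmod (u x) powr p)" l 0] l by (simp add: Lp_int_def)
  finally show ?thesis using l by (simp add: mult.assoc[symmetric] ennreal_mult[symmetric])
qed

section \<open>Gagliardo--Nirenberg inequalities\<close>

subsection \<open>Finite differences\<close>

lemma L2_norm_sum_le:
  "finite I \<Longrightarrow> (\<And>i. i \<in> I \<Longrightarrow> f i \<in> L2) \<Longrightarrow> L2_norm (\<lambda>x. \<Sum>i\<in>I. f i x) \<le> (\<Sum>i\<in>I. L2_norm (f i))"
proof (induction I rule: finite_induct)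
  case empty
  then show ?case by (simp add: L2_norm_def)
next
  case (insert i I)
  have "L2_norm (\<lambda>x. f i x + (\<Sum>i\<in>I. f i x)) \<le> L2_norm (f i) + L2_norm (\<lambda>x. \<Sum>i\<in>I. f i x)"
    using insert by (intro L2_norm_triangle L2_sum) auto
  also have "\<dots> \<le> L2_norm (f i) + (\<Sum>i\<in>I. L2_norm (f i))" using insert by simp
  finally show ?case using insert by simp
qed

lemma wd_direction:
  fixes f :: "real ^ 'n \<Rightarrow> complex"
  assumes "\<And>i. wd (axis i 1) f (g i)"
  shows "wd z f (\<lambda>x. \<Sum>i\<in>UNIV. z $ i *\<^sub>R g i x)"
proof -
  have "wd (\<Sum>i\<in>UNIV. z $ i *\<^sub>R axis i 1) f (\<lambda>x. \<Sum>i\<in>UNIV. z $ i *\<^sub>R g i x)"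
    using wd_L2(1)[OF assms] by (intro wd_sum_direction wd_scale_direction assms) auto
  then show ?thesis using basis_expansion[of z] by (simp add: scalar_mult_eq_scaleR)
qed

lemma weighted_sum_bound:
  fixes f :: "'n::finite \<Rightarrow> real ^ 'n \<Rightarrow> complex"
  assumes "\<And>i. f i \<in> L2" "\<And>i. L2_norm (f i) \<le> D" "\<And>i. \<bar>c i\<bar> \<le> t"
  shows "L2_norm (\<lambda>x. \<Sum>i\<in>UNIV. c i *\<^sub>R f i x) \<le> real CARD('n) * (t * D)"
proof -
  have "L2_norm (\<lambda>x. \<Sum>i\<in>UNIV. c i *\<^sub>R f i x) \<le> (\<Sum>i\<in>UNIV. L2_norm (\<lambda>x. c i *\<^sub>R f i x))"
    using assms by (intro L2_norm_sum_le) auto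
  also have "\<dots> \<le> (\<Sum>i\<in>(UNIV::'n set). t * D)"
  proof (rule sum_mono)
    fix i
    show "L2_norm (\<lambda>x. c i *\<^sub>R f i x) \<le> t * D"
      unfolding L2_norm_scale using assms(2,3)[of i] abs_ge_zero[of "c i"] L2_norm_nonneg[of "f i"]
      by (intro mult_mono) linarith+
  qed
  also have "\<dots> = real CARD('n) * (t * D)" by simp
  finally show ?thesis .
qed

lemma first_difference_bound:
  fixes u :: "real ^ 'n \<Rightarrow> complex"
  assumes u: "u \<in> H2" and z: "\<And>i. \<bar>z $ i\<bar> \<le> t"
  shows "L2_norm (\<lambda>x. u (x + z) - u x) \<le> real CARD('n) * (t * sqrt (grad_sq u))"
proof -
  have "L2_norm (weak_pd i u) \<le> sqrt (grad_sq u)" for i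
  proof (rule real_le_rsqrt)
    show "(L2_norm (weak_pd i u))\<^sup>2 \<le> grad_sq u"
      unfolding grad_sq_eq[OF u] by (rule member_le_sum) auto
  qed
  with wd_difference_le[OF wd_direction[OF H2_wd(1)[OF u], of z]] show ?thesis
    using weighted_sum_bound[of "\<lambda>i. weak_pd i u" "sqrt (grad_sq u)" "\<lambda>i. z $ i" t] u z by fastforce
qed

text \<open>
  A forward second difference, with the points \<open>x\<close>, \<open>x + z\<close> and \<open>x + 2 z\<close>, serves as well as a symmetric one
  and keeps \<open>z\<close> in the cube \<open>[0, t]\<^sup>N\<close> when averages are taken.
\<close>

lemma second_difference_bound:
  fixes u :: "real ^ 'n \<Rightarrow> complex"
  assumes u: "u \<in> H2" and z: "\<And>i. \<bar>z $ i\<bar> \<le> t"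
  shows "L2_norm (\<lambda>x. u (x + 2 *\<^sub>R z) - 2 *\<^sub>R u (x + z) + u x)
    \<le> (real CARD('n) * t)\<^sup>2 * L2_norm (weak_laplacian u)"
proof -
  let ?D = "L2_norm (weak_laplacian u)" and ?N = "real CARD('n)"
  have t: "t \<ge> 0" using z[of undefined] abs_ge_zero order_trans by blast
  have hD: "L2_norm (weak_pd j (weak_pd i u)) \<le> ?D" for i j
  proof (rule power2_le_imp_le)
    have "(L2_norm (weak_pd j (weak_pd i u)))\<^sup>2 \<le> (\<Sum>j\<in>UNIV. (L2_norm (weak_pd j (weak_pd i u)))\<^sup>2)"
      by (rule member_le_sum) auto
    also have "\<dots> \<le> (\<Sum>i\<in>UNIV. \<Sum>j\<in>UNIV. (L2_norm (weak_pd j (weak_pd i u)))\<^sup>2)"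
      by (rule member_le_sum[where f="\<lambda>i. \<Sum>j\<in>UNIV. (L2_norm (weak_pd j (weak_pd i u)))\<^sup>2"])
         (auto intro: sum_nonneg)
    finally show "(L2_norm (weak_pd j (weak_pd i u)))\<^sup>2 \<le> ?D\<^sup>2"
      by (simp add: hessian_eq_laplacian[OF u])
  qed simp
  define H where "H i x = (\<Sum>j\<in>UNIV. z $ j *\<^sub>R weak_pd j (weak_pd i u) x)" for i x
  have wH: "wd z (weak_pd i u) (H i)" for i
    unfolding H_def[abs_def] by (rule wd_direction[OF H2_wd(2)[OF u]])
  have Hb: "L2_norm (H i) \<le> ?N * (t * ?D)" for i
    unfolding H_def[abs_def] by (rule weighted_sum_bound) (use u hD z in auto)
  define G where "G x = (\<Sum>i\<in>UNIV. z $ i *\<^sub>R weak_pd i u x)" for x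
  have wG: "wd z u G" unfolding G_def[abs_def] by (rule wd_direction[OF H2_wd(1)[OF u]])
  have "L2_norm (\<lambda>x. (u (x + z + z) - u (x + z)) - (u (x + z) - u x)) \<le> L2_norm (\<lambda>x. G (x + z) - G x)"
    by (rule wd_difference_le[OF wd_diff[OF wd_translate[OF wG, of z] wG]])
  also have "(\<lambda>x. G (x + z) - G x) = (\<lambda>x. \<Sum>i\<in>UNIV. z $ i *\<^sub>R (weak_pd i u (x + z) - weak_pd i u x))"
    by (simp add: G_def scaleR_diff_right sum_subtractf)
  also have "L2_norm \<dots> \<le> ?N * (t * (?N * (t * ?D)))"
  proof (rule weighted_sum_bound)
    show "L2_norm (\<lambda>x. weak_pd i u (x + z) - weak_pd i u x) \<le> ?N * (t * ?D)" for i
      using wd_difference_le[OF wH] Hb order_trans by blast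
    show "(\<lambda>x. weak_pd i u (x + z) - weak_pd i u x) \<in> L2" for i
      using u by (intro L2_diff L2_translate H2_L2)
  qed (rule z)
  also have "?N * (t * (?N * (t * ?D))) = (?N * t)\<^sup>2 * ?D" by (simp add: power2_eq_square)
  finally show ?thesis by (simp add: algebra_simps scaleR_2)
qed

subsection \<open>A weak type estimate\<close>

text \<open>
  If \<open>u (x)\<close> is reproduced, up to an error \<open>W x z\<close>, from the values of \<open>u\<close> at \<open>x + z\<close> and \<open>x + 2 z\<close>,
  then averaging over \<open>z\<close> in a cube whose volume is large compared with \<open>\<integral>\<bar>u\<bar>\<^sup>r / s\<^sup>r\<close> makes these
  values small compared with \<open>s\<close>. Hence where \<open>\<bar>u\<bar> > s\<close> the averaged error is of size \<open>s\<close>, and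
  Chebyshev's inequality bounds the measure of that set.
\<close>

lemma weak_type_estimate:
  fixes u :: "real ^ 'n \<Rightarrow> complex" and W :: "real ^ 'n \<Rightarrow> real ^ 'n \<Rightarrow> real"
  assumes [measurable]: "u \<in> borel_measurable borel" "case_prod W \<in> borel_measurable (borel \<Otimes>\<^sub>M borel)"
    and r: "r \<ge> 1" and s: "s > 0" and t: "t > 0" and R: "R \<ge> 0"
    and Lr: "Lp_int r u \<le> ennreal R" and tN: "t ^ CARD('n) \<ge> R * (8 / s) powr r"
    and W0: "\<And>x z. W x z \<ge> 0"
    and pt: "\<And>x z. cmod (u x) \<le> 2 * cmod (u (x + z)) + cmod (u (x + 2 *\<^sub>R z)) + W x z"
    and K: "K \<ge> 0" "\<And>z. (\<And>i. \<bar>z $ i\<bar> \<le> t) \<Longrightarrow> (\<integral>\<^sup>+x. ennreal ((W x z)\<^sup>2) \<partial>lborel) \<le> ennreal K"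
  shows "emeasure lborel {x. cmod (u x) > s} \<le> ennreal (16 * K / s\<^sup>2)"
proof -
  define Q :: "(real ^ 'n) set" where "Q = cbox 0 (\<chi> i. t)"
  have [measurable]: "Q \<in> sets borel" by (simp add: Q_def)
  have eQ: "emeasure lborel Q = ennreal (t ^ CARD('n))"
  proof -
    have "(\<Prod>b\<in>(Basis :: (real ^ 'n) set). ((\<chi> i. t) - 0) \<bullet> b) = t ^ CARD('n)"
    proof -
      have "((\<chi> i. t) - 0) \<bullet> b = t" if "b \<in> (Basis :: (real ^ 'n) set)" for b
        using that by (auto simp: Basis_vec_def inner_axis)
      then show ?thesis by simp
    qed
    moreover have "0 \<le> ((\<chi> i. t) :: real ^ 'n) \<bullet> b" if "b \<in> (Basis :: (real ^ 'n) set)" for b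
      using that t by (auto simp: Basis_vec_def inner_axis)
    ultimately show ?thesis unfolding Q_def by (subst emeasure_lborel_cbox) auto
  qed
  define \<nu> where "\<nu> = uniform_measure lborel Q"
  have tp: "t ^ CARD('n) > 0" using t by simp
  have prob: "prob_space \<nu>" unfolding \<nu>_def by (rule prob_space_uniform_measure) (use t in \<open>auto simp: eQ\<close>)
  interpret \<nu>: prob_space \<nu> by (rule prob)
  have sets[measurable_cong]: "sets \<nu> = sets borel" by (simp add: \<nu>_def)
  \<comment> \<open>The threshold splits \<open>\<bar>u\<bar> \<le> \<epsilon> + \<epsilon>\<^bsup>1-r\<^esup> \<bar>u\<bar>\<^sup>r\<close>, so that both parts average to at most \<open>s / 8\<close>.\<close>
  define \<epsilon> where "\<epsilon> = s / 8"
  have \<epsilon>: "\<epsilon> > 0" using s by (simp add: \<epsilon>_def)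
  have young: "a \<le> \<epsilon> + \<epsilon> powr (1 - r) * a powr r" if "a \<ge> 0" for a
  proof (cases "a \<le> \<epsilon>")
    case True
    then show ?thesis by (meson le_add_same_cancel1 mult_nonneg_nonneg order_trans powr_ge_zero)
  next
    case False
    have "a = \<epsilon> powr (1 - r) * \<epsilon> powr (r - 1) * a"
      using \<epsilon> by (simp add: powr_add[symmetric])
    also have "\<dots> \<le> \<epsilon> powr (1 - r) * a powr (r - 1) * a"
      using False \<epsilon> r by (intro mult_right_mono mult_left_mono powr_mono2) auto
    also have "\<dots> = \<epsilon> powr (1 - r) * a powr r"
      using False \<epsilon> by (simp add: powr_diff)
    finally show ?thesis using \<epsilon> by simp
  qed
  have avg_small: "(\<integral>\<^sup>+z. ennreal (cmod (u (x + c *\<^sub>R z))) \<partial>\<nu>) \<le> ennreal (s / 4)" if c: "c \<ge> 1" for x c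
  proof -
    have [measurable]: "(\<lambda>z. u (x + c *\<^sub>R z)) \<in> borel_measurable borel" by measurable
    have "(\<integral>\<^sup>+z. ennreal (cmod (u (x + c *\<^sub>R z)) powr r) \<partial>\<nu>)
       = (\<integral>\<^sup>+z. ennreal (cmod (u (x + c *\<^sub>R z)) powr r) * indicator Q z \<partial>lborel) / emeasure lborel Q"
      unfolding \<nu>_def by (rule nn_integral_uniform_measure) measurable
    also have "\<dots> \<le> (\<integral>\<^sup>+z. ennreal (cmod (u (x + c *\<^sub>R z)) powr r) \<partial>lborel) / emeasure lborel Q"
      by (intro divide_right_mono_ennreal nn_integral_mono) (auto simp: indicator_def)
    also have "(\<integral>\<^sup>+z. ennreal (cmod (u (x + c *\<^sub>R z)) powr r) \<partial>lborel) = ennreal (1 / c ^ CARD('n)) * Lp_int r u"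
      unfolding Lp_int_def by (rule nn_integral_affine[where f="\<lambda>z. ennreal (cmod (u z) powr r)"]) (use c in auto)
    also have "\<dots> \<le> 1 * ennreal R"
    proof (intro mult_mono Lr)
      have "1 / c ^ CARD('n) \<le> 1" using c by simp
      then show "ennreal (1 / c ^ CARD('n)) \<le> 1" using ennreal_leI by fastforce
    qed auto
    finally have *: "(\<integral>\<^sup>+z. ennreal (cmod (u (x + c *\<^sub>R z)) powr r) \<partial>\<nu>) \<le> ennreal (R / t ^ CARD('n))"
      using tp R by (simp add: eQ divide_ennreal divide_right_mono_ennreal)
    have RtN: "R / t ^ CARD('n) \<le> \<epsilon> powr r"
    proof -
      have "R = R * (8 / s) powr r * (s / 8) powr r"
        using s by (simp add: powr_mult[symmetric])
      also have "\<dots> \<le> t ^ CARD('n) * (s / 8) powr r" by (intro mult_right_mono tN) simp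
      finally show ?thesis using tp by (simp add: divide_le_eq \<epsilon>_def mult.commute)
    qed
    have "(\<integral>\<^sup>+z. ennreal (cmod (u (x + c *\<^sub>R z))) \<partial>\<nu>)
       \<le> (\<integral>\<^sup>+z. ennreal \<epsilon> + ennreal (\<epsilon> powr (1 - r)) * ennreal (cmod (u (x + c *\<^sub>R z)) powr r) \<partial>\<nu>)"
      by (intro nn_integral_mono) (use young \<epsilon> in \<open>auto simp: ennreal_mult[symmetric] ennreal_plus[symmetric] simp del: ennreal_plus intro!: ennreal_leI\<close>)
    also have "\<dots> = ennreal \<epsilon> + ennreal (\<epsilon> powr (1 - r)) * (\<integral>\<^sup>+z. ennreal (cmod (u (x + c *\<^sub>R z)) powr r) \<partial>\<nu>)"
      by (subst nn_integral_add) (auto simp: nn_integral_cmult \<nu>.emeasure_space_1)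
    also have "\<dots> \<le> ennreal \<epsilon> + ennreal (\<epsilon> powr (1 - r)) * ennreal (\<epsilon> powr r)"
      by (intro add_left_mono mult_left_mono order_trans[OF *] ennreal_leI RtN) auto
    also have "\<dots> = ennreal (\<epsilon> + \<epsilon> powr (1 - r) * \<epsilon> powr r)"
      using \<epsilon> by (simp add: ennreal_mult[symmetric] ennreal_plus[symmetric] del: ennreal_plus)
    also have "\<epsilon> powr (1 - r) * \<epsilon> powr r = \<epsilon>" using \<epsilon> by (simp add: powr_add[symmetric])
    finally show ?thesis by (simp add: \<epsilon>_def)
  qed
  define w where "w x = (\<integral>\<^sup>+z. ennreal (W x z) \<partial>\<nu>)" for x
  have [measurable]: "w \<in> borel_measurable borel" unfolding w_def by measurable
  have wbig: "ennreal (s / 4) \<le> w x" if big: "cmod (u x) > s" for x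
  proof -
    have "ennreal s \<le> ennreal (cmod (u x))" using big by (intro ennreal_leI) auto
    also have "\<dots> = (\<integral>\<^sup>+z. ennreal (cmod (u x)) \<partial>\<nu>)" by (simp add: \<nu>.emeasure_space_1)
    also have "\<dots> \<le> (\<integral>\<^sup>+z. 2 * ennreal (cmod (u (x + 1 *\<^sub>R z))) + ennreal (cmod (u (x + 2 *\<^sub>R z))) + ennreal (W x z) \<partial>\<nu>)"
    proof (rule nn_integral_mono)
      fix z
      have "ennreal (cmod (u x)) \<le> ennreal (2 * cmod (u (x + z)) + cmod (u (x + 2 *\<^sub>R z)) + W x z)"
        by (rule ennreal_leI[OF pt])
      then show "ennreal (cmod (u x)) \<le> 2 * ennreal (cmod (u (x + 1 *\<^sub>R z))) + ennreal (cmod (u (x + 2 *\<^sub>R z))) + ennreal (W x z)"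
        using W0 by (simp add: ennreal_mult)
    qed
    also have "\<dots> = 2 * (\<integral>\<^sup>+z. ennreal (cmod (u (x + 1 *\<^sub>R z))) \<partial>\<nu>) + (\<integral>\<^sup>+z. ennreal (cmod (u (x + 2 *\<^sub>R z))) \<partial>\<nu>) + w x"
      unfolding w_def by (simp add: nn_integral_add nn_integral_cmult)
    also have "\<dots> \<le> 2 * ennreal (s / 4) + ennreal (s / 4) + w x"
      by (intro add_mono mult_left_mono avg_small) auto
    also have "2 * ennreal (s / 4) + ennreal (s / 4) = ennreal (3 * s / 4)"
    proof -
      have "2 * ennreal (s / 4) = ennreal (2 * (s / 4))" using s by (simp only: ennreal_mult ennreal_numeral[symmetric] zero_le_numeral)
      then show ?thesis using s by (simp add: ennreal_plus[symmetric] del: ennreal_plus)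
    qed
    finally have le: "ennreal s \<le> ennreal (3 * s / 4) + w x" .
    show ?thesis
    proof (cases "w x")
      case (real q)
      then have "ennreal s \<le> ennreal (3 * s / 4 + q)" using le s by simp
      then have "s \<le> 3 * s / 4 + q" using real s by (subst (asm) ennreal_le_iff) auto
      then show ?thesis using real by (auto intro!: ennreal_leI)
    qed simp
  qed
  have main: "(\<integral>\<^sup>+x. (w x)\<^sup>2 \<partial>lborel) \<le> ennreal K"
  proof -
    have "(\<integral>\<^sup>+x. (w x)\<^sup>2 \<partial>lborel) \<le> (\<integral>\<^sup>+z. (\<integral>\<^sup>+x. (ennreal (W x z))\<^sup>2 \<partial>lborel) \<partial>\<nu>)"
      unfolding w_def by (rule nn_integral_Jensen_square[OF prob sets]) measurable
    also have "\<dots> \<le> (\<integral>\<^sup>+z. ennreal K \<partial>\<nu>)"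
    proof (rule nn_integral_mono_AE)
      have "AE z in \<nu>. z \<in> Q"
        unfolding \<nu>_def by (rule AE_uniform_measureI) auto
      then show "AE z in \<nu>. (\<integral>\<^sup>+x. (ennreal (W x z))\<^sup>2 \<partial>lborel) \<le> ennreal K"
      proof eventually_elim
        case (elim z)
        then have "\<bar>z $ i\<bar> \<le> t" for i by (auto simp: Q_def mem_box_cart)
        from K(2)[OF this] show ?case using W0 by (simp add: ennreal_power)
      qed
    qed
    also have "\<dots> = ennreal K" by (simp add: \<nu>.emeasure_space_1)
    finally show ?thesis .
  qed
  have "emeasure lborel {x. cmod (u x) > s} = (\<integral>\<^sup>+x. indicator {x. cmod (u x) > s} x \<partial>lborel)"
    by (rule nn_integral_indicator[symmetric]) measurable
  also have "\<dots> \<le> (\<integral>\<^sup>+x. ennreal (16 / s\<^sup>2) * (w x)\<^sup>2 \<partial>lborel)"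
  proof (rule nn_integral_mono)
    fix x
    have "1 \<le> ennreal (16 / s\<^sup>2) * (w x)\<^sup>2" if "cmod (u x) > s"
    proof -
      have "1 = ennreal (16 / s\<^sup>2 * (s / 4)\<^sup>2)" using s by (simp add: power_divide)
      also have "\<dots> = ennreal (16 / s\<^sup>2) * (ennreal (s / 4))\<^sup>2"
        using s by (simp add: ennreal_mult[symmetric] ennreal_power)
      also have "\<dots> \<le> ennreal (16 / s\<^sup>2) * (w x)\<^sup>2"
        by (intro mult_left_mono power_mono wbig that) auto
      finally show ?thesis .
    qed
    then show "indicator {x. cmod (u x) > s} x \<le> ennreal (16 / s\<^sup>2) * (w x)\<^sup>2"
      by (auto simp: indicator_def)
  qed
  also have "\<dots> = ennreal (16 / s\<^sup>2) * (\<integral>\<^sup>+x. (w x)\<^sup>2 \<partial>lborel)"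
    by (rule nn_integral_cmult) measurable
  also have "\<dots> \<le> ennreal (16 / s\<^sup>2) * ennreal K" by (intro mult_left_mono main) auto
  also have "\<dots> = ennreal (16 * K / s\<^sup>2)" using K by (simp add: ennreal_mult[symmetric])
  finally show ?thesis .
qed

lemma side_length_exists:
  assumes "a > 0" "n > 0"
  shows "(a powr (1 / real n)) ^ n = a"
  using assms by (simp add: powr_realpow[symmetric] powr_powr)

text \<open>
  The cube has the volume \<open>t\<^sup>N = R (8 / s)\<^sup>r\<close>, which keeps the averages of \<open>\<bar>u\<bar>\<close> at most
  \<open>s / 4\<close>; the error of second order then contributes \<open>t\<^sup>4 / s\<^sup>2\<close>.
\<close>

lemma weak_type_second:
  fixes u :: "real ^ 'n \<Rightarrow> complex"
  assumes u: "u \<in> H2" and D: "L2_norm (weak_laplacian u) \<le> 1" and r: "r \<ge> 1" and R: "R > 0"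
    and Lr: "Lp_int r u \<le> ennreal R" and s: "s > 0"
  shows "emeasure lborel {x. cmod (u x) > s} \<le>
    ennreal (16 * real CARD('n) ^ 4 * (R * 8 powr r) powr (4 / real CARD('n)) * s powr - (2 + 4 * r / real CARD('n)))"
proof -
  let ?N = "real CARD('n)"
  have [measurable]: "u \<in> borel_measurable borel" using H2_L2(1)[OF u] by measurable
  define A where "A = R * (8 / s) powr r"
  have A: "A > 0" using R s by (simp add: A_def)
  define t where "t = A powr (1 / ?N)"
  have t: "t > 0" "t ^ CARD('n) = A" using A side_length_exists[OF A, of "CARD('n)"] by (auto simp: t_def)
  have "emeasure lborel {x. cmod (u x) > s} \<le> ennreal (16 * ((?N * t)\<^sup>2)\<^sup>2 / s\<^sup>2)"
  proof (rule weak_type_estimate[where r=r and t=t and R=R and W="\<lambda>x z. cmod (u (x + 2 *\<^sub>R z) - 2 *\<^sub>R u (x + z) + u x)"])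
    fix x z
    let ?A = "u (x + 2 *\<^sub>R z) - 2 *\<^sub>R u (x + z) + u x"
    have eq: "u x = (?A + 2 *\<^sub>R u (x + z)) - u (x + 2 *\<^sub>R z)" by simp
    have "cmod (u x) \<le> cmod ?A + cmod (2 *\<^sub>R u (x + z)) + cmod (u (x + 2 *\<^sub>R z))"
      using norm_triangle_ineq4[of "?A + 2 *\<^sub>R u (x + z)" "u (x + 2 *\<^sub>R z)"]
        norm_triangle_ineq[of ?A "2 *\<^sub>R u (x + z)"] unfolding eq[symmetric] by linarith
    then show "cmod (u x) \<le> 2 * cmod (u (x + z)) + cmod (u (x + 2 *\<^sub>R z)) + cmod (u (x + 2 *\<^sub>R z) - 2 *\<^sub>R u (x + z) + u x)"
      by (simp add: norm_scaleR)
  next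
    fix z :: "real ^ 'n" assume z: "\<And>i. \<bar>z $ i\<bar> \<le> t"
    let ?f = "\<lambda>x. u (x + 2 *\<^sub>R z) - 2 *\<^sub>R u (x + z) + u x"
    have "?f \<in> L2" using u by (intro L2_add L2_diff L2_scaleR L2_translate) auto
    then have "(\<integral>\<^sup>+x. ennreal ((cmod (?f x))\<^sup>2) \<partial>lborel) = ennreal ((L2_norm ?f)\<^sup>2)" by (rule L2_norm_sq_nn)
    also have "L2_norm ?f \<le> (?N * t)\<^sup>2 * 1"
      using second_difference_bound[OF u z] mult_left_mono[OF D, of "(?N * t)\<^sup>2"] by simp
    then have "ennreal ((L2_norm ?f)\<^sup>2) \<le> ennreal (((?N * t)\<^sup>2)\<^sup>2)"
      by (intro ennreal_leI power_mono) auto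
    finally show "(\<integral>\<^sup>+x. ennreal ((cmod (?f x))\<^sup>2) \<partial>lborel) \<le> ennreal (((?N * t)\<^sup>2)\<^sup>2)" .
  qed (use r s t R Lr A_def in auto)
  also have "16 * ((?N * t)\<^sup>2)\<^sup>2 / s\<^sup>2 = 16 * ?N ^ 4 * (R * 8 powr r) powr (4 / ?N) * s powr - (2 + 4 * r / ?N)"
  proof -
    have "t ^ 4 = A powr (4 / ?N)"
      unfolding t_def using A by (simp add: powr_realpow[symmetric] powr_powr)
    also have "A = (R * 8 powr r) * s powr (- r)"
      using s by (simp add: A_def powr_divide powr_minus_divide)
    also have "\<dots> powr (4 / ?N) = (R * 8 powr r) powr (4 / ?N) * s powr (- (4 * r / ?N))"
      using R s by (simp add: powr_mult powr_powr mult.commute)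
    finally have "t ^ 4 = (R * 8 powr r) powr (4 / ?N) * s powr (- (4 * r / ?N))" .
    moreover have "s powr - (2 + 4 * r / ?N) = s powr (- (4 * r / ?N)) / s\<^sup>2"
    proof -
      have "s powr - (2 + w) = s powr (- w) / s\<^sup>2" for w
      proof -
        have "- (2 + w) = - w + - 2" by simp
        then have "s powr - (2 + w) = s powr (- w) * s powr (- 2)" by (simp only: powr_add)
        then show ?thesis using s by (simp add: powr_neg_numeral)
      qed
      then show ?thesis .
    qed
    moreover have "((?N * t)\<^sup>2)\<^sup>2 = ?N ^ 4 * t ^ 4" by (simp add: power_mult_distrib)
    ultimately show ?thesis by simp
  qed
  finally show ?thesis .
qed

lemma weak_type_first:
  fixes u :: "real ^ 'n \<Rightarrow> complex"
  assumes s: "s > 0"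
  obtains K where "K \<ge> 0" "\<And>u :: real ^ 'n \<Rightarrow> complex. u \<in> H2 \<Longrightarrow> L2_norm u \<le> 1 \<Longrightarrow>
     emeasure lborel {x. cmod (u x) > s} \<le> ennreal (K * grad_sq u)"
proof -
  let ?N = "real CARD('n)"
  define A where "A = 1 * (8 / s) powr 2"
  have A: "A > 0" using s by (simp add: A_def)
  define t where "t = A powr (1 / ?N)"
  have t: "t > 0" "t ^ CARD('n) = A" using A side_length_exists[OF A, of "CARD('n)"] by (auto simp: t_def)
  show ?thesis
  proof (rule that[of "16 * (?N * t)\<^sup>2 / s\<^sup>2"])
    fix u :: "real ^ 'n \<Rightarrow> complex" assume u: "u \<in> H2" and M: "L2_norm u \<le> 1"
    have [measurable]: "u \<in> borel_measurable borel" using H2_L2(1)[OF u] by measurable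
    have "Lp_int 2 u = ennreal ((L2_norm u)\<^sup>2)"
      using L2_norm_sq_nn[OF H2_L2(1)[OF u]] by (simp add: Lp_int_def)
    also have "\<dots> \<le> ennreal 1" using M by (intro ennreal_leI) (simp add: power_le_one)
    finally have L: "Lp_int 2 u \<le> ennreal 1" .
    have "emeasure lborel {x. cmod (u x) > s} \<le> ennreal (16 * ((?N * t)\<^sup>2 * grad_sq u) / s\<^sup>2)"
    proof (rule weak_type_estimate[where r=2 and t=t and R=1 and W="\<lambda>x z. cmod (u (x + z) - u x)"])
      fix x z
      have "cmod (u x) \<le> cmod (u (x + z)) + cmod (u (x + z) - u x)"
        using norm_triangle_ineq4[of "u (x + z)" "u (x + z) - u x"] by simp
      then show "cmod (u x) \<le> 2 * cmod (u (x + z)) + cmod (u (x + 2 *\<^sub>R z)) + cmod (u (x + z) - u x)"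
        using norm_ge_zero[of "u (x + z)"] norm_ge_zero[of "u (x + 2 *\<^sub>R z)"] by linarith
    next
      fix z :: "real ^ 'n" assume z: "\<And>i. \<bar>z $ i\<bar> \<le> t"
      let ?f = "\<lambda>x. u (x + z) - u x"
      have "?f \<in> L2" using u by (intro L2_diff L2_translate) auto
      then have "(\<integral>\<^sup>+x. ennreal ((cmod (?f x))\<^sup>2) \<partial>lborel) = ennreal ((L2_norm ?f)\<^sup>2)" by (rule L2_norm_sq_nn)
      also have "(L2_norm ?f)\<^sup>2 \<le> (?N * (t * sqrt (grad_sq u)))\<^sup>2"
        using first_difference_bound[OF u z] by (intro power_mono) auto
      then have "ennreal ((L2_norm ?f)\<^sup>2) \<le> ennreal ((?N * t)\<^sup>2 * grad_sq u)"
        using grad_sq_nonneg[of u] by (intro ennreal_leI) (simp add: power_mult_distrib)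
      finally show "(\<integral>\<^sup>+x. ennreal ((cmod (?f x))\<^sup>2) \<partial>lborel) \<le> ennreal ((?N * t)\<^sup>2 * grad_sq u)" .
    qed (use s t L A_def grad_sq_nonneg[of u] in auto)
    then show "emeasure lborel {x. cmod (u x) > s} \<le> ennreal (16 * (?N * t)\<^sup>2 / s\<^sup>2 * grad_sq u)" by (simp add: mult.assoc)
  qed simp
qed

subsection \<open>Strong type estimates\<close>

text \<open>
  Where \<open>\<bar>u\<bar> \<le> 1\<close>, the power \<open>\<bar>u\<bar>\<^sup>p\<close> is at most \<open>\<bar>u\<bar>\<^sup>2\<close>; elsewhere it is summed over the dyadic levels
  \<open>2\<^sup>k < \<bar>u\<bar> \<le> 2\<^bsup>k+1\<^esup>\<close>, which gives a geometric series with ratio \<open>2\<^bsup>p-b\<^esup> < 1\<close>.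
\<close>

lemma strong_from_weak_type:
  fixes u :: "real ^ 'n \<Rightarrow> complex"
  assumes [measurable]: "u \<in> borel_measurable borel" and p: "2 \<le> p" "p < b" and C: "C \<ge> 0"
    and L: "Lp_int 2 u \<le> ennreal R" and R: "R \<ge> 0"
    and weak: "\<And>s. s \<ge> 1 \<Longrightarrow> emeasure lborel {x. cmod (u x) > s} \<le> ennreal (C * s powr - b)"
  shows "Lp_int p u \<le> ennreal (R + 2 powr p * C * (1 / (1 - 2 powr (p - b))))"
proof -
  define q where "q = 2 powr (p - b)"
  have q: "0 < q" "q < 1" using p by (auto simp: q_def powr_less_one)
  let ?S = "\<lambda>k. {x. cmod (u x) > 2 ^ k}"
  have pt: "ennreal (cmod (u x) powr p) \<le> ennreal (cmod (u x) powr 2) + (\<Sum>k. ennreal (2 powr (real (Suc k) * p)) * indicator (?S k) x)" for x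
  proof (cases "cmod (u x) \<le> 1")
    case True
    have "cmod (u x) powr p \<le> cmod (u x) powr 2"
    proof (cases "cmod (u x) = 0")
      case False
      then show ?thesis using True p by (intro powr_mono') auto
    qed simp
    then show ?thesis by (meson ennreal_leI add_increasing2 order_trans zero_le)
  next
    case False
    define n where "n = (LEAST n. cmod (u x) \<le> 2 ^ n)"
    obtain n' where "cmod (u x) < 2 ^ n'" using real_arch_pow[of 2 "cmod (u x)"] by auto
    then have "cmod (u x) \<le> 2 ^ n'" by simp
    then have n: "cmod (u x) \<le> 2 ^ n" unfolding n_def by (rule LeastI)
    then obtain k where k: "n = Suc k" using False by (cases n) auto
    have "\<not> cmod (u x) \<le> 2 ^ k" using not_less_Least[of k "\<lambda>n. cmod (u x) \<le> 2 ^ n"] k by (simp add: n_def)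
    then have S: "x \<in> ?S k" by simp
    define F where "F k = ennreal (2 powr (real (Suc k) * p)) * indicator (?S k) x" for k
    have "cmod (u x) powr p \<le> (2 ^ Suc k) powr p" using n k p by (intro powr_mono2) auto
    also have "\<dots> = 2 powr (real (Suc k) * p)" by (simp only: powr_realpow[symmetric] powr_powr zero_less_numeral)
    finally have "ennreal (cmod (u x) powr p) \<le> F k"
      using S by (simp add: F_def ennreal_leI)
    also have "F k \<le> suminf F" using sum_le_suminf[of F "{k}"] by simp
    also have "suminf F \<le> ennreal (cmod (u x) powr 2) + suminf F" by (simp add: add_increasing)
    finally show ?thesis unfolding F_def .
  qed
  have "Lp_int p u \<le> (\<integral>\<^sup>+x. ennreal (cmod (u x) powr 2) + (\<Sum>k. ennreal (2 powr (real (Suc k) * p)) * indicator (?S k) x) \<partial>lborel)"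
    unfolding Lp_int_def by (intro nn_integral_mono pt)
  also have "\<dots> = Lp_int 2 u + (\<integral>\<^sup>+x. (\<Sum>k. ennreal (2 powr (real (Suc k) * p)) * indicator (?S k) x) \<partial>lborel)"
    unfolding Lp_int_def by (rule nn_integral_add) measurable
  also have "(\<integral>\<^sup>+x. (\<Sum>k. ennreal (2 powr (real (Suc k) * p)) * indicator (?S k) x) \<partial>lborel)
      = (\<Sum>k. \<integral>\<^sup>+x. ennreal (2 powr (real (Suc k) * p)) * indicator (?S k) x \<partial>lborel)"
    by (rule nn_integral_suminf) measurable
  also have "\<dots> = (\<Sum>k. ennreal (2 powr (real (Suc k) * p)) * emeasure lborel (?S k))"
    by (intro suminf_cong nn_integral_cmult_indicator) measurable
  also have "\<dots> \<le> (\<Sum>k. ennreal (2 powr p * C * q ^ k))"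
  proof (intro suminf_le summableI)
    fix k :: nat
    have "ennreal (2 powr (real (Suc k) * p)) * emeasure lborel (?S k)
       \<le> ennreal (2 powr (real (Suc k) * p)) * ennreal (C * (2 ^ k) powr - b)"
      by (intro mult_left_mono weak) auto
    also have "\<dots> = ennreal (2 powr (real (Suc k) * p) * (C * (2 ^ k) powr - b))"
      using C by (intro ennreal_mult[symmetric]) auto
    also have "2 powr (real (Suc k) * p) * (C * (2 ^ k) powr - b) = 2 powr p * C * q ^ k"
    proof -
      have "(2 ^ k) powr - b = 2 powr (- (real k * b))"
        by (simp add: powr_realpow[symmetric] powr_powr)
      moreover have "q ^ k = 2 powr (real k * (p - b))"
        using q(1) by (simp add: q_def powr_realpow[symmetric] powr_powr mult.commute)
      moreover have "2 powr (real (Suc k) * p) * 2 powr (- (real k * b)) = 2 powr p * 2 powr (real k * (p - b))"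
        by (simp add: powr_add[symmetric] algebra_simps)
      ultimately show ?thesis by (simp add: mult_ac)
    qed
    finally show "ennreal (2 powr (real (Suc k) * p)) * emeasure lborel (?S k) \<le> ennreal (2 powr p * C * q ^ k)" .
  qed
  also have "\<dots> = ennreal (2 powr p * C * (1 / (1 - q)))"
    using q C by (intro suminf_ennreal_eq sums_mult geometric_sums) auto
  finally have "Lp_int p u \<le> Lp_int 2 u + ennreal (2 powr p * C * (1 / (1 - q)))" by (simp add: add_left_mono)
  also have "\<dots> \<le> ennreal R + ennreal (2 powr p * C * (1 / (1 - q)))" by (intro add_right_mono L)
  also have "\<dots> = ennreal (R + 2 powr p * C * (1 / (1 - q)))"
    using R C q by (intro ennreal_plus[symmetric]) auto
  finally show ?thesis by (simp add: q_def)
qed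

lemma Lp_int_2_le: "u \<in> L2 \<Longrightarrow> L2_norm u \<le> 1 \<Longrightarrow> Lp_int 2 u \<le> ennreal 1"
  using L2_norm_sq_nn[of u] power_le_one[of "L2_norm u" 2] by (simp add: Lp_int_def)

lemma Lp_bounded_step:
  assumes r: "r \<ge> 1" and R: "R > 0"
    and Lr: "\<And>u :: real ^ 'n \<Rightarrow> complex. u \<in> H2 \<Longrightarrow> L2_norm u \<le> 1 \<Longrightarrow> L2_norm (weak_laplacian u) \<le> 1 \<Longrightarrow> Lp_int r u \<le> ennreal R"
    and p: "2 \<le> p" "p < 2 + 4 * r / real CARD('n)"
  shows "\<exists>C>0. \<forall>u :: real ^ 'n \<Rightarrow> complex. u \<in> H2 \<longrightarrow> L2_norm u \<le> 1 \<longrightarrow> L2_norm (weak_laplacian u) \<le> 1 \<longrightarrow> Lp_int p u \<le> ennreal C"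
proof -
  let ?b = "2 + 4 * r / real CARD('n)"
  define C where "C = 16 * real CARD('n) ^ 4 * (R * 8 powr r) powr (4 / real CARD('n))"
  have C: "C \<ge> 0" using R by (simp add: C_def)
  let ?C = "1 + 2 powr p * C * (1 / (1 - 2 powr (p - ?b)))"
  have "2 powr (p - ?b) < 1" using p by (intro powr_less_one) auto
  then have pos: "?C > 0" using C by (intro add_pos_nonneg mult_nonneg_nonneg) auto
  have "Lp_int p u \<le> ennreal ?C" if u: "u \<in> H2" "L2_norm u \<le> 1" "L2_norm (weak_laplacian u) \<le> 1" for u :: "real ^ 'n \<Rightarrow> complex"
  proof (rule strong_from_weak_type[OF _ p C])
    show "u \<in> borel_measurable borel" using H2_L2(1)[OF u(1)] by measurable
    show "Lp_int 2 u \<le> ennreal 1" using u by (intro Lp_int_2_le) auto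
    show "emeasure lborel {x. cmod (u x) > s} \<le> ennreal (C * s powr - ?b)" if "s \<ge> 1" for s
      unfolding C_def by (rule weak_type_second[OF u(1,3) r R Lr[OF u]]) (use that in auto)
  qed simp
  then show ?thesis using pos by blast
qed

text \<open>
  Starting from \<open>r = 2\<close> the weak type estimate ends exactly at the critical exponent \<open>2 + 8 / N\<close>; a
  second application, starting from an \<open>r > 2\<close> below it, goes beyond.
\<close>

lemma Lp_bounded:
  assumes p: "2 \<le> p" "p < 2 + 8 / real CARD('n) + 16 / (real CARD('n))\<^sup>2"
  shows "\<exists>C>0. \<forall>u :: real ^ 'n \<Rightarrow> complex. u \<in> H2 \<longrightarrow> L2_norm u \<le> 1 \<longrightarrow> L2_norm (weak_laplacian u) \<le> 1 \<longrightarrow> Lp_int p u \<le> ennreal C"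
proof -
  let ?N = "real CARD('n)"
  have N: "?N > 0" by simp
  \<comment> \<open>The midpoint of \<open>2\<close> and the exponent \<open>2 + 8 / N\<close>, which the first application just misses.\<close>
  define r where "r = 2 + 4 / ?N"
  have "\<exists>C>0. \<forall>u :: real ^ 'n \<Rightarrow> complex. u \<in> H2 \<longrightarrow> L2_norm u \<le> 1 \<longrightarrow> L2_norm (weak_laplacian u) \<le> 1 \<longrightarrow> Lp_int r u \<le> ennreal C"
  proof (rule Lp_bounded_step[where r=2 and R=1])
    show "r < 2 + 4 * 2 / ?N" using N by (simp add: r_def divide_strict_right_mono)
  qed (use N in \<open>auto simp: r_def intro!: Lp_int_2_le[simplified]\<close>)
  then obtain R where R: "R > 0" "\<And>u :: real ^ 'n \<Rightarrow> complex. u \<in> H2 \<Longrightarrow> L2_norm u \<le> 1 \<Longrightarrow> L2_norm (weak_laplacian u) \<le> 1 \<Longrightarrow> Lp_int r u \<le> ennreal R"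
    by blast
  show ?thesis
  proof (rule Lp_bounded_step[OF _ R(1) R(2) p(1)])
    have "4 * r / ?N = 8 / ?N + 16 / ?N\<^sup>2" using N by (simp add: r_def power2_eq_square field_simps)
    then show "p < 2 + 4 * r / ?N" using p(2) by simp
    show "1 \<le> r" using N by (simp add: r_def)
  qed
qed

text \<open>
  Small gradient forces small \<open>L\<^sup>p\<close> norm: moderate values of \<open>u\<close> occur on a set of small measure by
  the first order weak type estimate, small values are controlled by the mass and large ones by a
  higher \<open>L\<^sup>p\<close> norm.
\<close>

lemma Lp_small:
  assumes p: "2 < p" "p < 2 + 8 / real CARD('n) + 16 / (real CARD('n))\<^sup>2" and e: "e > 0"
  shows "\<exists>c>0. \<forall>u :: real ^ 'n \<Rightarrow> complex. u \<in> H2 \<longrightarrow> L2_norm u \<le> 1 \<longrightarrow> L2_norm (weak_laplacian u) \<le> 1 \<longrightarrow>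
     grad_sq u < c \<longrightarrow> Lp_int p u \<le> ennreal e"
proof -
  obtain p' where p': "p < p'" "p' < 2 + 8 / real CARD('n) + 16 / (real CARD('n))\<^sup>2" using dense[OF p(2)] by blast
  obtain C where C: "C > 0" "\<And>u :: real ^ 'n \<Rightarrow> complex. u \<in> H2 \<Longrightarrow> L2_norm u \<le> 1 \<Longrightarrow> L2_norm (weak_laplacian u) \<le> 1 \<Longrightarrow> Lp_int p' u \<le> ennreal C"
    using Lp_bounded[OF _ p'(2)] p p'(1) by fastforce
  \<comment> \<open>Low, high and intermediate values of \<open>u\<close> contribute \<open>e / 3\<close> each, by the choice of \<open>s\<close>, \<open>T\<close> and \<open>c\<close>.\<close>
  define s where "s = (e / 3) powr (1 / (p - 2))"
  have s: "s > 0" "s powr (p - 2) = e / 3" using e p by (auto simp: s_def powr_powr)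
  define T where "T = (e / (3 * C)) powr (1 / (p - p'))"
  have T: "T > 0" "T powr (p - p') * C = e / 3"
    using e C(1) p' by (auto simp: T_def powr_powr)
  obtain K where K: "K \<ge> 0" "\<And>u :: real ^ 'n \<Rightarrow> complex. u \<in> H2 \<Longrightarrow> L2_norm u \<le> 1 \<Longrightarrow>
     emeasure lborel {x. cmod (u x) > s} \<le> ennreal (K * grad_sq u)"
    using weak_type_first[OF s(1)] by blast
  define c where "c = (e / 3) / (T powr p * K + 1)"
  have TK: "T powr p * K \<ge> 0" using K by simp
  then have c: "c > 0" using e by (simp add: c_def add_nonneg_pos)
  have "Lp_int p u \<le> ennreal e" if u: "u \<in> H2" "L2_norm u \<le> 1" "L2_norm (weak_laplacian u) \<le> 1" "grad_sq u < c" for u :: "real ^ 'n \<Rightarrow> complex"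
  proof -
    have [measurable]: "u \<in> borel_measurable borel" using H2_L2(1)[OF u(1)] by measurable
    have pt: "ennreal (cmod (u x) powr p) \<le> ennreal (s powr (p - 2)) * ennreal (cmod (u x) powr 2)
       + ennreal (T powr p) * indicator {x. cmod (u x) > s} x + ennreal (T powr (p - p')) * ennreal (cmod (u x) powr p')" for x
    proof -
      consider "cmod (u x) \<le> s" | "cmod (u x) > s" "cmod (u x) \<le> T" | "cmod (u x) > T" by linarith
      then show ?thesis
      proof cases
        case 1
        have "cmod (u x) powr p = cmod (u x) powr (p - 2) * cmod (u x) powr 2" by (simp only: powr_add[symmetric]) simp
        also have "\<dots> \<le> s powr (p - 2) * cmod (u x) powr 2"
          using 1 p by (intro mult_right_mono powr_mono2) auto
        finally have "ennreal (cmod (u x) powr p) \<le> ennreal (s powr (p - 2)) * ennreal (cmod (u x) powr 2)"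
          by (simp add: ennreal_mult[symmetric] ennreal_leI)
        then show ?thesis by (meson add_increasing2 order_trans zero_le le_add_same_cancel1)
      next
        case 2
        have "cmod (u x) powr p \<le> T powr p" using 2 p by (intro powr_mono2) auto
        then have "ennreal (cmod (u x) powr p) \<le> ennreal (T powr p) * indicator {x. cmod (u x) > s} x"
          using 2 by (simp add: ennreal_leI)
        then show ?thesis by (simp add: add_increasing add_increasing2)
      next
        case 3
        have "cmod (u x) powr p = cmod (u x) powr (p - p') * cmod (u x) powr p'"
          by (simp only: powr_add[symmetric]) simp
        also have "\<dots> \<le> T powr (p - p') * cmod (u x) powr p'"
          using 3 p' T by (intro mult_right_mono powr_mono2') auto
        finally have "ennreal (cmod (u x) powr p) \<le> ennreal (T powr (p - p')) * ennreal (cmod (u x) powr p')"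
          by (simp add: ennreal_mult[symmetric] ennreal_leI)
        then show ?thesis by (simp add: add_increasing)
      qed
    qed
    have "Lp_int p u \<le> (\<integral>\<^sup>+x. ennreal (s powr (p - 2)) * ennreal (cmod (u x) powr 2)
       + ennreal (T powr p) * indicator {x. cmod (u x) > s} x + ennreal (T powr (p - p')) * ennreal (cmod (u x) powr p') \<partial>lborel)"
      unfolding Lp_int_def by (intro nn_integral_mono pt)
    also have "\<dots> = ennreal (s powr (p - 2)) * Lp_int 2 u + ennreal (T powr p) * emeasure lborel {x. cmod (u x) > s}
       + ennreal (T powr (p - p')) * Lp_int p' u"
      unfolding Lp_int_def by (simp add: nn_integral_add nn_integral_cmult)
    also have "\<dots> \<le> ennreal (s powr (p - 2)) * ennreal 1 + ennreal (T powr p) * ennreal (K * grad_sq u)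
       + ennreal (T powr (p - p')) * ennreal C"
      by (intro add_mono mult_left_mono Lp_int_2_le K(2) C(2) u H2_L2) auto
    also have "\<dots> = ennreal (s powr (p - 2) + T powr p * (K * grad_sq u) + T powr (p - p') * C)"
      using K C grad_sq_nonneg[of u] by (simp add: ennreal_mult[symmetric] ennreal_plus[symmetric] del: ennreal_plus)
    also have "\<dots> \<le> ennreal e"
    proof (rule ennreal_leI)
      have "T powr p * (K * grad_sq u) \<le> (T powr p * K) * c"
        using TK u(4) by (simp add: mult.assoc[symmetric] mult_left_mono)
      also have "\<dots> \<le> (T powr p * K + 1) * c" using c by simp
      also have "\<dots> = e / 3"
      proof -
        have "T powr p * K + 1 \<noteq> 0" using TK by linarith
        moreover have "y * (z / y) = z" if "y \<noteq> 0" for y z :: real using that by simp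
        ultimately show ?thesis by (simp only: c_def)
      qed
      finally show "s powr (p - 2) + T powr p * (K * grad_sq u) + T powr (p - p') * C \<le> e"
        using s T by simp
    qed
    finally show ?thesis .
  qed
  then show ?thesis using c by blast
qed

section \<open>Wave packets\<close>

subsection \<open>Classical derivatives are weak derivatives\<close>

lemma continuous_compact_support_integrable:
  fixes f :: "real ^ 'n \<Rightarrow> complex"
  assumes "continuous_on UNIV f" "\<And>x. norm x > R \<Longrightarrow> f x = 0"
  shows "integrable lborel f" "f \<in> L2" "p > 0 \<Longrightarrow> Lp_int p f < \<infinity>"
proof -
  obtain B where B: "B \<ge> 0" "\<And>x. cmod (f x) \<le> B * indicator (cball 0 R) x"
    using continuous_compact_support_bound[OF assms] by blast
  have [measurable]: "f \<in> borel_measurable borel" using assms(1) by (rule borel_measurable_continuous_onI)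
  show "integrable lborel f"
    by (rule Bochner_Integration.integrable_bound[OF integrable_indicator_cball[of B R]])
       (use B in \<open>auto intro!: AE_I2 order_trans[OF B(2)]\<close>)
  have sq: "(cmod (f x))\<^sup>2 \<le> B\<^sup>2 * indicator (cball 0 R) x" for x
    using power_mono[OF B(2)[of x], of 2] by (cases "norm x \<le> R") auto
  have "integrable lborel (\<lambda>x. (cmod (f x))\<^sup>2)"
  proof (rule Bochner_Integration.integrable_bound[OF integrable_indicator_cball[of "B\<^sup>2" R]])
    show "AE x in lborel. norm ((cmod (f x))\<^sup>2) \<le> norm (B\<^sup>2 * indicator (cball 0 R) x)"
    proof (rule AE_I2)
      fix x
      show "norm ((cmod (f x))\<^sup>2) \<le> norm (B\<^sup>2 * indicator (cball 0 R) x)"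
        using sq[of x] abs_ge_self[of "B\<^sup>2 * indicator (cball 0 R) x"] by (simp add: order_trans)
    qed
  qed measurable
  then show "f \<in> L2" by (simp add: L2_def)
  assume p: "p > 0"
  have "Lp_int p f \<le> (\<integral>\<^sup>+x. ennreal (B powr p * indicator (cball (0 :: real ^ 'n) R) x) \<partial>lborel)"
    unfolding Lp_int_def
  proof (intro nn_integral_mono ennreal_leI)
    fix x
    show "cmod (f x) powr p \<le> B powr p * indicator (cball 0 R) x"
    proof (cases "norm x \<le> R")
      case True
      then show ?thesis using B(2)[of x] p by (auto intro!: powr_mono2)
    next
      case False
      then show ?thesis using B(2)[of x] p by simp
    qed
  qed
  also have "\<dots> < \<infinity>"
    by (subst nn_integral_eq_integral[OF integrable_indicator_cball]) auto
  finally show "Lp_int p f < \<infinity>" .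
qed

text \<open>
  The integral of \<open>G\<close> is also that of its averages over segments in direction \<open>y\<close>, which are the
  differences \<open>F (x + y) - F x\<close> and integrate to \<open>0\<close> by translation invariance.
\<close>

lemma integral_directional_derivative_zero:
  fixes F G :: "real ^ 'n \<Rightarrow> complex"
  assumes F: "integrable lborel F" and G: "continuous_on UNIV G" "integrable lborel G"
    and d: "\<And>x s. ((\<lambda>s. F (x + s *\<^sub>R y)) has_vector_derivative G (x + s *\<^sub>R y)) (at s)"
  shows "(LINT x|lborel. G x) = 0"
proof -
  interpret U: prob_space uniform_01 by (rule prob_space_uniform_01)
  have [measurable]: "F \<in> borel_measurable borel" "G \<in> borel_measurable borel" using F G by auto
  have ftc: "F (x + y) - F x = (LINT s|uniform_01. G (x + s *\<^sub>R y))" for x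
  proof -
    have "(LINT s|uniform_01. G (x + s *\<^sub>R y)) = (LINT s|lborel. indicator {0..1} s *\<^sub>R G (x + s *\<^sub>R y))"
      unfolding uniform_01_def by (rule integral_density) auto
    also have "\<dots> = F (x + 1 *\<^sub>R y) - F (x + 0 *\<^sub>R y)"
    proof (rule integral_FTC_atLeastAtMost)
      show "continuous_on {0..1} (\<lambda>s. G (x + s *\<^sub>R y))"
        by (intro continuous_on_compose2[OF G(1)] continuous_intros) auto
      show "((\<lambda>s. F (x + s *\<^sub>R y)) has_vector_derivative G (x + s *\<^sub>R y)) (at s within {0..1})" for s
        using d by (rule has_vector_derivative_at_within)
    qed simp
    finally show ?thesis by simp
  qed
  have "(LINT x|lborel. LINT s|uniform_01. G (x + s *\<^sub>R y)) = (LINT s|uniform_01. LINT x|lborel. G (x + s *\<^sub>R y))"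
  proof (rule Fubini_uniform_01)
    fix s
    have "(\<integral>\<^sup>+x. norm (G (x + s *\<^sub>R y)) \<partial>lborel) = (\<integral>\<^sup>+x. norm (G x) \<partial>lborel)"
      by (rule nn_integral_translate) measurable
    also have "\<dots> = ennreal (LINT x|lborel. norm (G x))"
      using G by (intro nn_integral_eq_integral) auto
    finally show "(\<integral>\<^sup>+x. norm (G (x + s *\<^sub>R y)) \<partial>lborel) \<le> ennreal (LINT x|lborel. norm (G x))" by simp
  qed measurable
  also have "\<dots> = (LINT s|uniform_01. LINT x|lborel. G x)"
    by (intro Bochner_Integration.integral_cong refl integral_translate) measurable
  also have "\<dots> = (LINT x|lborel. G x)" by (simp add: U.prob_space)
  also have "(LINT x|lborel. LINT s|uniform_01. G (x + s *\<^sub>R y)) = (LINT x|lborel. F (x + y) - F x)"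
    by (simp add: ftc)
  also have "\<dots> = 0"
    using F integrable_translate[OF F, of y] integral_translate[of F y] by simp
  finally show ?thesis by simp
qed

lemma classical_derivative_wd:
  fixes f :: "real ^ 'n \<Rightarrow> complex"
  assumes f: "\<And>x. (f has_derivative f' x) (at x)" and cont: "continuous_on UNIV (\<lambda>x. f' x y)"
    and supp: "\<And>x. norm x > R \<Longrightarrow> f x = 0" "\<And>x. norm x > R \<Longrightarrow> f' x y = 0"
  shows "wd y f (\<lambda>x. f' x y)"
proof (rule wdI)
  have fc: "continuous_on UNIV f"
    using f by (intro continuous_at_imp_continuous_on ballI has_derivative_continuous) auto
  show L: "f \<in> L2" "(\<lambda>x. f' x y) \<in> L2"
    using continuous_compact_support_integrable(2)[OF fc supp(1)]
      continuous_compact_support_integrable(2)[OF cont supp(2)] by auto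
  fix \<phi> :: "real ^ 'n \<Rightarrow> real" assume t: "test_function \<phi>"
  have phic: "continuous_on UNIV (\<lambda>x. frechet_derivative \<phi> (at x) y)"
    unfolding frechet_derivative_pderivative[OF test_function_differentiable[OF t]]
    by (intro continuous_intros test_function_pderivative_continuous[OF t])
  have int: "integrable lborel (\<lambda>x. \<phi> x *\<^sub>R f x)" "integrable lborel (\<lambda>x. \<phi> x *\<^sub>R f' x y)"
    "integrable lborel (\<lambda>x. frechet_derivative \<phi> (at x) y *\<^sub>R f x)"
    using test_function_integrable[OF t L(1)] test_function_integrable(1)[OF t L(2)] by auto
  have "(LINT x|lborel. \<phi> x *\<^sub>R f' x y + frechet_derivative \<phi> (at x) y *\<^sub>R f x) = 0"
  proof (rule integral_directional_derivative_zero[where y=y and F="\<lambda>x. \<phi> x *\<^sub>R f x"])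
    show "continuous_on UNIV (\<lambda>x. \<phi> x *\<^sub>R f' x y + frechet_derivative \<phi> (at x) y *\<^sub>R f x)"
      by (intro continuous_intros test_function_continuous[OF t] cont phic fc)
    fix x s
    have line: "((\<lambda>s. x + s *\<^sub>R y) has_derivative (\<lambda>h. h *\<^sub>R y)) (at s)"
      by (auto intro!: derivative_eq_intros)
    have dphi: "(\<phi> has_derivative frechet_derivative \<phi> (at z)) (at z)" for z
      using frechet_derivative_works[THEN iffD1, OF test_function_differentiable[OF t]] .
    have lin: "linear (frechet_derivative \<phi> (at z))" "linear (f' z)" for z
      using frechet_derivative_linear_test[OF t] has_derivative_linear[OF f] by auto
    have "((\<lambda>x. \<phi> x *\<^sub>R f x) has_derivative (\<lambda>h. \<phi> z *\<^sub>R f' z h + frechet_derivative \<phi> (at z) h *\<^sub>R f z)) (at z)" for z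
      by (rule has_derivative_scaleR[OF dphi f])
    from has_derivative_compose[OF line this]
    have "((\<lambda>s. \<phi> (x + s *\<^sub>R y) *\<^sub>R f (x + s *\<^sub>R y)) has_derivative
       (\<lambda>h. \<phi> (x + s *\<^sub>R y) *\<^sub>R f' (x + s *\<^sub>R y) (h *\<^sub>R y) + frechet_derivative \<phi> (at (x + s *\<^sub>R y)) (h *\<^sub>R y) *\<^sub>R f (x + s *\<^sub>R y))) (at s)" .
    then show "((\<lambda>s. \<phi> (x + s *\<^sub>R y) *\<^sub>R f (x + s *\<^sub>R y)) has_vector_derivative
       \<phi> (x + s *\<^sub>R y) *\<^sub>R f' (x + s *\<^sub>R y) y + frechet_derivative \<phi> (at (x + s *\<^sub>R y)) y *\<^sub>R f (x + s *\<^sub>R y)) (at s)"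
      unfolding has_vector_derivative_def
      by (simp add: linear_scale[OF lin(1)] linear_scale[OF lin(2)] scaleR_right_distrib mult.commute)
  qed (use int in auto)
  then show "(LINT x|lborel. frechet_derivative \<phi> (at x) y *\<^sub>R f x) = - (LINT x|lborel. \<phi> x *\<^sub>R f' x y)"
    using int by (simp add: add_eq_0_iff)
qed

subsection \<open>A modulated bump\<close>

definition ball_bump :: "nat \<Rightarrow> real ^ 'n \<Rightarrow> real" where
  "ball_bump n x = (max 0 (1 - x \<bullet> x)) ^ n"

lemma max_power_deriv: "((\<lambda>t::real. (max 0 t) ^ Suc (Suc n)) has_real_derivative real (Suc (Suc n)) * (max 0 t) ^ Suc n) (at t)"
proof -
  consider "t > 0" | "t < 0" | "t = 0" by linarith
  then show ?thesis
  proof cases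
    case 1
    have "((\<lambda>t. t ^ Suc (Suc n)) has_real_derivative real (Suc (Suc n)) * t ^ Suc n) (at t)"
      using DERIV_pow[of "Suc (Suc n)" t] by simp
    then have "((\<lambda>t. (max 0 t) ^ Suc (Suc n)) has_real_derivative real (Suc (Suc n)) * t ^ Suc n) (at t)"
      by (rule has_field_derivative_transform_within_open[where S="{0<..}"]) (use 1 in auto)
    then show ?thesis using 1 by simp
  next
    case 2
    have "((\<lambda>t. 0) has_real_derivative 0) (at t)" by simp
    then have "((\<lambda>t. (max 0 t) ^ Suc (Suc n)) has_real_derivative 0) (at t)"
      by (rule has_field_derivative_transform_within_open[where S="{..<0}"]) (use 2 in auto)
    then show ?thesis using 2 by simp
  next
    case 3
    have "((\<lambda>h. (max 0 h) ^ Suc n) \<longlongrightarrow> (max 0 (0::real)) ^ Suc n) (at 0)" by (intro tendsto_intros)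
    then have "((\<lambda>h. (max 0 h) ^ Suc n) \<longlongrightarrow> (0::real)) (at 0)" by simp
    then have "((\<lambda>h. ((max 0 (0 + h)) ^ Suc (Suc n) - (max 0 0) ^ Suc (Suc n)) / h) \<longlongrightarrow> (0::real)) (at 0)"
    proof (rule Lim_transform_eventually)
      show "\<forall>\<^sub>F h in at 0. (max 0 h) ^ Suc n = ((max 0 (0 + h)) ^ Suc (Suc n) - (max 0 0) ^ Suc (Suc n)) / (h::real)"
        by (auto simp: eventually_at_filter max_def)
    qed
    then show ?thesis using 3 by (simp add: DERIV_def)
  qed
qed

lemma ball_bump_derivative:
  "(ball_bump (Suc (Suc n)) has_derivative (\<lambda>h. - 2 * real (Suc (Suc n)) * ball_bump (Suc n) x * (x \<bullet> h))) (at x)"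
proof -
  have d: "((\<lambda>x. 1 - x \<bullet> x) has_derivative (\<lambda>h. - 2 * (x \<bullet> h))) (at x)"
    by (auto intro!: derivative_eq_intros simp: inner_commute)
  show ?thesis
    using has_derivative_compose[OF d max_power_deriv[of n "1 - x \<bullet> x", unfolded has_field_derivative_def]]
    unfolding ball_bump_def[abs_def] by (simp add: algebra_simps)
qed

lemma ball_bump_continuous: "continuous_on UNIV (ball_bump n)"
  unfolding ball_bump_def[abs_def] by (intro continuous_intros)

lemma ball_bump_supp: "norm x > 1 \<Longrightarrow> n > 0 \<Longrightarrow> ball_bump n x = 0"
proof -
  assume "norm x > 1" "n > 0"
  then have "x \<bullet> x > 1" by (metis one_less_power dot_square_norm zero_less_numeral)
  then show ?thesis using \<open>n > 0\<close> by (simp add: ball_bump_def)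
qed

definition wave :: "real \<Rightarrow> 'n \<Rightarrow> real ^ 'n \<Rightarrow> complex" where
  "wave \<kappa> k x = exp (\<i> * of_real (\<kappa> * x $ k))"

lemma norm_wave [simp]: "cmod (wave \<kappa> k x) = 1"
  by (simp add: wave_def)

lemma wave_derivative:
  "(wave \<kappa> k has_derivative (\<lambda>h. wave \<kappa> k x * (\<i> * of_real (\<kappa> * h $ k)))) (at x)"
proof -
  have "((\<lambda>x. \<i> * of_real (\<kappa> * x $ k)) has_derivative (\<lambda>h. \<i> * of_real (\<kappa> * h $ k))) (at x)"
    by (intro bounded_linear_imp_has_derivative bounded_linear_const_mult bounded_linear_compose[OF bounded_linear_of_real]
        bounded_linear_vec_nth)
  from has_derivative_compose[OF this DERIV_exp[unfolded has_field_derivative_def]]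
  show ?thesis unfolding wave_def[abs_def] .
qed

lemma wave_continuous: "continuous_on UNIV (wave \<kappa> k)"
  using wave_derivative by (intro continuous_at_imp_continuous_on ballI has_derivative_continuous) auto

text \<open>
  Differentiating a modulated amplitude again gives a modulated amplitude, so only the amplitudes have
  to be tracked.
\<close>

lemma modulated_wd:
  fixes a :: "real ^ 'n \<Rightarrow> complex"
  assumes a: "\<And>x. (a has_derivative a' x) (at x)" and c: "continuous_on UNIV (\<lambda>x. a' x (axis j 1))"
    and supp: "\<And>x. norm x > R \<Longrightarrow> a x = 0" "\<And>x. norm x > R \<Longrightarrow> a' x (axis j 1) = 0"
  shows "wd (axis j 1) (\<lambda>x. wave \<kappa> k x * a x)
     (\<lambda>x. wave \<kappa> k x * (a' x (axis j 1) + \<i> * of_real (if j = k then \<kappa> else 0) * a x))"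
proof -
  have ac: "continuous_on UNIV a"
    using a by (intro continuous_at_imp_continuous_on ballI has_derivative_continuous) auto
  have eq: "wave \<kappa> k x * a' x (axis j 1) + wave \<kappa> k x * (\<i> * of_real (\<kappa> * axis j 1 $ k)) * a x =
     wave \<kappa> k x * (a' x (axis j 1) + \<i> * of_real (if j = k then \<kappa> else 0) * a x)" for x
    by (simp add: axis_def algebra_simps)
  have "wd (axis j 1) (\<lambda>x. wave \<kappa> k x * a x)
     (\<lambda>x. wave \<kappa> k x * a' x (axis j 1) + wave \<kappa> k x * (\<i> * of_real (\<kappa> * axis j 1 $ k)) * a x)"
  proof (rule classical_derivative_wd[where R=R])
    show "((\<lambda>x. wave \<kappa> k x * a x) has_derivative
       (\<lambda>h. wave \<kappa> k x * a' x h + wave \<kappa> k x * (\<i> * of_real (\<kappa> * h $ k)) * a x)) (at x)" for x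
      by (rule has_derivative_mult[OF wave_derivative a])
    show "continuous_on UNIV (\<lambda>x. wave \<kappa> k x * a' x (axis j 1) + wave \<kappa> k x * (\<i> * of_real (\<kappa> * axis j 1 $ k)) * a x)"
      by (intro continuous_intros wave_continuous c ac)
  qed (use supp in auto)
  then show ?thesis unfolding eq .
qed

lemma Lp_int_pos:
  fixes f :: "real ^ 'n \<Rightarrow> complex"
  assumes [measurable]: "f \<in> borel_measurable borel" and pos: "\<And>x. norm x < 1 \<Longrightarrow> f x \<noteq> 0"
  shows "Lp_int p f > 0"
proof (rule ccontr)
  assume "\<not> Lp_int p f > 0"
  then have "AE x in lborel. ennreal (cmod (f x) powr p) = 0"
    using nn_integral_0_iff_AE[of "\<lambda>x. ennreal (cmod (f x) powr p)" lborel]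
    by (simp add: Lp_int_def zero_less_iff_neq_zero)
  then have "AE x in lborel. x \<notin> ball (0::real^'n) 1"
    by eventually_elim (use pos in auto)
  then have "ball (0::real^'n) 1 \<in> null_sets lborel"
    by (subst (asm) AE_iff_null) (auto simp: ball_def)
  then have "negligible (ball (0::real^'n) 1)"
    unfolding negligible_iff_null_sets by (rule null_sets_completionI)
  then show False using open_not_negligible[of "ball (0::real^'n) 1"] by auto
qed

text \<open>
  The functions \<open>exp (\<i> \<kappa> x\<^sub>k) (1 - \<bar>x\<bar>\<^sup>2)\<^sub>+\<^sup>3\<close> are twice continuously differentiable with compact
  support, and for large \<open>\<kappa>\<close> their frequencies concentrate, relatively, at a point of modulus \<open>\<kappa>\<close>.
\<close>

lemma wave_packets:
  shows "\<exists>M>0. \<exists>A\<ge>0. \<exists>B\<ge>0. \<forall>\<kappa>\<ge>0. \<exists>u :: real ^ 'n \<Rightarrow> complex. u \<in> H2 \<and> L2_norm u = M \<and>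
    L2_norm (weak_laplacian u) \<le> \<kappa>\<^sup>2 * M + \<kappa> * A + B \<and> \<kappa>\<^sup>2 * M\<^sup>2 \<le> grad_sq u \<and>
    (\<forall>p>0. 0 < Lp_int p u \<and> Lp_int p u < \<infinity>)"
proof -
  define k :: 'n where "k = undefined"
  let ?\<eta> = "\<lambda>x::real^'n. complex_of_real (ball_bump 3 x)"
  define d1 where "d1 i x = complex_of_real (- 6 * x $ i * ball_bump 2 x)" for i and x :: "real ^ 'n"
  define d2 where "d2 i j x = complex_of_real ((if i = j then - 6 * ball_bump 2 x else 0) + 24 * x $ i * x $ j * ball_bump 1 x)"
    for i j and x :: "real ^ 'n"
  have q3: "(ball_bump 3 has_derivative (\<lambda>h. - 6 * ball_bump 2 x * (x \<bullet> h))) (at x)" for x :: "real ^ 'n"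
    using ball_bump_derivative[of 1 x] by (simp add: numeral_eq_Suc)
  have q2: "(ball_bump 2 has_derivative (\<lambda>h. - 4 * ball_bump 1 x * (x \<bullet> h))) (at x)" for x :: "real ^ 'n"
    using ball_bump_derivative[of 0 x] by (simp add: numeral_eq_Suc)
  have \<eta>d: "(?\<eta> has_derivative (\<lambda>h. of_real (- 6 * ball_bump 2 x * (x \<bullet> h)))) (at x)" for x
    by (rule has_derivative_of_real[OF q3])
  have ia: "x \<bullet> axis i 1 = x $ i" for x :: "real ^ 'n" and i by (simp add: inner_axis)
  have \<eta>1: "of_real (- 6 * ball_bump 2 x * (x \<bullet> axis i 1)) = d1 i x" for x i by (simp add: d1_def ia)
  define d1' where "d1' i x h = complex_of_real ((- 6 * x $ i) * (- 4 * ball_bump 1 x * (x \<bullet> h)) + (- 6 * h $ i) * ball_bump 2 x)"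
    for i and x h :: "real ^ 'n"
  have d1d: "(d1 i has_derivative d1' i x) (at x)" for i x
  proof -
    have "((\<lambda>x::real^'n. - 6 * x $ i) has_derivative (\<lambda>h. - 6 * h $ i)) (at x)"
      by (intro bounded_linear_imp_has_derivative bounded_linear_const_mult bounded_linear_vec_nth)
    from has_derivative_of_real[OF has_derivative_mult[OF this q2]]
    show ?thesis unfolding d1_def[abs_def] d1'_def[abs_def] .
  qed
  have ax: "axis j (1::real) $ i = (if i = j then 1 else 0)" for i j :: 'n by (simp add: axis_def)
  have d12: "d1' i x (axis j 1) = d2 i j x" for i j x
    unfolding d1'_def d2_def ia ax by (simp add: algebra_simps)
  have cont: "continuous_on UNIV ?\<eta>" "continuous_on UNIV (d1 i)" "continuous_on UNIV (d2 i j)" for i j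
    unfolding d1_def[abs_def] d2_def[abs_def]
    by (intro continuous_intros ball_bump_continuous; cases "i = j"; simp; intro continuous_intros ball_bump_continuous)+
  have supp: "norm x > 1 \<Longrightarrow> ?\<eta> x = 0" "norm x > 1 \<Longrightarrow> d1 i x = 0" "norm x > 1 \<Longrightarrow> d2 i j x = 0" for x i j
    by (auto simp: ball_bump_supp d1_def d2_def)
  have L: "?\<eta> \<in> L2" "d1 i \<in> L2" "d2 i j \<in> L2" for i j
    using continuous_compact_support_integrable(2)[OF cont(1) supp(1)] continuous_compact_support_integrable(2)[OF cont(2) supp(2)]
      continuous_compact_support_integrable(2)[OF cont(3) supp(3)] by auto
  have Ls: "(\<lambda>x. \<Sum>i\<in>UNIV. d2 i i x) \<in> L2" by (intro L2_sum L)
  define M where "M = L2_norm ?\<eta>"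
  define A where "A = 2 * L2_norm (d1 k)"
  define B where "B = L2_norm (\<lambda>x. \<Sum>i\<in>UNIV. d2 i i x)"
  have \<eta>pos: "ball_bump 3 x \<noteq> 0" if "norm x < 1" for x :: "real ^ 'n"
  proof -
    have "x \<bullet> x < 1" using that by (simp add: dot_square_norm power_less_one_iff abs_square_less_1)
    then show ?thesis by (simp add: ball_bump_def)
  qed
  have "Lp_int 2 ?\<eta> > 0"
    using \<eta>pos by (intro Lp_int_pos borel_measurable_continuous_onI cont) auto
  then have "ennreal (M\<^sup>2) > 0"
    using L2_norm_sq_nn[OF L(1)] by (simp add: Lp_int_def M_def)
  then have M: "M > 0" using L2_norm_nonneg[of ?\<eta>] by (auto simp: M_def less_le)
  have "\<exists>u :: real ^ 'n \<Rightarrow> complex. u \<in> H2 \<and> L2_norm u = M \<and>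
    L2_norm (weak_laplacian u) \<le> \<kappa>\<^sup>2 * M + \<kappa> * A + B \<and> \<kappa>\<^sup>2 * M\<^sup>2 \<le> grad_sq u \<and>
    (\<forall>p>0. 0 < Lp_int p u \<and> Lp_int p u < \<infinity>)" if \<kappa>: "\<kappa> \<ge> 0" for \<kappa>
  proof -
    let ?\<delta> = "\<lambda>i. \<i> * complex_of_real (if i = k then \<kappa> else 0)"
    define u where "u x = wave \<kappa> k x * ?\<eta> x" for x
    \<comment> \<open>Amplitudes of the first and second derivatives of \<open>u\<close>, with the wave factored out.\<close>
    define a1 where "a1 i x = d1 i x + ?\<delta> i * ?\<eta> x" for i x
    define g where "g i x = wave \<kappa> k x * a1 i x" for i x
    define a2 where "a2 i j x = d2 i j x + ?\<delta> i * d1 j x + ?\<delta> j * a1 i x" for i j x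
    define h where "h i j x = wave \<kappa> k x * a2 i j x" for i j x
    have w1: "wd (axis i 1) u (g i)" for i
    proof -
      have "wd (axis i 1) (\<lambda>x. wave \<kappa> k x * ?\<eta> x)
        (\<lambda>x. wave \<kappa> k x * (of_real (- 6 * ball_bump 2 x * (x \<bullet> axis i 1)) + ?\<delta> i * ?\<eta> x))"
      proof (rule modulated_wd[OF \<eta>d, where R=1])
        show "continuous_on UNIV (\<lambda>x. complex_of_real (- 6 * ball_bump 2 x * (x \<bullet> axis i 1)))"
          unfolding \<eta>1 by (rule cont)
        show "complex_of_real (- 6 * ball_bump 2 x * (x \<bullet> axis i 1)) = 0" if "norm x > 1" for x
          unfolding \<eta>1 using supp that by simp
      qed (use supp in auto)
      then show ?thesis unfolding \<eta>1 u_def[abs_def] g_def[abs_def] a1_def .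
    qed
    have a1d: "(a1 i has_derivative (\<lambda>h. d1' i x h + ?\<delta> i * of_real (- 6 * ball_bump 2 x * (x \<bullet> h)))) (at x)" for i x
      unfolding a1_def[abs_def] by (intro has_derivative_add d1d has_derivative_mult_right \<eta>d)
    have w2: "wd (axis j 1) (g i) (h i j)" for i j
    proof -
      have "wd (axis j 1) (\<lambda>x. wave \<kappa> k x * a1 i x)
        (\<lambda>x. wave \<kappa> k x * ((d1' i x (axis j 1) + ?\<delta> i * of_real (- 6 * ball_bump 2 x * (x \<bullet> axis j 1))) + ?\<delta> j * a1 i x))"
      proof (rule modulated_wd[OF a1d, where R=1])
        show "continuous_on UNIV (\<lambda>x. d1' i x (axis j 1) + ?\<delta> i * of_real (- 6 * ball_bump 2 x * (x \<bullet> axis j 1)))"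
          unfolding \<eta>1 d12 by (intro continuous_intros cont)
        show "a1 i x = 0" if "norm x > 1" for x using supp that by (simp add: a1_def)
        show "d1' i x (axis j 1) + ?\<delta> i * of_real (- 6 * ball_bump 2 x * (x \<bullet> axis j 1)) = 0" if "norm x > 1" for x
          unfolding \<eta>1 d12 using supp that by simp
      qed
      then show ?thesis unfolding \<eta>1 d12 g_def[abs_def] h_def[abs_def] a2_def .
    qed
    note H = H2_I[OF w1 w2]
    have u: "u \<in> H2" by (rule H(1))
    have nu: "L2_norm u = M" by (simp add: L2_norm_def u_def M_def norm_mult)
    have "AE x in lborel. \<forall>i\<in>UNIV. weak_pd i (weak_pd i u) x = h i i x"
      by (rule AE_finite_allI) (use H(3) in auto)
    then have lap: "AE x in lborel. weak_laplacian u x = (\<Sum>i\<in>UNIV. h i i x)"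
      by eventually_elim (simp add: weak_laplacian_def)
    have hs: "(\<Sum>i\<in>UNIV. h i i x) = wave \<kappa> k x * ((\<Sum>i\<in>UNIV. d2 i i x) + 2 * \<i> * of_real \<kappa> * d1 k x - of_real (\<kappa>\<^sup>2) * ?\<eta> x)" for x
    proof -
      have "a2 i i x = d2 i i x + (if i = k then 2 * \<i> * of_real \<kappa> * d1 k x - of_real (\<kappa>\<^sup>2) * ?\<eta> x else 0)" for i
        by (simp add: a2_def a1_def algebra_simps power2_eq_square)
      then have "(\<Sum>i\<in>UNIV. a2 i i x) = (\<Sum>i\<in>UNIV. d2 i i x) + (2 * \<i> * of_real \<kappa> * d1 k x - of_real (\<kappa>\<^sup>2) * ?\<eta> x)"
        by (simp add: sum.distrib)
      then show ?thesis by (simp add: h_def sum_distrib_left[symmetric])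
    qed
    have hL: "(\<lambda>x. \<Sum>i\<in>UNIV. h i i x) \<in> L2" using wd_L2(2)[OF w2] by (intro L2_sum) auto
    have "L2_norm (weak_laplacian u) = L2_norm (\<lambda>x. \<Sum>i\<in>UNIV. h i i x)"
      by (rule L2_norm_cong_AE[OF L2_measurable[OF H2_L2(4)[OF u]] L2_measurable[OF hL] lap])
    also have "\<dots> = L2_norm (\<lambda>x. (\<Sum>i\<in>UNIV. d2 i i x) + 2 * \<i> * of_real \<kappa> * d1 k x - of_real (\<kappa>\<^sup>2) * ?\<eta> x)"
      unfolding hs by (simp add: L2_norm_def norm_mult)
    also have "\<dots> \<le> L2_norm (\<lambda>x. (\<Sum>i\<in>UNIV. d2 i i x) + 2 * \<i> * of_real \<kappa> * d1 k x) + L2_norm (\<lambda>x. of_real (\<kappa>\<^sup>2) * ?\<eta> x)"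
    proof (rule L2_norm_triangle_diff)
      have mL: "(\<lambda>x. c * f x) \<in> L2" if "f \<in> L2" for c :: complex and f :: "real ^ 'n \<Rightarrow> complex"
        using that by (auto simp: L2_def norm_mult power_mult_distrib intro!: integrable_mult_right)
      show "(\<lambda>x. (\<Sum>i\<in>UNIV. d2 i i x) + 2 * \<i> * of_real \<kappa> * d1 k x) \<in> L2" "(\<lambda>x. of_real (\<kappa>\<^sup>2) * ?\<eta> x) \<in> L2"
        by (intro L2_add Ls mL L)+
    qed
    also have "L2_norm (\<lambda>x. (\<Sum>i\<in>UNIV. d2 i i x) + 2 * \<i> * of_real \<kappa> * d1 k x) \<le> B + L2_norm (\<lambda>x. 2 * \<i> * of_real \<kappa> * d1 k x)"
      unfolding B_def
    proof (rule L2_norm_triangle[OF Ls])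
      show "(\<lambda>x. 2 * \<i> * of_real \<kappa> * d1 k x) \<in> L2"
        using L(2)[of k] by (auto simp: L2_def norm_mult power_mult_distrib intro!: integrable_mult_right)
    qed
    also have "L2_norm (\<lambda>x. 2 * \<i> * of_real \<kappa> * d1 k x) = L2_norm (\<lambda>x. (2 * \<kappa>) *\<^sub>R d1 k x)"
      by (simp add: L2_norm_def norm_mult abs_mult)
    also have "\<dots> = \<kappa> * A" unfolding L2_norm_scale using \<kappa> by (simp add: A_def)
    also have "L2_norm (\<lambda>x. of_real (\<kappa>\<^sup>2) * ?\<eta> x) = L2_norm (\<lambda>x. \<kappa>\<^sup>2 *\<^sub>R ?\<eta> x)"
      by (simp add: L2_norm_def norm_mult norm_power)
    also have "\<dots> = \<kappa>\<^sup>2 * M" unfolding L2_norm_scale by (simp add: M_def)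
    finally have D: "L2_norm (weak_laplacian u) \<le> \<kappa>\<^sup>2 * M + \<kappa> * A + B" by simp
    have "\<kappa>\<^sup>2 * M\<^sup>2 \<le> (L2_norm (g k))\<^sup>2"
    proof -
      have "\<kappa>\<^sup>2 * M\<^sup>2 = (L2_norm (\<lambda>x. \<kappa> *\<^sub>R ?\<eta> x))\<^sup>2" unfolding L2_norm_scale by (simp add: M_def power_mult_distrib)
      also have "\<dots> \<le> (L2_norm (g k))\<^sup>2"
        unfolding L2_norm_sq
      proof (rule integral_mono)
        show "integrable lborel (\<lambda>x. (cmod (\<kappa> *\<^sub>R ?\<eta> x))\<^sup>2)" by (intro L2_integrable_square L2_scaleR L)
        show "integrable lborel (\<lambda>x. (cmod (g k x))\<^sup>2)" by (intro L2_integrable_square wd_L2(2)[OF w1])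
        fix x
        have "(cmod (g k x))\<^sup>2 = (cmod (a1 k x))\<^sup>2" by (simp add: g_def norm_mult)
        also have "\<dots> = (- 6 * x $ k * ball_bump 2 x)\<^sup>2 + (\<kappa> * ball_bump 3 x)\<^sup>2"
          by (simp add: a1_def d1_def cmod_power2)
        finally show "(cmod (\<kappa> *\<^sub>R ?\<eta> x))\<^sup>2 \<le> (cmod (g k x))\<^sup>2" by (simp add: power_mult_distrib norm_mult)
      qed
      finally show ?thesis .
    qed
    also have "L2_norm (g k) = L2_norm (weak_pd k u)"
    proof (rule L2_norm_cong_AE)
      show "AE x in lborel. g k x = weak_pd k u x" using H(2)[of k] by eventually_elim simp
    qed (intro L2_measurable wd_L2(2)[OF w1] H2_L2(2) u)+
    also have "(L2_norm (weak_pd k u))\<^sup>2 \<le> grad_sq u"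
      unfolding grad_sq_eq[OF u] by (rule member_le_sum) auto
    finally have G: "\<kappa>\<^sup>2 * M\<^sup>2 \<le> grad_sq u" .
    have eqL: "Lp_int p u = Lp_int p ?\<eta>" for p by (simp add: Lp_int_def u_def norm_mult)
    have "0 < Lp_int p u \<and> Lp_int p u < \<infinity>" if "p > 0" for p
      unfolding eqL using \<eta>pos continuous_compact_support_integrable(3)[OF cont(1) supp(1) that]
      by (auto intro!: Lp_int_pos borel_measurable_continuous_onI cont)
    then show ?thesis using u nu D G by blast
  qed
  moreover have "A \<ge> 0" "B \<ge> 0" by (auto simp: A_def B_def)
  ultimately show ?thesis using M by blast
qed

section \<open>Scaling of the energy\<close>

abbreviation mass :: "(real ^ 'n \<Rightarrow> complex) \<Rightarrow> real" where "mass u \<equiv> (L2_norm u)\<^sup>2"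

abbreviation lap :: "(real ^ 'n \<Rightarrow> complex) \<Rightarrow> real" where "lap u \<equiv> L2_norm (weak_laplacian u)"

lemma energy_eq:
  fixes u :: "real ^ 'n \<Rightarrow> complex"
  assumes "u \<in> H2"
  shows "energy \<sigma> u = (if Lp_int (2 * \<sigma> + 2) u < \<infinity>
    then ereal ((lap u)\<^sup>2 - 2 * grad_sq u - 1 / (\<sigma> + 1) * enn2real (Lp_int (2 * \<sigma> + 2) u)) else - \<infinity>)"
proof -
  have [measurable]: "u \<in> borel_measurable borel" by (rule L2_measurable[OF H2_L2(1)[OF assms]])
  have "integrable lborel (\<lambda>x. cmod (u x) powr (2 * \<sigma> + 2)) \<longleftrightarrow> Lp_int (2 * \<sigma> + 2) u < \<infinity>"
    by (simp add: integrable_iff_bounded Lp_int_def)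
  moreover have "(LINT x|lborel. cmod (u x) powr (2 * \<sigma> + 2)) = enn2real (Lp_int (2 * \<sigma> + 2) u)"
    unfolding Lp_int_def by (rule integral_eq_nn_integral) auto
  ultimately show ?thesis by (simp add: energy_def L2_norm_sq grad_sq_def)
qed

lemma energy_lower:
  assumes "u \<in> H2" "\<sigma> > 0" "Lp_int (2 * \<sigma> + 2) u \<le> ennreal K" "K \<ge> 0"
  shows "ereal ((lap u)\<^sup>2 - 2 * (L2_norm u * lap u) - K / (\<sigma> + 1)) \<le> energy \<sigma> u"
proof -
  have "Lp_int (2 * \<sigma> + 2) u < \<infinity>" using assms(3) by (auto intro: le_less_trans)
  moreover have "enn2real (Lp_int (2 * \<sigma> + 2) u) \<le> K"
    using assms(3,4) by (simp add: enn2real_leI)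
  then have "1 / (\<sigma> + 1) * enn2real (Lp_int (2 * \<sigma> + 2) u) \<le> K / (\<sigma> + 1)"
    using assms(2) by (simp add: divide_right_mono)
  ultimately show ?thesis using grad_sq_le[OF assms(1)] by (simp add: energy_eq[OF assms(1)])
qed

lemma E_min_le:
  fixes u :: "real ^ 'n \<Rightarrow> complex"
  assumes "u \<in> H2" "mass u = m"
  shows "E_min TYPE('n) \<sigma> m \<le> energy \<sigma> u"
  unfolding E_min_def by (rule INF_lower) (use assms in auto)

lemma powr_scaling:
  fixes l :: real
  assumes l: "l > 0" and c: "c > 0"
  shows "(sqrt (c * l ^ n)) powr (2 * \<sigma> + 2) / l ^ n = c powr (\<sigma> + 1) * l powr (\<sigma> * real n)"
proof -
  have "sqrt (c * l ^ n) = (c * l powr real n) powr (1 / 2)"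
    using l c by (simp add: powr_half_sqrt powr_realpow)
  then have "(sqrt (c * l ^ n)) powr (2 * \<sigma> + 2) = (c * l powr real n) powr (\<sigma> + 1)"
    by (simp add: powr_powr algebra_simps)
  also have "\<dots> = c powr (\<sigma> + 1) * l powr (real n * (\<sigma> + 1))"
    using l c by (simp add: powr_mult powr_powr)
  also have "l powr (real n * (\<sigma> + 1)) = l powr (\<sigma> * real n) * l ^ n"
    using l by (simp add: powr_realpow[symmetric] powr_add[symmetric] algebra_simps)
  finally show ?thesis using l by simp
qed

text \<open>Any nonzero element of \<open>H2\<close> can be given mass \<open>m\<close>, at any length scale \<open>1 / l\<close>.\<close>

lemma E_min_le_scaled:
  fixes u :: "real ^ 'n \<Rightarrow> complex"
  assumes u: "u \<in> H2" and M: "L2_norm u > 0" and fin: "Lp_int (2 * \<sigma> + 2) u < \<infinity>" and m: "m > 0" and l: "l > 0"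
  shows "E_min TYPE('n) \<sigma> m \<le> ereal (m / mass u * (l ^ 4 * (lap u)\<^sup>2 - 2 * l\<^sup>2 * grad_sq u)
    - 1 / (\<sigma> + 1) * ((m / mass u) powr (\<sigma> + 1) * l powr (\<sigma> * real CARD('n)) * enn2real (Lp_int (2 * \<sigma> + 2) u)))"
proof -
  define c where "c = m / mass u"
  have c: "c > 0" using m M by (simp add: c_def)
  define a where "a = sqrt (c * l ^ CARD('n))"
  have a: "a\<^sup>2 = c * l ^ CARD('n)" "a \<ge> 0" using c l by (auto simp: a_def)
  have meas: "u \<in> borel_measurable borel" by (rule L2_measurable[OF H2_L2(1)[OF u]])
  let ?v = "dil a l u"
  have v: "?v \<in> H2" by (rule dil_H2(1)[OF u l])
  have "mass ?v = m" using L2_norm_dil[OF H2_L2(1)[OF u] l, of a] M l by (simp add: a c_def)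
  then have 1: "E_min TYPE('n) \<sigma> m \<le> energy \<sigma> ?v" by (rule E_min_le[OF v])
  have P: "Lp_int (2 * \<sigma> + 2) ?v = ennreal (c powr (\<sigma> + 1) * l powr (\<sigma> * real CARD('n))) * Lp_int (2 * \<sigma> + 2) u"
    unfolding Lp_int_dil[OF meas l a(2)] by (simp only: a_def powr_scaling[OF l c])
  then have "Lp_int (2 * \<sigma> + 2) ?v < \<infinity>" using fin by (simp add: ennreal_mult_less_top)
  moreover have "enn2real (Lp_int (2 * \<sigma> + 2) ?v) = c powr (\<sigma> + 1) * l powr (\<sigma> * real CARD('n)) * enn2real (Lp_int (2 * \<sigma> + 2) u)"
    unfolding P by (simp add: enn2real_mult)
  moreover have "(lap ?v)\<^sup>2 = c * l ^ 4 * (lap u)\<^sup>2" "grad_sq ?v = c * l\<^sup>2 * grad_sq u"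
    using l unfolding L2_norm_laplacian_dil[OF u l] grad_sq_dil[OF u l] a by simp_all
  ultimately have "energy \<sigma> ?v = ereal (c * (l ^ 4 * (lap u)\<^sup>2 - 2 * l\<^sup>2 * grad_sq u)
    - 1 / (\<sigma> + 1) * (c powr (\<sigma> + 1) * l powr (\<sigma> * real CARD('n)) * enn2real (Lp_int (2 * \<sigma> + 2) u)))"
    by (simp add: energy_eq[OF v] algebra_simps)
  then show ?thesis using 1 by (simp add: c_def)
qed

text \<open>
  The two free parameters of a dilation are fixed by \<open>M = D = 1\<close>; \<open>P\<close> then changes by the factor that makes
  the Gagliardo--Nirenberg quotient invariant.
\<close>

lemma normalise:
  fixes u :: "real ^ 'n \<Rightarrow> complex"
  assumes u: "u \<in> H2" and M: "L2_norm u > 0" and D: "lap u > 0"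
  obtains v :: "real ^ 'n \<Rightarrow> complex" where "v \<in> H2" "L2_norm v = 1" "lap v = 1"
    "Lp_int (2 * \<sigma> + 2) u = ennreal (lap u powr (\<sigma> * real CARD('n) / 2) *
       L2_norm u powr (2 + 2 * \<sigma> - \<sigma> * real CARD('n) / 2)) * Lp_int (2 * \<sigma> + 2) v"
proof -
  define M where "M = L2_norm u"
  define D where "D = lap u"
  have pos: "M > 0" "D > 0" using assms by (auto simp: M_def D_def)
  define c where "c = 1 / M\<^sup>2"
  \<comment> \<open>Solves \<open>l\<^sup>2 D / M = 1\<close>.\<close>
  define l where "l = sqrt (M / D)"
  have l: "l > 0" and c: "c > 0" using pos by (auto simp: l_def c_def)
  have l2: "l\<^sup>2 = M / D" using pos by (simp add: l_def)
  have l4: "l ^ 4 = (M / D)\<^sup>2" using l2 by (metis numeral_Bit0 power_add power2_eq_square)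
  define a where "a = sqrt (c * l ^ CARD('n))"
  have a: "a\<^sup>2 = c * l ^ CARD('n)" "a \<ge> 0" using c l by (auto simp: a_def)
  have meas: "u \<in> borel_measurable borel" by (rule L2_measurable[OF H2_L2(1)[OF u]])
  let ?v = "dil a l u" and ?q = "\<sigma> * real CARD('n) / 2"
  have "mass ?v = 1"
    using L2_norm_dil[OF H2_L2(1)[OF u] l, of a] pos l by (simp add: a c_def M_def[symmetric])
  then have Mv: "L2_norm ?v = 1" using L2_norm_nonneg[of ?v] by (simp add: power2_eq_1_iff)
  have "(lap ?v)\<^sup>2 = 1"
    unfolding L2_norm_laplacian_dil[OF u l] a l4 using pos l by (simp add: c_def D_def[symmetric] power_divide)
  then have Dv: "lap ?v = 1" using L2_norm_nonneg[of "weak_laplacian ?v"] by (simp add: power2_eq_1_iff)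
  define b where "b = c powr (\<sigma> + 1) * l powr (\<sigma> * real CARD('n))"
  have P: "Lp_int (2 * \<sigma> + 2) ?v = ennreal b * Lp_int (2 * \<sigma> + 2) u"
    unfolding Lp_int_dil[OF meas l a(2)] by (simp only: a_def b_def powr_scaling[OF l c])
  have b: "b * (D powr ?q * M powr (2 + 2 * \<sigma> - ?q)) = 1"
  proof -
    have "c powr (\<sigma> + 1) = M powr - (2 + 2 * \<sigma>)"
    proof -
      have "c = M powr - 2" using pos by (simp add: c_def powr_neg_numeral)
      then show ?thesis by (simp add: powr_powr algebra_simps)
    qed
    moreover have "l powr (\<sigma> * real CARD('n)) = M powr ?q * D powr - ?q"
    proof -
      have "l = (M / D) powr (1 / 2)" using pos by (simp add: l_def powr_half_sqrt)
      then have "l powr (\<sigma> * real CARD('n)) = (M / D) powr ?q" by (simp add: powr_powr)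
      also have "\<dots> = M powr ?q * D powr - ?q" using pos by (simp add: powr_divide powr_minus_divide)
      finally show ?thesis .
    qed
    ultimately have "b * (D powr ?q * M powr (2 + 2 * \<sigma> - ?q)) =
       (M powr - (2 + 2 * \<sigma>) * M powr ?q * M powr (2 + 2 * \<sigma> - ?q)) * (D powr - ?q * D powr ?q)"
      by (simp add: b_def mult_ac)
    also have "\<dots> = 1" using pos by (simp add: powr_add[symmetric])
    finally show ?thesis .
  qed
  have "Lp_int (2 * \<sigma> + 2) u = ennreal (b * (D powr ?q * M powr (2 + 2 * \<sigma> - ?q))) * Lp_int (2 * \<sigma> + 2) u"
    unfolding b by simp
  also have "\<dots> = ennreal (D powr ?q * M powr (2 + 2 * \<sigma> - ?q)) * Lp_int (2 * \<sigma> + 2) ?v"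
    unfolding P by (simp add: b_def ennreal_mult mult_ac)
  finally show ?thesis using that[OF dil_H2(1)[OF u l] Mv Dv] by (simp add: M_def D_def)
qed

subsection \<open>The Gagliardo--Nirenberg inequality in homogeneous form\<close>

lemma L2_norm_eq_0_iff:
  assumes "u \<in> L2" shows "L2_norm u = 0 \<longleftrightarrow> (AE x in lborel. u x = 0)"
proof -
  have "L2_norm u = 0 \<longleftrightarrow> (LINT x|lborel. (cmod (u x))\<^sup>2) = 0" by (simp add: L2_norm_def)
  also have "\<dots> \<longleftrightarrow> (AE x in lborel. (cmod (u x))\<^sup>2 = 0)"
    by (rule integral_nonneg_eq_0_iff_AE[OF L2_integrable_square[OF assms]]) auto
  finally show ?thesis by simp
qed

lemma Lp_int_eq_0_iff:
  fixes u :: "real ^ 'n \<Rightarrow> complex"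
  assumes [measurable]: "u \<in> borel_measurable borel" shows "Lp_int p u = 0 \<longleftrightarrow> (AE x in lborel. u x = 0)"
  unfolding Lp_int_def by (subst nn_integral_0_iff_AE) auto

lemma exponent_admissible:
  assumes "\<sigma> > 0" "\<sigma> * real CARD('n::finite) \<le> 4"
  shows "2 < 2 * \<sigma> + 2" "2 * \<sigma> + 2 < 2 + 8 / real CARD('n) + 16 / (real CARD('n))\<^sup>2"
proof -
  have N: "real CARD('n) > 0" by simp
  have "2 * \<sigma> \<le> 8 / real CARD('n)" using assms N by (simp add: field_simps)
  moreover have "16 / (real CARD('n))\<^sup>2 > 0" using N by simp
  ultimately show "2 * \<sigma> + 2 < 2 + 8 / real CARD('n) + 16 / (real CARD('n))\<^sup>2" by linarith
qed (use assms in simp)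

text \<open>
  A harmonic \<open>u\<close> of mass \<open>1\<close> could be concentrated at will, its \<open>L\<^sup>p\<close> norms growing without bound
  while its mass and its Laplacian stay the same, against \<open>Lp_bounded\<close>.
\<close>

lemma laplacian_pos:
  fixes u :: "real ^ 'n \<Rightarrow> complex"
  assumes u: "u \<in> H2" and M: "L2_norm u > 0"
  shows "lap u > 0"
proof (rule ccontr)
  assume "\<not> lap u > 0"
  then have D: "lap u = 0" using L2_norm_nonneg[of "weak_laplacian u"] by linarith
  \<comment> \<open>An auxiliary exponent at which the \<open>L\<^sup>p\<close> norms are bounded.\<close>
  define \<sigma> where "\<sigma> = 4 / real CARD('n)"
  have \<sigma>: "\<sigma> > 0" "\<sigma> * real CARD('n) = 4" by (auto simp: \<sigma>_def)
  obtain C where C: "C > 0" "\<And>u :: real ^ 'n \<Rightarrow> complex. u \<in> H2 \<Longrightarrow> L2_norm u \<le> 1 \<Longrightarrow> lap u \<le> 1 \<Longrightarrow> Lp_int (2 * \<sigma> + 2) u \<le> ennreal C"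
    using Lp_bounded[of "2 * \<sigma> + 2"] exponent_admissible[OF \<sigma>(1), where 'n='n] \<sigma> by fastforce
  have meas: "u \<in> borel_measurable borel" by (rule L2_measurable[OF H2_L2(1)[OF u]])
  define c where "c = 1 / mass u"
  have c: "c > 0" using M by (simp add: c_def)
  have bound: "ennreal (c powr (\<sigma> + 1) * l powr 4) * Lp_int (2 * \<sigma> + 2) u \<le> ennreal C" if l: "l > 0" for l
  proof -
    define a where "a = sqrt (c * l ^ CARD('n))"
    have a: "a\<^sup>2 = c * l ^ CARD('n)" "a \<ge> 0" using c l by (auto simp: a_def)
    have "mass (dil a l u) = 1" using L2_norm_dil[OF H2_L2(1)[OF u] l, of a] M l by (simp add: a c_def)
    then have "L2_norm (dil a l u) = 1" using L2_norm_nonneg[of "dil a l u"] by (simp add: power2_eq_1_iff)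
    moreover have "lap (dil a l u) = 0" using L2_norm_laplacian_dil[OF u l, of a] D by simp
    ultimately have "Lp_int (2 * \<sigma> + 2) (dil a l u) \<le> ennreal C" by (intro C(2) dil_H2(1)[OF u l]) auto
    then show ?thesis
      unfolding Lp_int_dil[OF meas l a(2)] unfolding a_def powr_scaling[OF l c] \<sigma>(2) .
  qed
  have "Lp_int (2 * \<sigma> + 2) u = 0"
  proof (cases "Lp_int (2 * \<sigma> + 2) u")
    case (real q)
    show ?thesis
    proof (rule ccontr)
      assume "Lp_int (2 * \<sigma> + 2) u \<noteq> 0"
      then have q: "q > 0" using real by (auto simp: less_le)
      define e where "e = c powr (\<sigma> + 1) * q"
      have e: "e > 0" using q c by (simp add: e_def)
      define l where "l = ((C + 1) / e) powr (1 / 4)"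
      have l: "l > 0" "l powr 4 = (C + 1) / e" using C e by (auto simp: l_def powr_powr)
      have "ennreal (c powr (\<sigma> + 1) * l powr 4 * q) \<le> ennreal C"
        using bound[OF l(1)] real by (simp add: ennreal_mult)
      then have "c powr (\<sigma> + 1) * l powr 4 * q \<le> C" using C by (subst (asm) ennreal_le_iff) auto
      moreover have "c powr (\<sigma> + 1) * l powr 4 * q = e * l powr 4" by (simp add: e_def mult_ac)
      ultimately show False using l e by simp
    qed
  next
    case top
    then show ?thesis using bound[of 1] c by (simp add: ennreal_mult_top top_unique)
  qed
  then have "AE x in lborel. u x = 0" by (simp add: Lp_int_eq_0_iff[OF meas])
  then show False using L2_norm_eq_0_iff[OF H2_L2(1)[OF u]] M by simp
qed

lemma gagliardo_nirenberg:
  assumes \<sigma>: "\<sigma> > 0" "\<sigma> * real CARD('n::finite) \<le> 4"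
  obtains B where "B > 0" "\<And>u :: real ^ 'n \<Rightarrow> complex. u \<in> H2 \<Longrightarrow> Lp_int (2 * \<sigma> + 2) u \<le>
    ennreal (B * (lap u powr (\<sigma> * real CARD('n) / 2) * L2_norm u powr (2 + 2 * \<sigma> - \<sigma> * real CARD('n) / 2)))"
proof -
  obtain C where C: "C > 0" "\<And>u :: real ^ 'n \<Rightarrow> complex. u \<in> H2 \<Longrightarrow> L2_norm u \<le> 1 \<Longrightarrow> lap u \<le> 1 \<Longrightarrow> Lp_int (2 * \<sigma> + 2) u \<le> ennreal C"
    using Lp_bounded[of "2 * \<sigma> + 2"] exponent_admissible[OF \<sigma>] by fastforce
  show ?thesis
  proof (rule that[OF C(1)])
    fix u :: "real ^ 'n \<Rightarrow> complex" assume u: "u \<in> H2"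
    have meas: "u \<in> borel_measurable borel" by (rule L2_measurable[OF H2_L2(1)[OF u]])
    let ?d = "lap u powr (\<sigma> * real CARD('n) / 2) * L2_norm u powr (2 + 2 * \<sigma> - \<sigma> * real CARD('n) / 2)"
    show "Lp_int (2 * \<sigma> + 2) u \<le> ennreal (C * ?d)"
    proof (cases "L2_norm u = 0")
      case True
      then have "Lp_int (2 * \<sigma> + 2) u = 0" using L2_norm_eq_0_iff[OF H2_L2(1)[OF u]] Lp_int_eq_0_iff[OF meas] by simp
      then show ?thesis by simp
    next
      case False
      then have M: "L2_norm u > 0" using L2_norm_nonneg[of u] by linarith
      obtain v :: "real ^ 'n \<Rightarrow> complex" where v: "v \<in> H2" "L2_norm v = 1" "lap v = 1"
        "Lp_int (2 * \<sigma> + 2) u = ennreal ?d * Lp_int (2 * \<sigma> + 2) v"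
        by (rule normalise[OF u M laplacian_pos[OF u M]])
      have "Lp_int (2 * \<sigma> + 2) u \<le> ennreal ?d * ennreal C"
        unfolding v(4) by (intro mult_left_mono C(2) v(1)) (use v in auto)
      also have "\<dots> = ennreal (C * ?d)" using C by (simp add: ennreal_mult[symmetric] mult.commute)
      finally show ?thesis .
    qed
  qed
qed

section \<open>Upper bounds for the minimal energy\<close>

lemma exists_H2_element:
  obtains u :: "real ^ 'n \<Rightarrow> complex" where "u \<in> H2" "L2_norm u > 0" "\<And>p. p > 0 \<Longrightarrow> 0 < Lp_int p u \<and> Lp_int p u < \<infinity>"
proof -
  obtain M A B where "M > 0" and *: "\<forall>\<kappa>\<ge>0. \<exists>u :: real ^ 'n \<Rightarrow> complex. u \<in> H2 \<and> L2_norm u = M \<and>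
    L2_norm (weak_laplacian u) \<le> \<kappa>\<^sup>2 * M + \<kappa> * A + B \<and> \<kappa>\<^sup>2 * M\<^sup>2 \<le> grad_sq u \<and>
    (\<forall>p>0. 0 < Lp_int p u \<and> Lp_int p u < \<infinity>)" using wave_packets[where 'n='n] by blast
  from *[rule_format, of 0] \<open>M > 0\<close> show ?thesis using that by auto
qed

text \<open>
  A wave packet of frequency \<open>\<kappa>\<close>, dilated by \<open>t = 1 / \<kappa>\<close>, has its frequencies near the unit sphere, where the
  symbol \<open>\<bar>\<xi>\<bar>\<^sup>4 - 2 \<bar>\<xi>\<bar>\<^sup>2\<close> is close to \<open>-1\<close>. The potential term only lowers the energy.
\<close>

lemma E_min_le_minus_mass:
  assumes \<sigma>: "\<sigma> > 0" and m: "m > 0"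
  shows "E_min TYPE('n::finite) \<sigma> m \<le> ereal (- m)"
proof -
  obtain M A B where M: "M > 0" and AB: "A \<ge> 0" "B \<ge> 0" and *: "\<forall>\<kappa>\<ge>0. \<exists>u :: real ^ 'n \<Rightarrow> complex. u \<in> H2 \<and> L2_norm u = M \<and>
    L2_norm (weak_laplacian u) \<le> \<kappa>\<^sup>2 * M + \<kappa> * A + B \<and> \<kappa>\<^sup>2 * M\<^sup>2 \<le> grad_sq u \<and>
    (\<forall>p>0. 0 < Lp_int p u \<and> Lp_int p u < \<infinity>)" using wave_packets[where 'n='n] by blast
  define f where "f t = m / M\<^sup>2 * ((M + t * A + t\<^sup>2 * B)\<^sup>2 - 2 * M\<^sup>2)" for t
  have le: "E_min TYPE('n) \<sigma> m \<le> ereal (f t)" if t: "t > 0" for t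
  proof -
    define \<kappa> where "\<kappa> = 1 / t"
    have \<kappa>: "\<kappa> \<ge> 0" "t * \<kappa> = 1" using t by (auto simp: \<kappa>_def)
    obtain u :: "real ^ 'n \<Rightarrow> complex" where u: "u \<in> H2" "L2_norm u = M" "lap u \<le> \<kappa>\<^sup>2 * M + \<kappa> * A + B"
      "\<kappa>\<^sup>2 * M\<^sup>2 \<le> grad_sq u" "\<forall>p>0. 0 < Lp_int p u \<and> Lp_int p u < \<infinity>" using *[rule_format, OF \<kappa>(1)] by blast
    have 1: "t ^ 4 * (lap u)\<^sup>2 \<le> (M + t * A + t\<^sup>2 * B)\<^sup>2"
    proof -
      have "t\<^sup>2 * lap u \<le> t\<^sup>2 * (\<kappa>\<^sup>2 * M + \<kappa> * A + B)" by (intro mult_left_mono u) simp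
      also have "\<dots> = (t * \<kappa>)\<^sup>2 * M + t * (t * \<kappa>) * A + t\<^sup>2 * B"
        by (simp add: power2_eq_square algebra_simps)
      finally have "t\<^sup>2 * lap u \<le> M + t * A + t\<^sup>2 * B" using \<kappa> by simp
      then have "(t\<^sup>2 * lap u)\<^sup>2 \<le> (M + t * A + t\<^sup>2 * B)\<^sup>2" by (intro power_mono) auto
      then show ?thesis by (simp add: power_mult_distrib)
    qed
    have 2: "M\<^sup>2 \<le> t\<^sup>2 * grad_sq u"
    proof -
      have "t\<^sup>2 * (\<kappa>\<^sup>2 * M\<^sup>2) \<le> t\<^sup>2 * grad_sq u" by (intro mult_left_mono u) simp
      then show ?thesis using \<kappa> by (simp add: mult.assoc[symmetric] power_mult_distrib[symmetric])
    qed
    have "E_min TYPE('n) \<sigma> m \<le> ereal (m / mass u * (t ^ 4 * (lap u)\<^sup>2 - 2 * t\<^sup>2 * grad_sq u)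
       - 1 / (\<sigma> + 1) * ((m / mass u) powr (\<sigma> + 1) * t powr (\<sigma> * real CARD('n)) * enn2real (Lp_int (2 * \<sigma> + 2) u)))"
      by (rule E_min_le_scaled) (use u M m t \<sigma> in auto)
    also have "\<dots> \<le> ereal (m / mass u * (t ^ 4 * (lap u)\<^sup>2 - 2 * t\<^sup>2 * grad_sq u))"
      using \<sigma> by simp
    also have "\<dots> \<le> ereal (f t)"
      unfolding f_def u(2) using 1 2 m by (simp add: mult_left_mono divide_right_mono)
    finally show ?thesis .
  qed
  have "(\<lambda>n. f (1 / real (Suc n))) \<longlonglongrightarrow> m / M\<^sup>2 * ((M + 0 * A + 0\<^sup>2 * B)\<^sup>2 - 2 * M\<^sup>2)"
    unfolding f_def by (intro tendsto_intros LIMSEQ_Suc lim_1_over_n)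
  then have "(\<lambda>n. ereal (f (1 / real (Suc n)))) \<longlonglongrightarrow> ereal (- m)" using M by simp
  then show ?thesis by (rule LIMSEQ_le_const) (use le in auto)
qed

text \<open>
  Under concentration the potential term grows like \<open>l\<^bsup>\<sigma>N\<^esup>\<close>, faster than the leading term \<open>l\<^sup>4\<close>.
\<close>

lemma E_min_supercritical:
  assumes \<sigma>: "\<sigma> > 0" "\<sigma> * real CARD('n::finite) > 4" and m: "m > 0"
  shows "E_min TYPE('n) \<sigma> m = - \<infinity>"
proof -
  obtain u :: "real ^ 'n \<Rightarrow> complex" where u: "u \<in> H2" "L2_norm u > 0" "\<And>p. p > 0 \<Longrightarrow> 0 < Lp_int p u \<and> Lp_int p u < \<infinity>"
    by (rule exists_H2_element) (rule that; blast)
  let ?q = "\<sigma> * real CARD('n)" and ?P = "Lp_int (2 * \<sigma> + 2) u"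
  define c where "c = m / mass u * (lap u)\<^sup>2"
  define d where "d = 1 / (\<sigma> + 1) * (m / mass u) powr (\<sigma> + 1) * enn2real ?P"
  have P: "enn2real ?P > 0" using u(3)[of "2 * \<sigma> + 2"] \<sigma> by (simp add: enn2real_positive_iff)
  have c: "c \<ge> 0" and d: "d > 0" using u m \<sigma> P by (auto simp: c_def d_def)
  have "E_min TYPE('n) \<sigma> m \<le> ereal r" for r
  proof -
    define w where "w = ((c + 1) / d) powr (1 / (?q - 4))"
    \<comment> \<open>Large enough for \<open>d l\<^bsup>\<sigma>N\<^esup> \<ge> (c + 1) l\<^sup>4\<close> and \<open>l\<^sup>4 \<ge> - r\<close>.\<close>
    define l where "l = max 1 (max (- r) w)"
    have l: "l \<ge> 1" "l \<ge> - r" "l \<ge> w" by (auto simp: l_def)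
    have w: "w powr (?q - 4) = (c + 1) / d" using c d \<sigma> by (simp add: w_def powr_powr)
    have "(c + 1) / d \<le> l powr (?q - 4)" unfolding w[symmetric]
      using l(3) \<sigma> by (intro powr_mono2) (auto simp: w_def)
    then have ge: "c + 1 \<le> d * l powr (?q - 4)" using d by (simp add: divide_le_eq mult.commute)
    have "E_min TYPE('n) \<sigma> m \<le> ereal (m / mass u * (l ^ 4 * (lap u)\<^sup>2 - 2 * l\<^sup>2 * grad_sq u)
       - 1 / (\<sigma> + 1) * ((m / mass u) powr (\<sigma> + 1) * l powr ?q * enn2real ?P))"
      by (rule E_min_le_scaled) (use u m l \<sigma> in auto)
    also have "\<dots> \<le> ereal (l ^ 4 * c - d * l powr ?q)"
    proof -
      have "0 \<le> m / mass u * (2 * l\<^sup>2 * grad_sq u)" using m grad_sq_nonneg[of u] by simp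
      then show ?thesis by (simp add: c_def d_def algebra_simps)
    qed
    also have "\<dots> \<le> ereal r"
    proof -
      have "l powr ?q = l powr (?q - 4) * l powr 4" by (simp only: powr_add[symmetric]) simp
      also have "l powr 4 = l ^ 4" using l by (simp add: powr_numeral)
      finally have "l ^ 4 * c - d * l powr ?q = l ^ 4 * (c - d * l powr (?q - 4))"
        by (simp add: algebra_simps)
      also have "\<dots> \<le> l ^ 4 * (- 1)" using ge by (intro mult_left_mono) auto
      also have "\<dots> \<le> - l" using l(1) power_increasing[of 1 4 l] by simp
      also have "\<dots> \<le> r" using l(2) by simp
      finally show ?thesis by simp
    qed
    finally show ?thesis .
  qed
  then show ?thesis by (metis ereal_bot)
qed

lemma powr_tangent:
  fixes w :: real
  assumes "w > 0" "s \<ge> 1" shows "1 + s * (w - 1) \<le> w powr s"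
proof -
  have "(w powr s) powr (1 / s) * 1 powr (1 - 1 / s) \<le> 1 / s * w powr s + (1 - 1 / s) * 1"
    using assms by (intro Youngs_inequality_0) auto
  then have "w \<le> 1 / s * w powr s + (1 - 1 / s)" using assms by (simp add: powr_powr)
  then have "s * w \<le> s * (1 / s * w powr s + (1 - 1 / s))" using assms by (intro mult_left_mono) auto
  also have "\<dots> = w powr s + s - 1" using assms by (simp add: algebra_simps)
  finally show ?thesis by (simp add: algebra_simps)
qed

text \<open>
  Along the ray \<open>m \<mapsto> \<surd>m u\<close> the energy is \<open>a m - b m\<^bsup>\<sigma>+1\<^esup>\<close> with \<open>b \<ge> 0\<close>, and \<open>E_min\<close> is the infimum
  of these concave functions of \<open>m\<close>.
\<close>

lemma E_min_concave:
  assumes \<sigma>: "\<sigma> > 0" and fin: "\<And>u :: real ^ 'n \<Rightarrow> complex. u \<in> H2 \<Longrightarrow> Lp_int (2 * \<sigma> + 2) u < \<infinity>"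
  shows "ereal_concave_on {0<..} (E_min TYPE('n::finite) \<sigma>)"
  unfolding ereal_concave_on_def
proof (intro conjI ballI allI impI)
  show "convex {0::real<..}" by simp
  show "E_min TYPE('n) \<sigma> x < \<infinity>" if "x \<in> {0<..}" for x
    using E_min_le_minus_mass[OF \<sigma>, of x, where 'n='n] that by (auto intro: le_less_trans)
next
  fix x y t :: real assume xy: "x \<in> {0<..}" "y \<in> {0<..}" and t: "0 < t \<and> t < 1"
  define z where "z = t * x + (1 - t) * y"
  have z: "z > 0" using xy t by (auto simp: z_def intro: add_pos_pos)
  show "ereal t * E_min TYPE('n) \<sigma> x + ereal (1 - t) * E_min TYPE('n) \<sigma> y \<le> E_min TYPE('n) \<sigma> (t * x + (1 - t) * y)"
    unfolding z_def[symmetric]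
  proof (subst (3) E_min_def, rule INF_greatest)
    fix u :: "real ^ 'n \<Rightarrow> complex" assume "u \<in> {u. u \<in> H2 \<and> mass u = z}"
    then have u: "u \<in> H2" "mass u = z" by auto
    have M: "L2_norm u > 0" using z u(2) L2_norm_nonneg[of u] by (auto simp: less_le)
    define a where "a = (lap u)\<^sup>2 - 2 * grad_sq u"
    define b where "b = 1 / (\<sigma> + 1) * enn2real (Lp_int (2 * \<sigma> + 2) u)"
    have b: "b \<ge> 0" using \<sigma> by (simp add: b_def)
    have E: "E_min TYPE('n) \<sigma> w \<le> ereal (w / z * a - (w / z) powr (\<sigma> + 1) * b)" if "w > 0" for w
      using E_min_le_scaled[OF u(1) M fin[OF u(1)] that, of 1] by (simp add: u(2) a_def b_def mult_ac)
    have "ereal t * E_min TYPE('n) \<sigma> x + ereal (1 - t) * E_min TYPE('n) \<sigma> y \<le>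
      ereal t * ereal (x / z * a - (x / z) powr (\<sigma> + 1) * b) + ereal (1 - t) * ereal (y / z * a - (y / z) powr (\<sigma> + 1) * b)"
      by (intro add_mono ereal_mult_left_mono E) (use xy t in auto)
    also have "\<dots> = ereal ((t * (x / z) + (1 - t) * (y / z)) * a - (t * (x / z) powr (\<sigma> + 1) + (1 - t) * (y / z) powr (\<sigma> + 1)) * b)"
      by (simp add: algebra_simps)
    also have "\<dots> \<le> ereal (a - b)"
    proof -
      have one: "t * (x / z) + (1 - t) * (y / z) = 1"
        using z by (simp add: add_divide_distrib[symmetric] z_def[symmetric])
      have "t * (1 + (\<sigma> + 1) * (x / z - 1)) + (1 - t) * (1 + (\<sigma> + 1) * (y / z - 1)) \<le>
         t * (x / z) powr (\<sigma> + 1) + (1 - t) * (y / z) powr (\<sigma> + 1)"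
        using xy z t \<sigma> by (intro add_mono mult_left_mono powr_tangent) auto
      moreover have "t * (1 + (\<sigma> + 1) * (x / z - 1)) + (1 - t) * (1 + (\<sigma> + 1) * (y / z - 1)) =
         1 + (\<sigma> + 1) * (t * (x / z) + (1 - t) * (y / z) - 1)" by (simp add: algebra_simps)
      moreover have "1 + (\<sigma> + 1) * (t * (x / z) + (1 - t) * (y / z) - 1) = 1" unfolding one by simp
      ultimately have "1 \<le> t * (x / z) powr (\<sigma> + 1) + (1 - t) * (y / z) powr (\<sigma> + 1)" by linarith
      then have "1 * b \<le> (t * (x / z) powr (\<sigma> + 1) + (1 - t) * (y / z) powr (\<sigma> + 1)) * b"
        using b by (intro mult_right_mono) auto
      then show ?thesis unfolding one by simp
    qed
    also have "ereal (a - b) = energy \<sigma> u" using fin[OF u(1)] by (simp add: energy_eq[OF u(1)] a_def b_def)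
    finally show "ereal t * E_min TYPE('n) \<sigma> x + ereal (1 - t) * E_min TYPE('n) \<sigma> y \<le> energy \<sigma> u" .
  qed
qed

section \<open>Lower bounds for the energy\<close>

lemma young_powr:
  fixes D M :: real
  assumes "D \<ge> 0" "M \<ge> 0" "0 < q" "q \<le> 2"
  shows "D powr q * M powr (2 - q) \<le> D\<^sup>2 + M\<^sup>2"
proof -
  have sq: "a powr q * a powr (2 - q) \<le> a\<^sup>2" if "a \<ge> 0" for a :: real
  proof (cases "a = 0")
    case False
    then have "a powr q * a powr (2 - q) = a powr 2" by (simp only: powr_add[symmetric]) simp
    then show ?thesis using that by (simp add: powr_numeral)
  qed simp
  show ?thesis
  proof (cases "D \<le> M")
    case True
    then have "D powr q * M powr (2 - q) \<le> M powr q * M powr (2 - q)"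
      using assms by (intro mult_right_mono powr_mono2) auto
    then show ?thesis using sq[OF assms(2)] zero_le_power2[of D] by linarith
  next
    case False
    then have "D powr q * M powr (2 - q) \<le> D powr q * D powr (2 - q)"
      using assms by (intro mult_left_mono powr_mono2) auto
    then show ?thesis using sq[OF assms(1)] zero_le_power2[of M] by linarith
  qed
qed

text \<open>
  Young's inequality turns the Gagliardo--Nirenberg bound into \<open>P / (\<sigma> + 1) \<le> \<theta> (D\<^sup>2 + m)\<close> with \<open>\<theta>\<close> proportional
  to \<open>m\<^sup>\<sigma>\<close>, and completing the square in \<open>(1 - \<theta>) D\<^sup>2 - 2 M D\<close> gives the bound.
\<close>

lemma E_min_lower_small_mass:
  assumes \<sigma>: "\<sigma> > 0" "\<sigma> * real CARD('n::finite) \<le> 4"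
  obtains B where "B > 0" "\<And>m. m > 0 \<Longrightarrow> B * m powr \<sigma> < 1 \<Longrightarrow>
    ereal (- m * (1 / (1 - B * m powr \<sigma>) + B * m powr \<sigma>)) \<le> E_min TYPE('n) \<sigma> m"
proof -
  let ?q = "\<sigma> * real CARD('n) / 2"
  obtain B where B: "B > 0" "\<And>u :: real ^ 'n \<Rightarrow> complex. u \<in> H2 \<Longrightarrow> Lp_int (2 * \<sigma> + 2) u \<le>
    ennreal (B * (lap u powr ?q * L2_norm u powr (2 + 2 * \<sigma> - ?q)))"
    by (rule gagliardo_nirenberg[OF \<sigma>]) (rule that; blast)
  have q: "0 < ?q" "?q \<le> 2" using \<sigma> by auto
  show ?thesis
  proof (rule that[of "B / (\<sigma> + 1)"])
    show "B / (\<sigma> + 1) > 0" using B \<sigma> by simp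
    fix m :: real assume m: "m > 0" and small: "B / (\<sigma> + 1) * m powr \<sigma> < 1"
    define \<theta> where "\<theta> = B / (\<sigma> + 1) * m powr \<sigma>"
    have \<theta>: "\<theta> \<ge> 0" "\<theta> < 1" using small B \<sigma> by (auto simp: \<theta>_def)
    show "ereal (- m * (1 / (1 - B / (\<sigma> + 1) * m powr \<sigma>) + B / (\<sigma> + 1) * m powr \<sigma>)) \<le> E_min TYPE('n) \<sigma> m"
      unfolding \<theta>_def[symmetric] unfolding E_min_def
    proof (rule INF_greatest)
      fix u :: "real ^ 'n \<Rightarrow> complex" assume "u \<in> {u. u \<in> H2 \<and> mass u = m}"
      then have u: "u \<in> H2" "mass u = m" by auto
      define M where "M = L2_norm u"
      define D where "D = lap u"
      have M: "M > 0" "M\<^sup>2 = m" using m u(2) L2_norm_nonneg[of u] by (auto simp: less_le M_def)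
      have D: "D \<ge> 0" by (simp add: D_def)
      have M2s: "M powr (2 * \<sigma>) = m powr \<sigma>"
      proof -
        have "M powr (2 * \<sigma>) = (M powr 2) powr \<sigma>" by (simp only: powr_powr)
        then show ?thesis using M by simp
      qed
      have "B * (D powr ?q * M powr (2 + 2 * \<sigma> - ?q)) = B * m powr \<sigma> * (D powr ?q * M powr (2 - ?q))"
      proof -
        have "M powr (2 + 2 * \<sigma> - ?q) = M powr (2 * \<sigma>) * M powr (2 - ?q)"
          by (simp only: powr_add[symmetric]) (simp add: algebra_simps)
        then show ?thesis by (simp add: M2s)
      qed
      also have "\<dots> \<le> B * m powr \<sigma> * (D\<^sup>2 + M\<^sup>2)"
        using B M D q by (intro mult_left_mono young_powr) auto
      finally have le: "B * (D powr ?q * M powr (2 + 2 * \<sigma> - ?q)) \<le> B * m powr \<sigma> * (D\<^sup>2 + M\<^sup>2)" .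
      have "Lp_int (2 * \<sigma> + 2) u \<le> ennreal (B * m powr \<sigma> * (D\<^sup>2 + M\<^sup>2))"
        using order_trans[OF B(2)[OF u(1)] ennreal_leI[OF le[unfolded M_def D_def]]] by (simp add: M_def D_def)
      then have "ereal (D\<^sup>2 - 2 * (M * D) - B * m powr \<sigma> * (D\<^sup>2 + M\<^sup>2) / (\<sigma> + 1)) \<le> energy \<sigma> u"
        using energy_lower[OF u(1) \<sigma>(1)] B unfolding M_def D_def by simp
      moreover have "- m * (1 / (1 - \<theta>) + \<theta>) \<le> D\<^sup>2 - 2 * (M * D) - B * m powr \<sigma> * (D\<^sup>2 + M\<^sup>2) / (\<sigma> + 1)"
      proof -
        have eq: "B * m powr \<sigma> * (D\<^sup>2 + M\<^sup>2) / (\<sigma> + 1) = \<theta> * (D\<^sup>2 + M\<^sup>2)" by (simp add: \<theta>_def)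
        define e where "e = 1 - \<theta>"
        have e: "e > 0" using \<theta> by (simp add: e_def)
        \<comment> \<open>Completing the square.\<close>
        have "0 \<le> (e * D - M)\<^sup>2 / e" using e by simp
        also have "\<dots> = e * D\<^sup>2 - 2 * (M * D) + M\<^sup>2 / e"
          using e by (simp add: power2_eq_square field_simps)
        finally have "- (M\<^sup>2 / e) \<le> e * D\<^sup>2 - 2 * (M * D)" by simp
        then show ?thesis unfolding eq by (simp add: e_def M(2)[symmetric] algebra_simps)
      qed
      ultimately show "ereal (- m * (1 / (1 - \<theta>) + \<theta>)) \<le> energy \<sigma> u"
        by (meson ereal_less_eq(3) order_trans)
    qed
  qed
qed

lemma E_min_at_0:
  assumes \<sigma>: "\<sigma> > 0" "\<sigma> * real CARD('n::finite) \<le> 4"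
  shows "(E_min TYPE('n) \<sigma> \<longlongrightarrow> 0) (at_right 0)"
    and "((\<lambda>m. E_min TYPE('n) \<sigma> m / ereal m) \<longlongrightarrow> -1) (at_right 0)"
proof -
  obtain B where B: "B > 0" "\<And>m. m > 0 \<Longrightarrow> B * m powr \<sigma> < 1 \<Longrightarrow>
    ereal (- m * (1 / (1 - B * m powr \<sigma>) + B * m powr \<sigma>)) \<le> E_min TYPE('n) \<sigma> m"
    by (rule E_min_lower_small_mass[OF \<sigma>]) (rule that; blast)
  define \<theta> where "\<theta> m = B * m powr \<sigma>" for m
  have pm: "\<forall>\<^sub>F m in at_right (0::real). m > 0" by (simp add: eventually_at_right_less)
  have id: "((\<lambda>m. m) \<longlongrightarrow> (0::real)) (at_right 0)" by (rule tendsto_ident_at)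
  have "((\<lambda>m. m powr \<sigma>) \<longlongrightarrow> 0) (at_right (0::real))"
    by (rule tendsto_zero_powrI[OF id tendsto_const _ \<sigma>(1)]) (use pm in \<open>auto elim: eventually_mono\<close>)
  from tendsto_mult_right_zero[OF this] have \<theta>0: "(\<theta> \<longlongrightarrow> 0) (at_right 0)" unfolding \<theta>_def[abs_def] .
  have ev: "\<forall>\<^sub>F m in at_right 0. \<theta> m < 1" using order_tendstoD(2)[OF \<theta>0] by simp
  define g where "g m = 1 / (1 - \<theta> m) + \<theta> m" for m
  have "(g \<longlongrightarrow> 1 / (1 - 0) + 0) (at_right 0)" unfolding g_def[abs_def] by (intro tendsto_intros \<theta>0) simp
  then have g: "(g \<longlongrightarrow> 1) (at_right 0)" by simp
  have lower: "\<forall>\<^sub>F m in at_right 0. ereal (- m * g m) \<le> E_min TYPE('n) \<sigma> m"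
    using ev pm by eventually_elim (use B in \<open>simp add: g_def \<theta>_def\<close>)
  have upper: "\<forall>\<^sub>F m in at_right 0. E_min TYPE('n) \<sigma> m \<le> ereal (- m)"
    using pm by eventually_elim (rule E_min_le_minus_mass[OF \<sigma>(1)])
  show "(E_min TYPE('n) \<sigma> \<longlongrightarrow> 0) (at_right 0)"
  proof (rule tendsto_sandwich[OF lower upper])
    have "((\<lambda>m. - m * g m) \<longlongrightarrow> - 0 * 1) (at_right 0)" by (intro tendsto_intros id g)
    then show "((\<lambda>m. ereal (- m * g m)) \<longlongrightarrow> 0) (at_right 0)" by (simp add: zero_ereal_def)
    have "((\<lambda>m. - m) \<longlongrightarrow> - 0) (at_right (0::real))" by (intro tendsto_intros id)
    then show "((\<lambda>m. ereal (- m)) \<longlongrightarrow> 0) (at_right 0)" by (simp only: zero_ereal_def lim_ereal) simp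
  qed
  show "((\<lambda>m. E_min TYPE('n) \<sigma> m / ereal m) \<longlongrightarrow> -1) (at_right 0)"
  proof (rule tendsto_sandwich)
    show "\<forall>\<^sub>F m in at_right 0. ereal (- g m) \<le> E_min TYPE('n) \<sigma> m / ereal m"
      using lower upper pm
    proof eventually_elim
      case (elim m)
      then show ?case by (cases "E_min TYPE('n) \<sigma> m") (auto simp: field_simps)
    qed
    show "\<forall>\<^sub>F m in at_right 0. E_min TYPE('n) \<sigma> m / ereal m \<le> ereal (- 1)"
      using lower upper pm
    proof eventually_elim
      case (elim m)
      then show ?case by (cases "E_min TYPE('n) \<sigma> m") (auto simp: field_simps)
    qed
    have "((\<lambda>m. - g m) \<longlongrightarrow> - 1) (at_right 0)" by (intro tendsto_intros g)
    then show "((\<lambda>m. ereal (- g m)) \<longlongrightarrow> -1) (at_right 0)" by (simp add: one_ereal_def)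
    show "((\<lambda>m. ereal (- 1)) \<longlongrightarrow> -1) (at_right 0)" by (simp add: one_ereal_def)
  qed
qed

lemma E_min_gt_of_coercive:
  assumes c: "c > 0" and coer: "\<And>u :: real ^ 'n \<Rightarrow> complex. u \<in> H2 \<Longrightarrow> mass u \<le> k \<Longrightarrow> ereal (c * (lap u)\<^sup>2 - K) \<le> energy \<sigma> u"
    and m: "m \<le> k"
  shows "E_min TYPE('n::finite) \<sigma> m > - \<infinity>"
proof -
  have "ereal (- K) \<le> E_min TYPE('n) \<sigma> m"
    unfolding E_min_def
  proof (rule INF_greatest)
    fix u :: "real ^ 'n \<Rightarrow> complex" assume "u \<in> {u. u \<in> H2 \<and> mass u = m}"
    then have "ereal (c * (lap u)\<^sup>2 - K) \<le> energy \<sigma> u" using coer m by auto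
    moreover have "ereal (- K) \<le> ereal (c * (lap u)\<^sup>2 - K)" using c by simp
    ultimately show "ereal (- K) \<le> energy \<sigma> u" by (rule order_trans[rotated])
  qed
  then show ?thesis by (auto intro: less_le_trans)
qed

lemma H2_bounded_of_coercive:
  assumes c: "c > 0" and coer: "\<And>u :: real ^ 'n \<Rightarrow> complex. u \<in> H2 \<Longrightarrow> mass u \<le> k \<Longrightarrow> ereal (c * (lap u)\<^sup>2 - K) \<le> energy \<sigma> u"
    and S: "S \<subseteq> {u :: real ^ 'n \<Rightarrow> complex. u \<in> H2 \<and> mass u \<le> k \<and> energy \<sigma> u \<le> ereal k2}"
  shows "H2_bounded S"
  unfolding H2_bounded_def
proof (intro conjI exI ballI)
  show "S \<subseteq> H2" using S by auto
  define L where "L = (k2 + K) / c"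
  fix u assume "u \<in> S"
  then have u: "u \<in> H2" "mass u \<le> k" "energy \<sigma> u \<le> ereal k2" using S by auto
  have "ereal (c * (lap u)\<^sup>2 - K) \<le> ereal k2" using order_trans[OF coer[OF u(1,2)] u(3)] .
  then have D: "(lap u)\<^sup>2 \<le> L" using c by (simp add: L_def field_simps)
  have "grad_sq u \<le> mass u + (lap u)\<^sup>2"
    using grad_sq_le[OF u(1)] sum_squares_bound[of "L2_norm u" "lap u"] L2_norm_nonneg[of u] L2_norm_nonneg[of "weak_laplacian u"]
      mult_nonneg_nonneg[of "L2_norm u" "lap u"] by linarith
  then show "H2_norm u \<le> sqrt (2 * k + 2 * L)"
    unfolding H2_norm_sq[OF u(1)] using D u(2) by simp
qed

lemma subcritical_absorb:
  fixes b :: real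
  assumes "b \<ge> 0" "0 < q" "q < 2"
  obtains K where "\<And>D. D \<ge> 0 \<Longrightarrow> b * D powr q \<le> D\<^sup>2 / 4 + K"
proof -
  \<comment> \<open>The \<open>+ 1\<close> keeps \<open>T\<close> positive if \<open>b = 0\<close>.\<close>
  define T where "T = (4 * b + 1) powr (1 / (2 - q))"
  have T: "T > 0" "T powr (2 - q) = 4 * b + 1" using assms by (auto simp: T_def powr_powr)
  show ?thesis
  proof (rule that[of "b * T powr q"])
    fix D :: real assume D: "D \<ge> 0"
    show "b * D powr q \<le> D\<^sup>2 / 4 + b * T powr q"
    proof (cases "D \<le> T")
      case True
      then have "b * D powr q \<le> b * T powr q" using assms D by (intro mult_left_mono powr_mono2) auto
      then show ?thesis using zero_le_power2[of D] by linarith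
    next
      case False
      then have "4 * b \<le> D powr (2 - q)" using powr_mono2[of "2 - q" T D] T assms by simp
      then have "4 * b * D powr q \<le> D powr (2 - q) * D powr q" by (intro mult_right_mono) auto
      also have "\<dots> = D powr 2" by (simp only: powr_add[symmetric]) simp
      also have "\<dots> = D\<^sup>2" using D by simp
      finally have "b * D powr q \<le> D\<^sup>2 / 4" by simp
      moreover have "b * T powr q \<ge> 0" using assms by simp
      ultimately show ?thesis by linarith
    qed
  qed
qed

text \<open>
  The potential term carries the power \<open>\<sigma>N / 2 < 2\<close> of \<open>D\<close> and is absorbed into a fraction of \<open>D\<^sup>2\<close>.
\<close>

lemma coercive_subcritical:
  assumes \<sigma>: "\<sigma> > 0" "\<sigma> * real CARD('n::finite) < 4" and k: "k \<ge> 0"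
  obtains K where "\<And>u :: real ^ 'n \<Rightarrow> complex. u \<in> H2 \<Longrightarrow> mass u \<le> k \<Longrightarrow> ereal (1 / 2 * (lap u)\<^sup>2 - K) \<le> energy \<sigma> u"
proof -
  let ?q = "\<sigma> * real CARD('n) / 2"
  obtain B where B: "B > 0" "\<And>u :: real ^ 'n \<Rightarrow> complex. u \<in> H2 \<Longrightarrow> Lp_int (2 * \<sigma> + 2) u \<le>
    ennreal (B * (lap u powr ?q * L2_norm u powr (2 + 2 * \<sigma> - ?q)))"
    by (rule gagliardo_nirenberg[OF \<sigma>(1) less_imp_le[OF \<sigma>(2)]]) (rule that; blast)
  have q: "0 < ?q" "?q < 2" using \<sigma> by auto
  define b where "b = B * sqrt k powr (2 + 2 * \<sigma> - ?q)"
  have b: "b \<ge> 0" using B by (simp add: b_def)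
  have "b / (\<sigma> + 1) \<ge> 0" using b \<sigma> by simp
  then obtain K where K: "\<And>D. D \<ge> 0 \<Longrightarrow> b / (\<sigma> + 1) * D powr ?q \<le> D\<^sup>2 / 4 + K"
    using subcritical_absorb[OF _ q] by blast
  show ?thesis
  proof (rule that[of "K + 4 * k"])
    fix u :: "real ^ 'n \<Rightarrow> complex" assume u: "u \<in> H2" "mass u \<le> k"
    have M: "L2_norm u \<le> sqrt k" using u(2) by (rule real_le_rsqrt)
    have "B * (lap u powr ?q * L2_norm u powr (2 + 2 * \<sigma> - ?q)) \<le> B * (lap u powr ?q * sqrt k powr (2 + 2 * \<sigma> - ?q))"
      using B M q \<sigma> by (intro mult_left_mono powr_mono2) auto
    also have "\<dots> = b * lap u powr ?q" by (simp add: b_def)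
    finally have "Lp_int (2 * \<sigma> + 2) u \<le> ennreal (b * lap u powr ?q)"
      using B(2)[OF u(1)] ennreal_leI order_trans by blast
    then have "ereal ((lap u)\<^sup>2 - 2 * (L2_norm u * lap u) - b * lap u powr ?q / (\<sigma> + 1)) \<le> energy \<sigma> u"
      using energy_lower[OF u(1) \<sigma>(1)] b by simp
    moreover have "1 / 2 * (lap u)\<^sup>2 - (K + 4 * k) \<le> (lap u)\<^sup>2 - 2 * (L2_norm u * lap u) - b * lap u powr ?q / (\<sigma> + 1)"
    proof -
      have "0 \<le> (lap u / 2 - 2 * L2_norm u)\<^sup>2" by simp
      then have "2 * (L2_norm u * lap u) \<le> (lap u)\<^sup>2 / 4 + 4 * mass u"
        by (simp add: power2_eq_square algebra_simps)
      moreover have "b * lap u powr ?q / (\<sigma> + 1) \<le> (lap u)\<^sup>2 / 4 + K" using K[of "lap u"] by simp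
      ultimately show ?thesis using u(2) by linarith
    qed
    ultimately show "ereal (1 / 2 * (lap u)\<^sup>2 - (K + 4 * k)) \<le> energy \<sigma> u"
      by (meson ereal_less_eq(3) order_trans)
  qed
qed

lemma E_min_strict_upper:
  assumes \<sigma>: "\<sigma> > 0"
  obtains A B where "B > 0" "\<And>m. m > 0 \<Longrightarrow> E_min TYPE('n::finite) \<sigma> m < ereal (A * m - B * m powr (\<sigma> + 1))"
proof -
  obtain u :: "real ^ 'n \<Rightarrow> complex" where u: "u \<in> H2" "L2_norm u > 0" "\<And>p. p > 0 \<Longrightarrow> 0 < Lp_int p u \<and> Lp_int p u < \<infinity>"
    by (rule exists_H2_element) (rule that; blast)
  let ?P = "Lp_int (2 * \<sigma> + 2) u"
  have P: "enn2real ?P > 0" using u(3)[of "2 * \<sigma> + 2"] \<sigma> by (simp add: enn2real_positive_iff)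
  define a where "a = ((lap u)\<^sup>2 - 2 * grad_sq u) / mass u"
  define B where "B = 1 / (\<sigma> + 1) * (1 / mass u) powr (\<sigma> + 1) * enn2real ?P"
  have "B > 0" using P \<sigma> u(2) by (simp add: B_def)
  moreover have "E_min TYPE('n) \<sigma> m < ereal ((a + 1) * m - B * m powr (\<sigma> + 1))" if m: "m > 0" for m
  proof -
    have "E_min TYPE('n) \<sigma> m \<le> ereal (m / mass u * (1 ^ 4 * (lap u)\<^sup>2 - 2 * 1\<^sup>2 * grad_sq u)
      - 1 / (\<sigma> + 1) * ((m / mass u) powr (\<sigma> + 1) * 1 powr (\<sigma> * real CARD('n)) * enn2real ?P))"
      by (rule E_min_le_scaled) (use u m \<sigma> in auto)
    also have "(m / mass u) powr (\<sigma> + 1) = m powr (\<sigma> + 1) * (1 / mass u) powr (\<sigma> + 1)"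
      using m by (simp add: powr_mult[symmetric])
    also have "m / mass u * (1 ^ 4 * (lap u)\<^sup>2 - 2 * 1\<^sup>2 * grad_sq u)
      - 1 / (\<sigma> + 1) * (m powr (\<sigma> + 1) * (1 / mass u) powr (\<sigma> + 1) * 1 powr (\<sigma> * real CARD('n)) * enn2real ?P)
      = a * m - B * m powr (\<sigma> + 1)"
      by (simp add: a_def B_def mult_ac)
    also have "ereal (a * m - B * m powr (\<sigma> + 1)) < ereal ((a + 1) * m - B * m powr (\<sigma> + 1))"
      using m by (simp add: algebra_simps)
    finally show ?thesis .
  qed
  ultimately show ?thesis using that by blast
qed

lemma E_min_ratio_at_top:
  assumes \<sigma>: "\<sigma> > 0" and fin: "\<And>m. m > 0 \<Longrightarrow> E_min TYPE('n::finite) \<sigma> m > - \<infinity>"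
  shows "((\<lambda>m. E_min TYPE('n) \<sigma> m / ereal m) \<longlongrightarrow> - \<infinity>) at_top"
  unfolding tendsto_MInfty
proof
  fix r :: real
  obtain A B where B: "B > 0" "\<And>m. m > 0 \<Longrightarrow> E_min TYPE('n) \<sigma> m < ereal (A * m - B * m powr (\<sigma> + 1))"
    by (rule E_min_strict_upper[OF \<sigma>, where 'n='n]) (rule that; blast)
  define w where "w = (\<bar>A - r\<bar> / B) powr (1 / \<sigma>)"
  have w: "w powr \<sigma> = \<bar>A - r\<bar> / B" using \<sigma> B by (simp add: w_def powr_powr)
  show "\<forall>\<^sub>F m in at_top. E_min TYPE('n) \<sigma> m / ereal m < ereal r"
    using eventually_ge_at_top[of w] eventually_gt_at_top[of 0]
  proof eventually_elim
    case (elim m)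
    have "\<bar>A - r\<bar> / B \<le> m powr \<sigma>" unfolding w[symmetric] using elim \<sigma> by (intro powr_mono2) (auto simp: w_def)
    then have "\<bar>A - r\<bar> \<le> B * m powr \<sigma>" using B by (simp add: divide_le_eq mult.commute)
    then have "A - B * m powr \<sigma> \<le> r" by linarith
    then have "(A - B * m powr \<sigma>) * m \<le> r * m" using elim by (intro mult_right_mono) auto
    moreover have "m powr (\<sigma> + 1) = m powr \<sigma> * m" using elim by (simp add: powr_add)
    ultimately have le: "A * m - B * m powr (\<sigma> + 1) \<le> r * m" by (simp add: algebra_simps)
    show ?case
    proof (cases "E_min TYPE('n) \<sigma> m")
      case (real e)
      then have "e < A * m - B * m powr (\<sigma> + 1)" using B(2)[of m] elim by simp
      then have "e / m < r" using le elim by (simp add: divide_less_eq)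
      then show ?thesis using real elim by simp
    next
      case PInf
      then show ?thesis using B(2)[of m] elim by simp
    next
      case MInf
      then show ?thesis using fin[of m] elim by simp
    qed
  qed
qed

section \<open>The mass critical case\<close>

text \<open>
  By \<open>normalise\<close> the supremum may be approached by functions with \<open>M = D = 1\<close>, for which the quotient is \<open>P\<close>.
\<close>

lemma GN_const_critical:
  assumes \<sigma>: "\<sigma> > 0" "\<sigma> * real CARD('n::finite) = 4"
  obtains b where "b > 0" "GN_const TYPE('n) \<sigma> = ennreal b"
    "\<And>u :: real ^ 'n \<Rightarrow> complex. u \<in> H2 \<Longrightarrow> Lp_int (2 * \<sigma> + 2) u \<le> ennreal (b * ((lap u)\<^sup>2 * L2_norm u powr (2 * \<sigma>)))"
    "\<And>\<beta>. 0 \<le> \<beta> \<Longrightarrow> \<beta> < b \<Longrightarrow> \<exists>v :: real ^ 'n \<Rightarrow> complex. v \<in> H2 \<and> L2_norm v = 1 \<and> lap v = 1 \<and> ennreal \<beta> < Lp_int (2 * \<sigma> + 2) v"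
proof -
  let ?P = "Lp_int (2 * \<sigma> + 2)"
  let ?d = "\<lambda>u :: real ^ 'n \<Rightarrow> complex. lap u powr (\<sigma> * real CARD('n) / 2) * L2_norm u powr (2 + 2 * \<sigma> - \<sigma> * real CARD('n) / 2)"
  define S where "S = {u :: real ^ 'n \<Rightarrow> complex. u \<in> H2 \<and> \<not> (AE x in lborel. u x = 0)}"
  have G: "GN_const TYPE('n) \<sigma> = (SUP u \<in> S. ?P u / ennreal (?d u))"
    by (simp add: GN_const_def Lp_int_def S_def)
  have S: "u \<in> H2" "L2_norm u > 0" "lap u > 0" "?d u > 0" if "u \<in> S" for u
  proof -
    show u: "u \<in> H2" using that by (simp add: S_def)
    have "L2_norm u \<noteq> 0" using that L2_norm_eq_0_iff[OF H2_L2(1)[OF u]] by (simp add: S_def)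
    then show M: "L2_norm u > 0" using L2_norm_nonneg[of u] by linarith
    show D: "lap u > 0" by (rule laplacian_pos[OF u M])
    show "?d u > 0" using M D by simp
  qed
  have dd: "?d u = (lap u)\<^sup>2 * L2_norm u powr (2 * \<sigma>)" for u
    using \<sigma> by (simp add: powr_numeral)
  obtain B where B: "B > 0" "\<And>u :: real ^ 'n \<Rightarrow> complex. u \<in> H2 \<Longrightarrow> ?P u \<le> ennreal (B * ?d u)"
    by (rule gagliardo_nirenberg[OF \<sigma>(1) eq_refl[OF \<sigma>(2)]]) (rule that; blast)
  have "GN_const TYPE('n) \<sigma> \<le> ennreal B"
    unfolding G
  proof (rule SUP_least)
    fix u assume u: "u \<in> S"
    show "?P u / ennreal (?d u) \<le> ennreal B"
      using B(2)[OF S(1)[OF u]] S(4)[OF u] B(1)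
      by (intro divide_le_posI_ennreal) (auto simp: ennreal_mult[symmetric] mult.commute)
  qed
  then obtain b where b: "b \<ge> 0" "GN_const TYPE('n) \<sigma> = ennreal b"
    by (cases "GN_const TYPE('n) \<sigma>") (auto simp: top_unique)
  have bound: "?P u \<le> ennreal b * ennreal (?d u)" if u: "u \<in> S" for u
  proof -
    have "?P u / ennreal (?d u) \<le> ennreal b" unfolding b(2)[symmetric] G using u by (rule SUP_upper)
    then have "?P u / ennreal (?d u) * ennreal (?d u) \<le> ennreal b * ennreal (?d u)" by (rule mult_right_mono) simp
    moreover have "?P u / ennreal (?d u) * ennreal (?d u) = ?P u"
    proof -
      have "?P u / ennreal (?d u) * ennreal (?d u) = ?P u * ennreal (?d u) / ennreal (?d u)"
        by (simp only: ennreal_times_divide mult.commute[of _ "ennreal (?d u)"])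
      also have "\<dots> = ?P u" by (rule ennreal_mult_divide_eq) (use S(4)[OF u] in auto)
      finally show ?thesis .
    qed
    ultimately show ?thesis by simp
  qed
  obtain u0 :: "real ^ 'n \<Rightarrow> complex" where u0: "u0 \<in> H2" "L2_norm u0 > 0" "\<And>p. p > 0 \<Longrightarrow> 0 < Lp_int p u0 \<and> Lp_int p u0 < \<infinity>"
    by (rule exists_H2_element) (rule that; blast)
  have "u0 \<in> S" using u0 L2_norm_eq_0_iff[OF H2_L2(1)[OF u0(1)]] by (auto simp: S_def)
  from bound[OF this] have "ennreal b * ennreal (?d u0) > 0" using u0(3)[of "2 * \<sigma> + 2"] \<sigma> by auto
  then have bpos: "b > 0" using b(1) by (cases "b = 0") auto
  show ?thesis
  proof (rule that[OF bpos b(2)])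
    fix u :: "real ^ 'n \<Rightarrow> complex" assume u: "u \<in> H2"
    show "?P u \<le> ennreal (b * ((lap u)\<^sup>2 * L2_norm u powr (2 * \<sigma>)))"
    proof (cases "u \<in> S")
      case True
      from bound[OF this] show ?thesis unfolding dd using b(1) by (simp add: ennreal_mult[symmetric])
    next
      case False
      then have "AE x in lborel. u x = 0" using u by (simp add: S_def)
      then have "?P u = 0" using Lp_int_eq_0_iff[OF L2_measurable[OF H2_L2(1)[OF u]]] by blast
      then show ?thesis by simp
    qed
  next
    fix \<beta> assume \<beta>: "0 \<le> \<beta>" "\<beta> < b"
    then have "ennreal \<beta> < GN_const TYPE('n) \<sigma>" unfolding b(2) by (simp add: ennreal_lessI)
    then obtain u where u: "u \<in> S" "ennreal \<beta> < ?P u / ennreal (?d u)"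
      unfolding G less_SUP_iff by blast
    obtain v :: "real ^ 'n \<Rightarrow> complex" where v: "v \<in> H2" "L2_norm v = 1" "lap v = 1" "?P u = ennreal (?d u) * ?P v"
      by (rule normalise[OF S(1,2,3)[OF u(1)]])
    have "?P u / ennreal (?d u) = ?P v"
      unfolding v(4) mult.commute[of "ennreal (?d u)"]
      by (rule ennreal_mult_divide_eq) (use S(4)[OF u(1)] in auto)
    then show "\<exists>v :: real ^ 'n \<Rightarrow> complex. v \<in> H2 \<and> L2_norm v = 1 \<and> lap v = 1 \<and> ennreal \<beta> < ?P v"
      using u(2) v by auto
  qed
qed

lemma k_star_powr:
  assumes "\<sigma> > 0" "b > 0" "GN_const TYPE('n::finite) \<sigma> = ennreal b"
  shows "k_star TYPE('n) \<sigma> > 0" "b * k_star TYPE('n) \<sigma> powr \<sigma> = \<sigma> + 1"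
proof -
  have k: "k_star TYPE('n) \<sigma> = (\<sigma> + 1) powr (1 / \<sigma>) * b powr (- (1 / \<sigma>))" using assms by (simp add: k_star_def)
  then show "k_star TYPE('n) \<sigma> > 0" using assms by simp
  have "k_star TYPE('n) \<sigma> powr \<sigma> = (\<sigma> + 1) * b powr - 1"
    unfolding k using assms by (simp add: powr_mult powr_powr)
  then show "b * k_star TYPE('n) \<sigma> powr \<sigma> = \<sigma> + 1" using assms by (simp add: powr_minus)
qed

text \<open>
  Here \<open>P\<close> is itself quadratic in \<open>D\<close>, and the definition of \<open>k_star\<close> says that the coefficient
  \<open>1 - b k\<^sup>\<sigma> / (\<sigma> + 1)\<close> of \<open>D\<^sup>2\<close> is positive exactly for \<open>k < k_star\<close>.
\<close>

lemma coercive_critical: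
  assumes \<sigma>: "\<sigma> > 0" "\<sigma> * real CARD('n::finite) = 4" and k: "0 \<le> k" "k < k_star TYPE('n) \<sigma>"
  obtains c K where "c > 0" "\<And>u :: real ^ 'n \<Rightarrow> complex. u \<in> H2 \<Longrightarrow> mass u \<le> k \<Longrightarrow> ereal (c * (lap u)\<^sup>2 - K) \<le> energy \<sigma> u"
proof -
  obtain b where b: "b > 0" "GN_const TYPE('n) \<sigma> = ennreal b"
    "\<And>u :: real ^ 'n \<Rightarrow> complex. u \<in> H2 \<Longrightarrow> Lp_int (2 * \<sigma> + 2) u \<le> ennreal (b * ((lap u)\<^sup>2 * L2_norm u powr (2 * \<sigma>)))"
    "\<And>\<beta>. 0 \<le> \<beta> \<Longrightarrow> \<beta> < b \<Longrightarrow> \<exists>v :: real ^ 'n \<Rightarrow> complex. v \<in> H2 \<and> L2_norm v = 1 \<and> lap v = 1 \<and> ennreal \<beta> < Lp_int (2 * \<sigma> + 2) v"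
    by (rule GN_const_critical[OF \<sigma>]) (rule that; blast)
  note ks = k_star_powr[OF \<sigma>(1) b(1,2)]
  define c where "c = 1 - b * k powr \<sigma> / (\<sigma> + 1)"
  have "b * k powr \<sigma> < b * k_star TYPE('n) \<sigma> powr \<sigma>"
    using b k \<sigma> by (intro mult_strict_left_mono powr_less_mono2) auto
  then have c: "c > 0" using ks \<sigma> by (simp add: c_def)
  show ?thesis
  proof (rule that[of "c / 2" "2 * k / c"])
    fix u :: "real ^ 'n \<Rightarrow> complex" assume u: "u \<in> H2" "mass u \<le> k"
    have "L2_norm u powr (2 * \<sigma>) = mass u powr \<sigma>"
    proof -
      have "L2_norm u powr (2 * \<sigma>) = (L2_norm u powr 2) powr \<sigma>" by (simp only: powr_powr)
      then show ?thesis by simp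
    qed
    also have "\<dots> \<le> k powr \<sigma>" using u(2) \<sigma> by (intro powr_mono2) auto
    finally have "b * ((lap u)\<^sup>2 * L2_norm u powr (2 * \<sigma>)) \<le> b * ((lap u)\<^sup>2 * k powr \<sigma>)"
      using b by (intro mult_left_mono) auto
    then have "Lp_int (2 * \<sigma> + 2) u \<le> ennreal (b * ((lap u)\<^sup>2 * k powr \<sigma>))"
      using b(3)[OF u(1)] ennreal_leI order_trans by blast
    then have "ereal ((lap u)\<^sup>2 - 2 * (L2_norm u * lap u) - b * ((lap u)\<^sup>2 * k powr \<sigma>) / (\<sigma> + 1)) \<le> energy \<sigma> u"
      using energy_lower[OF u(1) \<sigma>(1)] b by simp
    moreover have "c / 2 * (lap u)\<^sup>2 - 2 * k / c \<le> (lap u)\<^sup>2 - 2 * (L2_norm u * lap u) - b * ((lap u)\<^sup>2 * k powr \<sigma>) / (\<sigma> + 1)"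
    proof -
      have eq: "(lap u)\<^sup>2 - b * ((lap u)\<^sup>2 * k powr \<sigma>) / (\<sigma> + 1) = c * (lap u)\<^sup>2"
        by (simp add: c_def algebra_simps)
      \<comment> \<open>Half of the coefficient \<open>c\<close> is spent on the mixed term.\<close>
      have "0 \<le> (c * lap u - 2 * L2_norm u)\<^sup>2 / (2 * c)" using c by simp
      also have "\<dots> = c / 2 * (lap u)\<^sup>2 - 2 * (L2_norm u * lap u) + 2 * mass u / c"
        using c by (simp add: power2_eq_square field_simps)
      finally have "2 * (L2_norm u * lap u) \<le> c / 2 * (lap u)\<^sup>2 + 2 * mass u / c" by simp
      moreover have "2 * mass u / c \<le> 2 * k / c" using u(2) c by (simp add: divide_right_mono)
      ultimately show ?thesis using eq by simp
    qed
    ultimately show "ereal (c / 2 * (lap u)\<^sup>2 - 2 * k / c) \<le> energy \<sigma> u"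
      by (meson ereal_less_eq(3) order_trans)
  qed (use c in simp)
qed

text \<open>
  From the critical mass on, the quartic terms of an almost optimal function nearly cancel or have a
  negative sum. Its gradient
  cannot be small, since otherwise its \<open>L\<^sup>p\<close> norm would be small as well, so after concentration the
  quadratic gradient term wins.
\<close>

lemma E_min_critical_infinite:
  assumes \<sigma>: "\<sigma> > 0" "\<sigma> * real CARD('n::finite) = 4" and m: "m > 0" "k_star TYPE('n) \<sigma> \<le> m"
  shows "E_min TYPE('n) \<sigma> m = - \<infinity>"
proof -
  let ?P = "Lp_int (2 * \<sigma> + 2)"
  obtain b where b: "b > 0" "GN_const TYPE('n) \<sigma> = ennreal b"
    "\<And>u :: real ^ 'n \<Rightarrow> complex. u \<in> H2 \<Longrightarrow> ?P u \<le> ennreal (b * ((lap u)\<^sup>2 * L2_norm u powr (2 * \<sigma>)))"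
    "\<And>\<beta>. 0 \<le> \<beta> \<Longrightarrow> \<beta> < b \<Longrightarrow> \<exists>v :: real ^ 'n \<Rightarrow> complex. v \<in> H2 \<and> L2_norm v = 1 \<and> lap v = 1 \<and> ennreal \<beta> < ?P v"
    by (rule GN_const_critical[OF \<sigma>]) (rule that; blast)
  note ks = k_star_powr[OF \<sigma>(1) b(1,2)]
  have "b * k_star TYPE('n) \<sigma> powr \<sigma> \<le> b * m powr \<sigma>"
    using b m ks \<sigma> by (intro mult_left_mono powr_mono2) auto
  then have bm: "\<sigma> + 1 \<le> b * m powr \<sigma>" using ks by simp
  obtain c where c: "c > 0" "\<And>u :: real ^ 'n \<Rightarrow> complex. u \<in> H2 \<Longrightarrow> L2_norm u \<le> 1 \<Longrightarrow> lap u \<le> 1 \<Longrightarrow> grad_sq u < c \<Longrightarrow> ?P u \<le> ennreal (b / 2)"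
    using Lp_small[where e="b / 2" and p="2 * \<sigma> + 2"] exponent_admissible[OF \<sigma>(1), where 'n='n] \<sigma>(2) b(1) by fastforce
  have key: "E_min TYPE('n) \<sigma> m \<le> ereal (- m * c\<^sup>2 / e)" if e: "e > 0" "e \<le> m powr \<sigma> / (\<sigma> + 1) * (b / 2)" for e
  proof -
    \<comment> \<open>A deficit \<open>\<delta>\<close> in the quotient leaves the remainder \<open>e l\<^sup>4\<close> after cancellation.\<close>
    define \<delta> where "\<delta> = e * (\<sigma> + 1) / m powr \<sigma>"
    have \<delta>: "\<delta> > 0" "\<delta> \<le> b / 2"
    proof -
      show "\<delta> > 0" using e(1) m \<sigma> by (simp add: \<delta>_def)
      show "\<delta> \<le> b / 2" using e(2) m \<sigma> by (simp add: \<delta>_def field_simps)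
    qed
    obtain v :: "real ^ 'n \<Rightarrow> complex" where v: "v \<in> H2" "L2_norm v = 1" "lap v = 1" "ennreal (b - \<delta>) < ?P v"
      using b(4)[of "b - \<delta>"] \<delta> b(1) by auto
    have fin: "?P v < \<infinity>" using b(3)[OF v(1)] by (auto intro: le_less_trans)
    have P: "b - \<delta> \<le> enn2real (?P v)"
      using v(4) fin \<delta> b(1) by (cases "?P v") (auto simp: ennreal_less_iff)
    have G: "grad_sq v \<ge> c"
    proof (rule ccontr)
      assume "\<not> grad_sq v \<ge> c"
      then have "?P v \<le> ennreal (b / 2)" using v by (intro c(2)) auto
      also have "\<dots> \<le> ennreal (b - \<delta>)" using \<delta> by (intro ennreal_leI) auto
      finally show False using v(4) by simp
    qed
    \<comment> \<open>Minimises \<open>e l\<^sup>4 - 2 c l\<^sup>2\<close>, with the value \<open>- c\<^sup>2 / e\<close>.\<close>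
    define l where "l = sqrt (c / e)"
    have l: "l > 0" "l\<^sup>2 = c / e" using c e by (auto simp: l_def)
    have l4: "l ^ 4 = (c / e)\<^sup>2" using l(2) by (metis numeral_Bit0 power_add power2_eq_square)
    have "E_min TYPE('n) \<sigma> m \<le> ereal (m / mass v * (l ^ 4 * (lap v)\<^sup>2 - 2 * l\<^sup>2 * grad_sq v)
       - 1 / (\<sigma> + 1) * ((m / mass v) powr (\<sigma> + 1) * l powr (\<sigma> * real CARD('n)) * enn2real (?P v)))"
      by (rule E_min_le_scaled) (use v m l fin in auto)
    also have "\<dots> \<le> ereal (- m * c\<^sup>2 / e)"
    proof -
      have lp: "l powr (\<sigma> * real CARD('n)) = l ^ 4" unfolding \<sigma>(2) using l by (simp add: powr_numeral)
      have mp: "m powr (\<sigma> + 1) = m * m powr \<sigma>" using m by (simp add: powr_add)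
      have "m powr \<sigma> / (\<sigma> + 1) * (b - \<delta>) \<le> m powr \<sigma> / (\<sigma> + 1) * enn2real (?P v)"
        using P \<sigma> by (intro mult_left_mono) auto
      moreover have "m powr \<sigma> / (\<sigma> + 1) * (b - \<delta>) = b * m powr \<sigma> / (\<sigma> + 1) - e"
      proof -
        have "\<sigma> + 1 \<noteq> 0" "m powr \<sigma> \<noteq> 0" using \<sigma> m by auto
        then have "m powr \<sigma> / (\<sigma> + 1) * \<delta> = e" by (simp add: \<delta>_def)
        then show ?thesis by (simp only: right_diff_distrib) (simp add: mult.commute)
      qed
      moreover have "1 \<le> b * m powr \<sigma> / (\<sigma> + 1)" using bm \<sigma> by simp
      ultimately have "1 - e \<le> m powr \<sigma> / (\<sigma> + 1) * enn2real (?P v)" by linarith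
      then have A: "l ^ 4 * (1 - m powr \<sigma> / (\<sigma> + 1) * enn2real (?P v)) \<le> l ^ 4 * e"
        by (intro mult_left_mono) auto
      have Bd: "2 * l\<^sup>2 * c \<le> 2 * l\<^sup>2 * grad_sq v" using G by (intro mult_left_mono) auto
      have "l ^ 4 * (1 - m powr \<sigma> / (\<sigma> + 1) * enn2real (?P v)) - 2 * l\<^sup>2 * grad_sq v \<le> l ^ 4 * e - 2 * l\<^sup>2 * c"
        using A Bd by linarith
      also have "\<dots> = - c\<^sup>2 / e" unfolding l4 l(2) using e by (simp add: power2_eq_square field_simps)
      finally have "m * (l ^ 4 * (1 - m powr \<sigma> / (\<sigma> + 1) * enn2real (?P v)) - 2 * l\<^sup>2 * grad_sq v) \<le> m * (- c\<^sup>2 / e)"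
        using m by (intro mult_left_mono) auto
      then show ?thesis unfolding v(2,3) lp by (simp add: mp mp[unfolded add.commute[of \<sigma>]] algebra_simps)
    qed
    finally show ?thesis .
  qed
  define e0 where "e0 = m powr \<sigma> / (\<sigma> + 1) * (b / 2)"
  have e0: "e0 > 0" using m \<sigma> b by (simp add: e0_def)
  have "E_min TYPE('n) \<sigma> m \<le> ereal r" for r
  proof -
    define e where "e = min e0 (m * c\<^sup>2 / (\<bar>r\<bar> + 1))"
    have e: "e > 0" "e \<le> e0" "e \<le> m * c\<^sup>2 / (\<bar>r\<bar> + 1)" using e0 m c by (auto simp: e_def)
    have "e * (\<bar>r\<bar> + 1) \<le> m * c\<^sup>2" using e(3) by (simp add: pos_le_divide_eq)
    then have "\<bar>r\<bar> + 1 \<le> m * c\<^sup>2 / e" using e(1) by (simp add: pos_le_divide_eq mult.commute)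
    then have "- m * c\<^sup>2 / e \<le> r" by simp
    then show ?thesis using key[OF e(1)] e(2) e0_def by (meson ereal_less_eq(3) order_trans)
  qed
  then show ?thesis by (metis ereal_bot)
qed

section \<open>The minimal energy as a function of the mass\<close>

theorem proposition3p1:
  fixes \<sigma> :: real
  assumes sigma_pos: "\<sigma> > 0"
  defines "N \<equiv> real CARD('n::finite)"
  shows
    "\<comment> \<open>i\<close>
     (\<sigma> * N > 4 \<longrightarrow> (\<forall>m>0. E_min TYPE('n) \<sigma> m = - \<infinity>)) \<and>
     (\<sigma> * N \<le> 4 \<longrightarrow>
       \<comment> \<open>ii\<close>
       ereal_concave_on {0<..} (E_min TYPE('n) \<sigma>) \<and>
       \<comment> \<open>iii\<close>
       (\<forall>m>0. E_min TYPE('n) \<sigma> m \<le> ereal (- m)) \<and>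
       \<comment> \<open>iv\<close>
       (E_min TYPE('n) \<sigma> \<longlongrightarrow> 0) (at_right 0) \<and>
       ((\<lambda>m. E_min TYPE('n) \<sigma> m / ereal m) \<longlongrightarrow> -1) (at_right 0) \<and>
       \<comment> \<open>v\<close>
       (\<sigma> * N < 4 \<longrightarrow>
         (\<forall>m>0. E_min TYPE('n) \<sigma> m > - \<infinity>) \<and>
         (\<exists>A B. B > 0 \<and> (\<forall>m>0. E_min TYPE('n) \<sigma> m < ereal (A * m - B * m powr (\<sigma> + 1)))) \<and>
         ((\<lambda>m. E_min TYPE('n) \<sigma> m / ereal m) \<longlongrightarrow> - \<infinity>) at_top \<and>
         (\<forall>k1>0. \<forall>k2>0. H2_bounded
            {u :: real ^ 'n \<Rightarrow> complex. u \<in> H2 \<and> L2_norm u \<le> k1 \<and> energy \<sigma> u \<le> ereal k2})) \<and>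
       \<comment> \<open>vi\<close>
       (\<sigma> * N = 4 \<longrightarrow>
         (\<forall>m. 0 < m \<and> m < k_star TYPE('n) \<sigma> \<longrightarrow> \<bar>E_min TYPE('n) \<sigma> m\<bar> \<noteq> \<infinity>) \<and>
         (\<forall>m>0. m \<ge> k_star TYPE('n) \<sigma> \<longrightarrow> E_min TYPE('n) \<sigma> m = - \<infinity>) \<and>
         (\<forall>k1 k2. k1 < k_star TYPE('n) \<sigma> \<and> k2 > 0 \<longrightarrow> H2_bounded
            {u :: real ^ 'n \<Rightarrow> complex. u \<in> H2 \<and> (L2_norm u)\<^sup>2 \<le> k1 \<and> energy \<sigma> u \<le> ereal k2})))"
proof (intro conjI impI allI)
  fix m :: real assume "\<sigma> * N > 4" "m > 0"
  then show "E_min TYPE('n) \<sigma> m = - \<infinity>" unfolding N_def by (rule E_min_supercritical[OF sigma_pos])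
next
  assume le: "\<sigma> * N \<le> 4"
  have fin: "Lp_int (2 * \<sigma> + 2) u < \<infinity>" if "u \<in> H2" for u :: "real ^ 'n \<Rightarrow> complex"
  proof -
    obtain B where "B > 0" and B: "\<And>u :: real ^ 'n \<Rightarrow> complex. u \<in> H2 \<Longrightarrow> Lp_int (2 * \<sigma> + 2) u \<le>
      ennreal (B * (lap u powr (\<sigma> * real CARD('n) / 2) * L2_norm u powr (2 + 2 * \<sigma> - \<sigma> * real CARD('n) / 2)))"
      by (rule gagliardo_nirenberg[OF sigma_pos le[unfolded N_def]]) (rule that; blast)
    from B[OF that] show ?thesis by (rule le_less_trans) simp
  qed
  show "ereal_concave_on {0<..} (E_min TYPE('n) \<sigma>)" by (rule E_min_concave[OF sigma_pos fin])
  show "E_min TYPE('n) \<sigma> m \<le> ereal (- m)" if "m > 0" for m by (rule E_min_le_minus_mass[OF sigma_pos that])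
  show "(E_min TYPE('n) \<sigma> \<longlongrightarrow> 0) (at_right 0)" "((\<lambda>m. E_min TYPE('n) \<sigma> m / ereal m) \<longlongrightarrow> -1) (at_right 0)"
    by (rule E_min_at_0[OF sigma_pos le[unfolded N_def]])+
next
  assume lt: "\<sigma> * N < 4"
  have gt: "E_min TYPE('n) \<sigma> m > - \<infinity>" if m: "m > 0" for m
  proof -
    obtain K where "\<And>u :: real ^ 'n \<Rightarrow> complex. u \<in> H2 \<Longrightarrow> mass u \<le> m \<Longrightarrow> ereal (1 / 2 * (lap u)\<^sup>2 - K) \<le> energy \<sigma> u"
      by (rule coercive_subcritical[OF sigma_pos lt[unfolded N_def] less_imp_le[OF m]]) (rule that; blast)
    then show ?thesis by (intro E_min_gt_of_coercive[where c="1/2" and k=m]) auto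
  qed
  then show "E_min TYPE('n) \<sigma> m > - \<infinity>" if "m > 0" for m using that .
  show "\<exists>A B. B > 0 \<and> (\<forall>m>0. E_min TYPE('n) \<sigma> m < ereal (A * m - B * m powr (\<sigma> + 1)))"
  proof (rule E_min_strict_upper[OF sigma_pos])
    fix A B :: real assume "B > 0" "\<And>m. m > 0 \<Longrightarrow> E_min TYPE('n) \<sigma> m < ereal (A * m - B * m powr (\<sigma> + 1))"
    then show ?thesis by blast
  qed
  show "((\<lambda>m. E_min TYPE('n) \<sigma> m / ereal m) \<longlongrightarrow> - \<infinity>) at_top" by (rule E_min_ratio_at_top[OF sigma_pos gt])
  fix k1 k2 :: real assume k: "k1 > 0" "k2 > 0"
  obtain K where "\<And>u :: real ^ 'n \<Rightarrow> complex. u \<in> H2 \<Longrightarrow> mass u \<le> k1\<^sup>2 \<Longrightarrow> ereal (1 / 2 * (lap u)\<^sup>2 - K) \<le> energy \<sigma> u"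
    by (rule coercive_subcritical[OF sigma_pos lt[unfolded N_def] zero_le_power2[of k1]]) (rule that; blast)
  then show "H2_bounded {u :: real ^ 'n \<Rightarrow> complex. u \<in> H2 \<and> L2_norm u \<le> k1 \<and> energy \<sigma> u \<le> ereal k2}"
    by (rule H2_bounded_of_coercive[where c="1/2" and k="k1\<^sup>2" and ?k2.0=k2, rotated]) (auto intro: power_mono)
next
  assume eq: "\<sigma> * N = 4"
  show "\<bar>E_min TYPE('n) \<sigma> m\<bar> \<noteq> \<infinity>" if m: "0 < m \<and> m < k_star TYPE('n) \<sigma>" for m
  proof -
    obtain c K where "c > 0" "\<And>u :: real ^ 'n \<Rightarrow> complex. u \<in> H2 \<Longrightarrow> mass u \<le> m \<Longrightarrow> ereal (c * (lap u)\<^sup>2 - K) \<le> energy \<sigma> u"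
      by (rule coercive_critical[OF sigma_pos eq[unfolded N_def] less_imp_le[OF conjunct1[OF m]] conjunct2[OF m]]) (rule that; blast)
    then have "E_min TYPE('n) \<sigma> m > - \<infinity>" by (intro E_min_gt_of_coercive[where c=c and k=m]) auto
    moreover have "E_min TYPE('n) \<sigma> m \<le> ereal (- m)" using E_min_le_minus_mass[OF sigma_pos] m by blast
    ultimately show ?thesis by (cases "E_min TYPE('n) \<sigma> m") auto
  qed
  show "E_min TYPE('n) \<sigma> m = - \<infinity>" if "m > 0" "m \<ge> k_star TYPE('n) \<sigma>" for m
    by (rule E_min_critical_infinite[OF sigma_pos eq[unfolded N_def] that])
  fix k1 k2 :: real assume k: "k1 < k_star TYPE('n) \<sigma> \<and> k2 > 0"
  have "k_star TYPE('n) \<sigma> > 0"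
    by (rule GN_const_critical[OF sigma_pos eq[unfolded N_def]]) (rule k_star_powr(1)[OF sigma_pos])
  then have "0 \<le> max 0 k1" "max 0 k1 < k_star TYPE('n) \<sigma>" using k by auto
  then obtain c K where c: "c > 0" "\<And>u :: real ^ 'n \<Rightarrow> complex. u \<in> H2 \<Longrightarrow> mass u \<le> max 0 k1 \<Longrightarrow> ereal (c * (lap u)\<^sup>2 - K) \<le> energy \<sigma> u"
    by (rule coercive_critical[OF sigma_pos eq[unfolded N_def]]) (rule that; blast)
  show "H2_bounded {u :: real ^ 'n \<Rightarrow> complex. u \<in> H2 \<and> (L2_norm u)\<^sup>2 \<le> k1 \<and> energy \<sigma> u \<le> ereal k2}"
    by (rule H2_bounded_of_coercive[OF c(1), where k="max 0 k1" and ?k2.0=k2]) (use c in auto)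
qed

end
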